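(* For any $C^\infty$ bounded almost complex structure $\sigma$ on the two-torus $\mathbb T^2$ there exists a $C^\infty$ diffeomorphism of $\mathbb T^2$ onto an appropriate complex torus (depending on $\sigma$) that transforms $\sigma$ to the standard complex structure of that complex torus.
   Context: $\mathbb T^2=\mathbb R^2/2\pi\mathbb Z^2$ with the complex coordinate $z=x_1+ix_2$ induced from $\mathbb R^2=\mathbb C$. An almost complex structure on $\mathbb T^2$ is a family of linear complex structures on the tangent planes, compatible with the standard orientation; each one is $\sigma_\mu$ for a unique function $\mu:\mathbb T^2\to\mathbb C$, $|\mu|<1$, where $\sigma_\mu$ is the structure for which the 1-form $dz+\mu\,d\bar z$ is $\mathbb C$-linear. It is $C^\infty$ if $\mu$ is, and bounded if $\sup|\mu|<1$. A complex torus is a quotient of $\mathbb C$ by a lattice, with the complex structure induced from $\mathbb C$ (its standard complex structure). A diffeomorphism transforms $\sigma$ to the standard complex structure if its derivative at each point is a $\mathbb C$-linear map from the tangent plane equipped with $\sigma$ to the tangent plane of the complex torus with its standard structure. *)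

theory Defs
  imports "HOL-Analysis.Analysis"
begin

section \<open>Maps of class \<open>C\<^sup>\<infinity>\<close> on open sets\<close>

text \<open>
  For finite-dimensional domains this is the usual notion on an open set \<open>S\<close>: all iterated
  directional derivatives exist and are continuous.
\<close>

primrec Ck_on :: "nat \<Rightarrow> 'a::euclidean_space set \<Rightarrow> ('a \<Rightarrow> 'b::real_normed_vector) \<Rightarrow> bool" where
  "Ck_on 0 S f \<longleftrightarrow> continuous_on S f"
| "Ck_on (Suc k) S f \<longleftrightarrow>
     (\<forall>x\<in>S. f differentiable (at x)) \<and> (\<forall>v. Ck_on k S (\<lambda>x. frechet_derivative f (at x) v))"

definition smooth_on :: "'a::euclidean_space set \<Rightarrow> ('a \<Rightarrow> 'b::real_normed_vector) \<Rightarrow> bool" where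
  "smooth_on S f \<longleftrightarrow> (\<forall>k. Ck_on k S f)"


section \<open>Lattices and tori\<close>

definition lattice_gen :: "complex \<Rightarrow> complex \<Rightarrow> complex set" where
  "lattice_gen a b = {of_int m * a + of_int n * b |m n. True}"

definition is_lattice :: "complex set \<Rightarrow> bool" where
  "is_lattice \<Lambda> \<longleftrightarrow> (\<exists>a b. a \<noteq> b \<and> independent {a, b} \<and> \<Lambda> = lattice_gen a b)"

definition torus_proj :: "complex set \<Rightarrow> complex \<Rightarrow> complex set" where
  "torus_proj \<Lambda> z = {w. w - z \<in> \<Lambda>}"

text \<open>The torus \<open>\<complex>/\<Lambda>\<close>; its points are the cosets of \<open>\<Lambda>\<close>.\<close>

definition torus :: "complex set \<Rightarrow> complex set set" where
  "torus \<Lambda> = range (torus_proj \<Lambda>)"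

text \<open>\<open>\<real>\<^sup>2/2\<pi>\<int>\<^sup>2\<close>, with \<open>\<real>\<^sup>2\<close> identified with \<open>\<complex>\<close> by \<open>z = x\<^sub>1 + i x\<^sub>2\<close>.\<close>

definition \<Lambda>\<^sub>0 :: "complex set" where
  "\<Lambda>\<^sub>0 = lattice_gen (of_real (2 * pi)) (of_real (2 * pi) * \<i>)"

definition T2 :: "complex set set" where
  "T2 = torus \<Lambda>\<^sub>0"


section \<open>Maps between tori\<close>

text \<open>
  The smooth structure of \<open>\<complex>/\<Lambda>\<close> is the one whose charts are the local inverses of the
  projection. So a map of tori read in charts is a local continuous lift of it.
\<close>

definition local_lift ::
  "complex set \<Rightarrow> complex set \<Rightarrow> (complex set \<Rightarrow> complex set) \<Rightarrow> complex set \<Rightarrow> (complex \<Rightarrow> complex) \<Rightarrow> bool"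
  where
  "local_lift \<Lambda> \<Lambda>' F U f \<longleftrightarrow>
     open U \<and> continuous_on U f \<and> (\<forall>w\<in>U. F (torus_proj \<Lambda> w) = torus_proj \<Lambda>' (f w))"

definition torus_smooth ::
  "complex set \<Rightarrow> complex set \<Rightarrow> (complex set \<Rightarrow> complex set) \<Rightarrow> bool" where
  "torus_smooth \<Lambda> \<Lambda>' F \<longleftrightarrow>
     (\<forall>z. \<exists>U f. z \<in> U \<and> local_lift \<Lambda> \<Lambda>' F U f \<and> smooth_on U f)"

definition torus_diffeo ::
  "complex set \<Rightarrow> complex set \<Rightarrow> (complex set \<Rightarrow> complex set) \<Rightarrow> bool" where
  "torus_diffeo \<Lambda> \<Lambda>' F \<longleftrightarrow>
     bij_betw F (torus \<Lambda>) (torus \<Lambda>') \<and>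
     torus_smooth \<Lambda> \<Lambda>' F \<and> torus_smooth \<Lambda>' \<Lambda> (inv_into (torus \<Lambda>) F)"

text \<open>
  Every tangent plane of \<open>\<complex>/\<Lambda>\<close> is identified with \<open>\<complex>\<close> by the derivative of the projection;
  as deck transformations are translations, this does not depend on the chosen representative.
  \<open>D\<close> is the derivative of \<open>F\<close> at the point \<open>p\<close> under these identifications.
\<close>

definition torus_has_derivative ::
  "complex set \<Rightarrow> complex set \<Rightarrow> (complex set \<Rightarrow> complex set) \<Rightarrow> (complex \<Rightarrow> complex) \<Rightarrow> complex set \<Rightarrow> bool"
  where
  "torus_has_derivative \<Lambda> \<Lambda>' F D p \<longleftrightarrow>
     (\<exists>z U f. p = torus_proj \<Lambda> z \<and> z \<in> U \<and> local_lift \<Lambda> \<Lambda>' F U f \<and> (f has_derivative D) (at z))"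


section \<open>Almost complex structures\<close>

text \<open>
  A linear complex structure on \<open>\<real>\<^sup>2\<close> compatible with the orientation: \<open>Im (cnj v * w)\<close> is the
  determinant of the pair \<open>(v, w)\<close>, so the last condition says that \<open>(v, J v)\<close> is a positive basis.
\<close>

definition complex_structure :: "(complex \<Rightarrow> complex) \<Rightarrow> bool" where
  "complex_structure J \<longleftrightarrow>
     linear J \<and> (\<forall>v. J (J v) = - v) \<and> (\<forall>v. v \<noteq> 0 \<longrightarrow> Im (cnj v * J v) > 0)"

text \<open>The value at \<open>v\<close> of the 1-form \<open>dz + m d\<bar>z\<close>.\<close>

definition beltrami_form :: "complex \<Rightarrow> complex \<Rightarrow> complex" where
  "beltrami_form m v = v + m * cnj v"

definition complex_linear_wrt ::
  "(complex \<Rightarrow> complex) \<Rightarrow> (complex \<Rightarrow> complex) \<Rightarrow> (complex \<Rightarrow> complex) \<Rightarrow> bool" where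
  "complex_linear_wrt J J' L \<longleftrightarrow> linear L \<and> (\<forall>v. L (J v) = J' (L v))"

definition std_structure :: "complex \<Rightarrow> complex" where
  "std_structure v = \<i> * v"

definition beltrami_coeff :: "(complex \<Rightarrow> complex) \<Rightarrow> complex" where
  "beltrami_coeff J =
     (THE m. cmod m < 1 \<and> complex_linear_wrt J std_structure (beltrami_form m))"

text \<open>
  An almost complex structure \<open>\<sigma>\<close> on \<open>T2\<close> assigns to each point \<open>p\<close> a complex structure \<open>\<sigma> p\<close> on
  the tangent plane at \<open>p\<close>; the function \<open>\<mu>\<close> with \<open>\<sigma> = \<sigma>\<^sub>\<mu>\<close> is \<open>\<lambda>p. beltrami_coeff (\<sigma> p)\<close>.
\<close>

definition almost_complex_structure :: "(complex set \<Rightarrow> complex \<Rightarrow> complex) \<Rightarrow> bool" where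
  "almost_complex_structure \<sigma> \<longleftrightarrow> (\<forall>p\<in>T2. complex_structure (\<sigma> p))"

definition smooth_acs :: "(complex set \<Rightarrow> complex \<Rightarrow> complex) \<Rightarrow> bool" where
  "smooth_acs \<sigma> \<longleftrightarrow> smooth_on UNIV (\<lambda>z. beltrami_coeff (\<sigma> (torus_proj \<Lambda>\<^sub>0 z)))"

definition bounded_acs :: "(complex set \<Rightarrow> complex \<Rightarrow> complex) \<Rightarrow> bool" where
  "bounded_acs \<sigma> \<longleftrightarrow> (SUP p\<in>T2. cmod (beltrami_coeff (\<sigma> p))) < 1"

definition transforms_to_standard ::
  "complex set \<Rightarrow> (complex set \<Rightarrow> complex set) \<Rightarrow> (complex set \<Rightarrow> complex \<Rightarrow> complex) \<Rightarrow> bool" where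
  "transforms_to_standard \<Lambda> F \<sigma> \<longleftrightarrow>
     (\<forall>p\<in>T2. \<exists>D. torus_has_derivative \<Lambda>\<^sub>0 \<Lambda> F D p \<and> complex_linear_wrt (\<sigma> p) std_structure D)"


section \<open>Well-definedness\<close>

lemma linear_complex_form:
  assumes "linear (J :: complex \<Rightarrow> complex)"
  obtains a b where "\<And>v. J v = a * v + b * cnj v"
proof
  fix v :: complex
  have "J v = J (Re v *\<^sub>R 1 + Im v *\<^sub>R \<i>)"
    by (rule arg_cong[of _ _ J]) (simp add: complex_eq_iff)
  also have "\<dots> = of_real (Re v) * J 1 + of_real (Im v) * J \<i>"
    unfolding linear_add[OF assms] linear_scale[OF assms] by (simp add: scaleR_conv_of_real)
  also have "\<dots> = ((J 1 - \<i> * J \<i>) / 2) * v + ((J 1 + \<i> * J \<i>) / 2) * cnj v"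
    by (simp add: complex_eq_iff) (simp add: field_simps)
  finally show "J v = ((J 1 - \<i> * J \<i>) / 2) * v + ((J 1 + \<i> * J \<i>) / 2) * cnj v" .
qed

lemma complex_linear_wrt_beltrami_form:
  assumes J: "\<And>v. J v = a * v + b * cnj v"
  shows "complex_linear_wrt J std_structure (beltrami_form m) \<longleftrightarrow>
           a + m * cnj b = \<i> \<and> b + m * cnj a = \<i> * m" (is "?L \<longleftrightarrow> ?A = \<i> \<and> ?B = \<i> * m")
proof -
  have lin: "linear (beltrami_form m)"
    by (rule linearI) (auto simp: beltrami_form_def algebra_simps scaleR_conv_of_real)
  have eq: "beltrami_form m (J v) = ?A * v + ?B * cnj v" for v
    by (simp add: J beltrami_form_def algebra_simps)
  show ?thesis
  proof
    assume ?L
    then have h: "?A * v + ?B * cnj v = \<i> * (v + m * cnj v)" for v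
      by (metis eq complex_linear_wrt_def std_structure_def beltrami_form_def)
    show "?A = \<i> \<and> ?B = \<i> * m"
      using h[of 1] h[of \<i>] by (auto simp: complex_eq_iff)
  next
    assume "?A = \<i> \<and> ?B = \<i> * m"
    then have "beltrami_form m (J v) = \<i> * beltrami_form m v" for v
      by (simp only: eq) (simp add: beltrami_form_def algebra_simps)
    then show ?L
      using lin by (simp add: complex_linear_wrt_def std_structure_def)
  qed
qed

lemma complex_structure_beltrami_ex1:
  assumes "complex_structure J"
  shows "\<exists>!m. cmod m < 1 \<and> complex_linear_wrt J std_structure (beltrami_form m)"
proof -
  obtain a b where J: "\<And>v. J v = a * v + b * cnj v"
    using assms linear_complex_form complex_structure_def by metis
  have sq: "J (J v) = - v" for v using assms by (simp add: complex_structure_def)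
  have pos: "Im (cnj v * J v) > 0" if "v \<noteq> 0" for v
    using assms that by (simp add: complex_structure_def)
  have sq1: "a * (a + b) + b * cnj (a + b) = - 1"
    using sq[of 1] by (simp add: J)
  have sq2: "a * (a - b) * \<i> - b * cnj (a - b) * \<i> = - \<i>"
    using sq[of \<i>] by (simp add: J algebra_simps)
  have "\<i> * (a * (a - b) - b * cnj (a - b)) = \<i> * - 1"
    using sq2 by (simp add: algebra_simps)
  then have sq3: "a * (a - b) - b * cnj (a - b) = - 1"
    by (metis complex_i_not_zero mult_cancel_left)
  have "2 * (a * a + b * cnj b) = (a * (a + b) + b * cnj (a + b)) + (a * (a - b) - b * cnj (a - b))"
    by (simp add: algebra_simps)
  then have "2 * (a * a + b * cnj b) = 2 * - 1" by (simp only: sq1 sq3) simp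
  then have s: "a * a + b * cnj b = -1" by (metis mult_cancel_left zero_neq_numeral)
  have "2 * (b * (a + cnj a)) = (a * (a + b) + b * cnj (a + b)) - (a * (a - b) - b * cnj (a - b))"
    by (simp add: algebra_simps)
  then have "2 * (b * (a + cnj a)) = 0" by (simp only: sq1 sq3) simp
  then have t: "b * (a + cnj a) = 0" by simp
  have Ima: "Im a > 0"
    using pos[of 1] pos[of \<i>] by (simp add: J)
  have Rea: "Re a = 0"
  proof (rule ccontr)
    assume "Re a \<noteq> 0"
    then have "b = 0" using t by (auto simp: complex_eq_iff)
    then show False using s Ima \<open>Re a \<noteq> 0\<close> by (auto simp: complex_eq_iff)
  qed
  define y where "y = Im a"
  have a: "a = \<i> * of_real y" using Rea by (simp add: y_def complex_eq_iff)
  have y: "y > 0" using Ima by (simp add: y_def)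
  have b2: "b * cnj b = of_real (y\<^sup>2 - 1)"
    using s by (simp add: a power2_eq_square algebra_simps)
  have nb: "(cmod b)\<^sup>2 = y\<^sup>2 - 1"
    using b2 complex_norm_square[of b] by (metis of_real_eq_iff)
  have y1: "complex_of_real (1 + y) \<noteq> 0" using y by (metis add_pos_pos of_real_eq_0_iff order_less_irrefl zero_less_one)
  have iff: "complex_linear_wrt J std_structure (beltrami_form m) \<longleftrightarrow> m = - \<i> * b / of_real (1 + y)" for m
  proof -
    have "b + m * cnj a = \<i> * m \<longleftrightarrow> m = - \<i> * b / of_real (1 + y)"
    proof -
      have "b + m * cnj a = \<i> * m \<longleftrightarrow> b = \<i> * m * of_real (1 + y)"
        by (auto simp: a algebra_simps)
      also have "\<dots> \<longleftrightarrow> - \<i> * b = m * of_real (1 + y)"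
        by (auto simp: complex_eq_iff)
      finally show ?thesis
        using y1 by (metis nonzero_eq_divide_eq)
    qed
    moreover have "a + m * cnj b = \<i>" if "m = - \<i> * b / of_real (1 + y)"
    proof -
      have "m * cnj b = - \<i> * (b * cnj b) / of_real (1 + y)" by (simp add: that)
      also have "\<dots> = - \<i> * of_real ((y\<^sup>2 - 1) / (1 + y))" by (simp only: b2) simp
      also have "(y\<^sup>2 - 1) / (1 + y) = y - 1"
        using y by (simp add: field_simps power2_eq_square)
      finally show ?thesis by (simp add: a algebra_simps)
    qed
    ultimately show ?thesis
      using complex_linear_wrt_beltrami_form[OF J] by blast
  qed
  have "(1 + y)\<^sup>2 = (y\<^sup>2 - 1) + (2 * y + 2)" by (simp add: power2_eq_square algebra_simps)
  then have "(cmod b)\<^sup>2 < (1 + y)\<^sup>2" using nb y by linarith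
  then have "cmod b < 1 + y" using y by (intro power_less_imp_less_base[of _ 2 "1 + y"]) auto
  moreover have "cmod (- \<i> * b / of_real (1 + y)) = cmod b / (1 + y)"
    unfolding norm_divide norm_mult norm_of_real using y by simp
  ultimately have "cmod (- \<i> * b / of_real (1 + y)) < 1"
    using y by simp
  then show ?thesis unfolding iff by blast
qed

lemma is_lattice_discrete:
  assumes "is_lattice \<Lambda>"
  obtains e where "e > 0" "\<And>x y. x \<in> \<Lambda> \<Longrightarrow> y \<in> \<Lambda> \<Longrightarrow> dist x y < e \<Longrightarrow> x = y"
proof -
  obtain a b where ab: "a \<noteq> b" "independent {a, b}" and \<Lambda>: "\<Lambda> = lattice_gen a b"
    using assms is_lattice_def by auto
  define d where "d = Im (cnj a * b)"
  have nz: "a \<noteq> 0" "b \<noteq> 0" using ab dependent_zero[of "{a, b}"] by auto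
  have "d \<noteq> 0"
  proof
    assume "d = 0"
    then have eq: "Re a * Im b = Im a * Re b" by (simp add: d_def)
    have "b = (Re (cnj a * b) / (cmod a)\<^sup>2) *\<^sub>R a"
    proof -
      have n: "(cmod a)\<^sup>2 \<noteq> 0" using nz by simp
      have "cnj a * b = of_real (Re (cnj a * b))"
        using \<open>d = 0\<close> d_def by (simp add: complex_eq_iff)
      then have "a * (cnj a * b) = a * of_real (Re (cnj a * b))" by simp
      then have "of_real ((cmod a)\<^sup>2) * b = a * of_real (Re (cnj a * b))"
        by (metis complex_norm_square mult.assoc)
      then show ?thesis
        using n by (simp add: scaleR_conv_of_real field_simps)
    qed
    then have "b \<in> span {a}" by (metis span_base span_scale singletonI)
    then show False using ab by (metis independent_insert insert_commute singletonD)
  qed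
  define e where "e = \<bar>d\<bar> / (cmod a + cmod b)"
  have ab0: "cmod a > 0" "cmod b > 0" using nz by auto
  have "e > 0" using \<open>d \<noteq> 0\<close> ab0 by (simp add: e_def add_pos_pos)
  moreover have "x = y" if x: "x \<in> \<Lambda>" and y: "y \<in> \<Lambda>" and xy: "dist x y < e" for x y
  proof -
    obtain m n m' n' where "x = of_int m * a + of_int n * b" "y = of_int m' * a + of_int n' * b"
      using x y by (auto simp: \<Lambda> lattice_gen_def)
    then obtain k l where kl: "x - y = of_int k * a + of_int l * b"
      by (metis (no_types, lifting) add_diff_add left_diff_distrib of_int_diff)
    have less: "cmod (x - y) * (cmod a + cmod b) < \<bar>d\<bar>"
      using xy ab0 by (simp add: e_def dist_norm pos_less_divide_eq add_pos_pos)
    have small: "\<bar>j\<bar> < 1" if "Im (cnj c * (x - y)) = of_int j * d \<or> Im (cnj c * (x - y)) = - of_int j * d"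
      and "cmod c \<le> cmod a + cmod b" for j c
    proof -
      have "\<bar>of_int j\<bar> * \<bar>d\<bar> = \<bar>Im (cnj c * (x - y))\<bar>" using that(1) by (auto simp: abs_mult)
      also have "\<dots> \<le> cmod c * cmod (x - y)"
        by (metis abs_Im_le_cmod complex_mod_cnj norm_mult)
      also have "\<dots> \<le> cmod (x - y) * (cmod a + cmod b)"
        using mult_left_mono[OF that(2) norm_ge_zero[of "x - y"]] by (simp only: mult.commute)
      finally have "\<bar>of_int j\<bar> * \<bar>d\<bar> < 1 * \<bar>d\<bar>" using less by simp
      then have "\<bar>of_int j :: real\<bar> < 1" by (rule mult_right_less_imp_less) simp
      then show ?thesis by linarith
    qed
    have "\<bar>l\<bar> < 1"
      by (rule small[of a]) (auto simp: kl d_def algebra_simps)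
    moreover have "\<bar>k\<bar> < 1"
      by (rule small[of b]) (auto simp: kl d_def algebra_simps)
    ultimately show ?thesis using kl by simp
  qed
  ultimately show ?thesis using that by blast
qed

lemma lattice_gen_diff: "x \<in> lattice_gen a b \<Longrightarrow> y \<in> lattice_gen a b \<Longrightarrow> x - y \<in> lattice_gen a b"
  unfolding lattice_gen_def
  by (clarsimp, metis (no_types, lifting) add_diff_add left_diff_distrib of_int_diff)

lemma torus_proj_eq_iff:
  assumes "is_lattice \<Lambda>"
  shows "torus_proj \<Lambda> z = torus_proj \<Lambda> w \<longleftrightarrow> z - w \<in> \<Lambda>"
proof -
  obtain a b where \<Lambda>: "\<Lambda> = lattice_gen a b" using assms is_lattice_def by auto
  have d: "x - y \<in> \<Lambda>" if "x \<in> \<Lambda>" "y \<in> \<Lambda>" for x y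
    using lattice_gen_diff that \<Lambda> by auto
  have "0 * a + 0 * b \<in> \<Lambda>" unfolding \<Lambda> lattice_gen_def by (metis (mono_tags, lifting) mem_Collect_eq of_int_0)
  then have 0: "0 \<in> \<Lambda>" by simp
  show ?thesis
  proof
    assume "torus_proj \<Lambda> z = torus_proj \<Lambda> w"
    then show "z - w \<in> \<Lambda>" using 0 unfolding torus_proj_def by (metis (mono_tags, lifting) cancel_comm_monoid_add_class.diff_cancel mem_Collect_eq)
  next
    assume zw: "z - w \<in> \<Lambda>"
    have "u - w \<in> \<Lambda>" if "u - z \<in> \<Lambda>" for u
      using d[OF that d[OF 0 zw]] by simp
    moreover have "u - z \<in> \<Lambda>" if "u - w \<in> \<Lambda>" for u
      using d[OF that zw] by simp
    ultimately show "torus_proj \<Lambda> z = torus_proj \<Lambda> w" by (auto simp: torus_proj_def)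
  qed
qed

lemma is_lattice_\<Lambda>\<^sub>0: "is_lattice \<Lambda>\<^sub>0"
proof -
  have "of_real (2 * pi) * \<i> \<notin> span {complex_of_real (2 * pi)}"
    by (auto simp: span_singleton complex_eq_iff)
  then have "independent {of_real (2 * pi) * \<i>, complex_of_real (2 * pi)}"
    by (intro independent_insertI) (auto simp: independent_empty)
  moreover have "complex_of_real (2 * pi) \<noteq> of_real (2 * pi) * \<i>"
    by (simp add: complex_eq_iff)
  ultimately show ?thesis
    unfolding is_lattice_def \<Lambda>\<^sub>0_def by (metis insert_commute)
qed

lemma torus_has_derivative_unique:
  assumes "is_lattice \<Lambda>" "is_lattice \<Lambda>'"
    and "torus_has_derivative \<Lambda> \<Lambda>' F D p" "torus_has_derivative \<Lambda> \<Lambda>' F E p"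
  shows "D = E"
proof -
  obtain z U f where f: "p = torus_proj \<Lambda> z" "z \<in> U" "open U" "continuous_on U f"
      "\<And>w. w \<in> U \<Longrightarrow> F (torus_proj \<Lambda> w) = torus_proj \<Lambda>' (f w)" "(f has_derivative D) (at z)"
    using assms(3) unfolding torus_has_derivative_def local_lift_def by blast
  obtain z' V g where g: "p = torus_proj \<Lambda> z'" "z' \<in> V" "open V" "continuous_on V g"
      "\<And>w. w \<in> V \<Longrightarrow> F (torus_proj \<Lambda> w) = torus_proj \<Lambda>' (g w)" "(g has_derivative E) (at z')"
    using assms(4) unfolding torus_has_derivative_def local_lift_def by blast
  define c where "c = z' - z"
  have c: "c \<in> \<Lambda>" using f(1) g(1) torus_proj_eq_iff[OF assms(1)] by (metis c_def)
  have shift: "torus_proj \<Lambda> (w + c) = torus_proj \<Lambda> w" for w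
    using c by (simp add: torus_proj_eq_iff[OF assms(1)])
  define h where "h w = g (w + c) - f w" for w
  have hd: "(h has_derivative (\<lambda>v. E v - D v)) (at z)"
  proof -
    have "(g \<circ> (\<lambda>w. w + c) has_derivative (E \<circ> (\<lambda>v. v))) (at z)"
      by (rule diff_chain_at) (auto intro!: derivative_eq_intros simp: g(6) c_def)
    then have "((\<lambda>w. g (w + c)) has_derivative E) (at z)" by (simp add: o_def)
    then show ?thesis unfolding h_def using f(6) by (intro has_derivative_diff)
  qed
  obtain e where e: "e > 0" "\<And>x y. x \<in> \<Lambda>' \<Longrightarrow> y \<in> \<Lambda>' \<Longrightarrow> dist x y < e \<Longrightarrow> x = y"
    using is_lattice_discrete[OF assms(2)] by metis
  have U: "\<forall>\<^sub>F w in nhds z. w \<in> U" using f(2,3) by (simp add: eventually_nhds_in_open)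
  have "open ((\<lambda>w. w + c) -` V)" using g(3) by (intro open_vimage continuous_intros) auto
  then have "\<forall>\<^sub>F w in nhds z. w \<in> (\<lambda>w. w + c) -` V"
    using g(2) by (intro eventually_nhds_in_open) (auto simp: c_def)
  then have V: "\<forall>\<^sub>F w in nhds z. w + c \<in> V" by simp
  have L: "h w \<in> \<Lambda>'" if "w \<in> U" "w + c \<in> V" for w
    using f(5)[OF that(1)] g(5)[OF that(2)] shift[of w]
      torus_proj_eq_iff[OF assms(2), of "g (w + c)" "f w"] by (simp add: h_def)
  have "isCont h z" using hd has_derivative_continuous by blast
  then have "\<forall>\<^sub>F w in at z. dist (h w) (h z) < e"
    using e(1) by (simp add: isCont_def tendstoD)
  then have "\<forall>\<^sub>F w in nhds z. dist (h w) (h z) < e"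
    using e(1) by (simp add: eventually_nhds_conv_at)
  with U V have "\<forall>\<^sub>F w in nhds z. h w = h z"
  proof eventually_elim
    case (elim w)
    then show ?case
      using e(2)[OF L L] f(2) g(2) by (simp add: c_def)
  qed
  then have "\<forall>\<^sub>F w in at z. h w = h z" by (simp add: eventually_nhds_conv_at)
  then have "(h has_derivative (\<lambda>v. 0)) (at z)"
    by (intro has_derivative_transform_eventually[OF has_derivative_const[of "h z"]])
      (auto elim: eventually_mono)
  then have "(\<lambda>v. E v - D v) = (\<lambda>v. 0)" using hd has_derivative_unique by blast
  then show ?thesis by (auto simp: fun_eq_iff)
qed

end

theory Submission
  imports Defs
begin

text \<open>
  Let \<open>\<mu>\<close> be the coefficient of the almost complex structure, lifted to a smooth doubly periodic
  function on the plane with \<open>|\<mu>| \<le> k < 1\<close>. A diffeomorphism onto a complex torus lifts to a map \<open>H\<close> of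
  the plane that is the sum of a real-linear and a periodic map, and it transforms the structure
  to the standard one exactly if \<open>H\<^bsub>zbar\<^esub> = \<mu> H\<^bsub>z\<^esub>\<close>, that is, \<open>dH = f (dz + \<mu> d zbar)\<close> with
  \<open>f = H\<^bsub>z\<^esub>\<close> nowhere zero. So the task is to solve a linear equation, to show that \<open>f\<close> has no zeros,
  and to see that \<open>H\<close> is bijective.

  The linear equation. For \<open>h = p + b zbar - cnj b z\<close> with \<open>p\<close> periodic, the periodic function
  \<open>\<psi> = h\<^bsub>zbar\<^esub>\<close> determines \<open>h\<^bsub>z\<^esub> = B \<psi>\<close>: the operator \<open>B\<close> multiplies the nonconstant Fourier modes by
  numbers of modulus 1 and maps the mean value \<open>c\<close> to \<open>- cnj c\<close>. Hence \<open>B\<close> preserves the mean square and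
  commutes with derivatives, and \<open>h\<^bsub>zbar\<^esub> = \<mu> h\<^bsub>z\<^esub> + r\<close> becomes \<open>\<psi> = \<mu> B \<psi> + r\<close>, a contraction by the
  factor \<open>k\<close>. Iterating it from \<open>0\<close> gives smooth functions that converge in mean square. Each
  derivative of the iterates satisfies a recursion of the same form whose inhomogeneity involves
  only lower derivatives, so it stays bounded in mean square. Thus the Fourier coefficients of the limit decrease
  rapidly, and the limit is a smooth solution (\<open>beltrami_inhomogeneous\<close>).

  No zeros. The equation is solved twice. The inhomogeneity \<open>r = \<mu>\<close> gives \<open>H = z + h\<close>, and then
  \<open>f = H\<^bsub>z\<^esub>\<close> satisfies \<open>f\<^bsub>zbar\<^esub> = (\<mu> f)\<^bsub>z\<^esub>\<close>. The inhomogeneity \<open>r = \<mu>\<^bsub>z\<^esub>\<close> gives a function \<open>\<phi>\<close> such that \<open>exp \<phi>\<close>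
  satisfies the same equation as \<open>f\<close>. The quotient \<open>G = f exp (- \<phi>)\<close> satisfies \<open>G\<^bsub>zbar\<^esub> = \<mu> G\<^bsub>z\<^esub>\<close>. The linear
  part of \<open>\<phi>\<close> has purely imaginary values (this is why \<open>B\<close> maps \<open>c\<close> to \<open>- cnj c\<close>), so \<open>G\<close> is
  multiplied by numbers of modulus 1 under the periods, and \<open>cnj G dG\<close> is periodic. As its exterior derivative
  has mean value \<open>0\<close>, the functions \<open>|G\<^bsub>z\<^esub>|\<^sup>2\<close> and \<open>|G\<^bsub>zbar\<^esub>|\<^sup>2 \<le> k\<^sup>2 |G\<^bsub>z\<^esub>|\<^sup>2\<close> have the same mean value.
  Therefore \<open>G\<close> is constant, and \<open>f\<close> has no zeros unless it vanishes identically
  (\<open>energy_identity\<close>, \<open>closed_section_nonvanishing\<close>). The latter is impossible: the linear part of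
  \<open>H\<close> would vanish, but its coefficients \<open>1 - cnj b\<close> and \<open>b\<close> are never both \<open>0\<close>.

  Bijectivity. By periodicity, \<open>H\<close> expands small distances at a uniform rate. Such a map is a covering of the
  simply connected plane, hence a homeomorphism (\<open>expanding_imp_bij\<close>). Its linear part
  is injective, because otherwise the image of \<open>H\<close> would lie in a strip; so it maps the standard lattice
  onto a lattice \<open>\<Lambda>\<close>, and \<open>H\<close> descends to a diffeomorphism onto the torus of \<open>\<Lambda>\<close>.
\<close>

section \<open>The calculus of smooth maps\<close>

lemma Ck_on_SucI:
  assumes "\<And>x. (f has_derivative f' x) (at x)" and "\<And>v. Ck_on k UNIV (\<lambda>x. f' x v)"
  shows "Ck_on (Suc k) UNIV f"
proof -
  have "frechet_derivative f (at x) = f' x" for x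
    using frechet_derivative_at[OF assms(1)] by simp
  then show ?thesis
    using assms by (auto simp: differentiable_def)
qed

lemma Ck_on_SucD:
  assumes "Ck_on (Suc k) UNIV f"
  shows "(f has_derivative frechet_derivative f (at x)) (at x)"
    and "Ck_on k UNIV (\<lambda>x. frechet_derivative f (at x) v)"
  using assms by (auto simp: frechet_derivative_works)

lemma Ck_on_Suc_imp: "Ck_on (Suc k) UNIV f \<Longrightarrow> Ck_on k UNIV f"
proof (induction k arbitrary: f)
  case 0
  then show ?case
    by (auto simp: continuous_on_eq_continuous_at intro!: differentiable_imp_continuous_within)
next
  case (Suc k)
  show ?case
    by (rule Ck_on_SucI[OF Ck_on_SucD(1)[OF Suc.prems]]) (rule Suc.IH[OF Ck_on_SucD(2)[OF Suc.prems]])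
qed

lemma Ck_on_imp_continuous: "Ck_on k UNIV f \<Longrightarrow> continuous_on UNIV f"
proof (induction k)
  case (Suc k)
  then show ?case using Ck_on_Suc_imp by blast
qed simp

lemma Ck_on_const: "Ck_on k UNIV (\<lambda>x. c)"
proof (induction k arbitrary: c)
  case (Suc k)
  show ?case by (rule Ck_on_SucI[OF has_derivative_const]) (rule Suc.IH)
qed simp

lemma Ck_on_bounded_linear:
  assumes "bounded_linear L"
  shows "Ck_on k UNIV L"
proof (cases k)
  case 0
  then show ?thesis using assms by (simp add: linear_continuous_on)
next
  case (Suc n)
  show ?thesis unfolding Suc
    by (rule Ck_on_SucI[OF bounded_linear_imp_has_derivative[OF assms]]) (rule Ck_on_const)
qed

lemma Ck_on_linear_compose:
  assumes L: "bounded_linear L" and "Ck_on k UNIV f"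
  shows "Ck_on k UNIV (\<lambda>x. L (f x))"
  using assms(2)
proof (induction k arbitrary: f)
  case 0
  then show ?case
    by (auto intro: continuous_on_compose2[OF linear_continuous_on[OF L]])
next
  case (Suc k)
  show ?case
    by (rule Ck_on_SucI[OF bounded_linear.has_derivative[OF L Ck_on_SucD(1)[OF Suc.prems]]])
       (rule Suc.IH[OF Ck_on_SucD(2)[OF Suc.prems]])
qed

lemma Ck_on_add:
  assumes "Ck_on k UNIV f" "Ck_on k UNIV g"
  shows "Ck_on k UNIV (\<lambda>x. f x + g x)"
  using assms
proof (induction k arbitrary: f g)
  case 0
  then show ?case by (auto intro!: continuous_intros)
next
  case (Suc k)
  show ?case
    by (rule Ck_on_SucI[OF has_derivative_add[OF Suc.prems[THEN Ck_on_SucD(1)]]])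
       (rule Suc.IH[OF Suc.prems[THEN Ck_on_SucD(2)]])
qed

lemma Ck_on_mult:
  fixes f g :: "'a::euclidean_space \<Rightarrow> 'b::real_normed_algebra"
  assumes "Ck_on k UNIV f" "Ck_on k UNIV g"
  shows "Ck_on k UNIV (\<lambda>x. f x * g x)"
  using assms
proof (induction k arbitrary: f g)
  case 0
  then show ?case by (auto intro!: continuous_intros)
next
  case (Suc k)
  show ?case
    by (rule Ck_on_SucI[OF has_derivative_mult[OF Suc.prems[THEN Ck_on_SucD(1)]]])
       (intro Ck_on_add Suc.IH Ck_on_Suc_imp[OF Suc.prems(1)] Ck_on_Suc_imp[OF Suc.prems(2)]
         Suc.prems[THEN Ck_on_SucD(2)])
qed

lemma Ck_on_exp:
  fixes f :: "'a::euclidean_space \<Rightarrow> complex"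
  assumes "Ck_on k UNIV f"
  shows "Ck_on k UNIV (\<lambda>x. exp (f x))"
  using assms
proof (induction k)
  case 0
  then show ?case by (auto intro!: continuous_intros)
next
  case (Suc k)
  show ?case
  proof (rule Ck_on_SucI)
    show "((\<lambda>x. exp (f x)) has_derivative (\<lambda>v. exp (f x) * frechet_derivative f (at x) v)) (at x)" for x
      by (rule has_derivative_compose[OF Ck_on_SucD(1)[OF Suc.prems] DERIV_exp[unfolded has_field_derivative_def]])
    show "Ck_on k UNIV (\<lambda>x. exp (f x) * frechet_derivative f (at x) v)" for v
      by (intro Ck_on_mult Suc.IH Ck_on_Suc_imp[OF Suc.prems] Ck_on_SucD(2)[OF Suc.prems])
  qed
qed

lemma Ck_on_inverse:
  fixes f :: "'a::euclidean_space \<Rightarrow> complex"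
  assumes "Ck_on k UNIV f" and nz: "\<And>x. f x \<noteq> 0"
  shows "Ck_on k UNIV (\<lambda>x. inverse (f x))"
  using assms(1)
proof (induction k)
  case 0
  then have "continuous_on UNIV f" by simp
  then have "continuous_on UNIV (\<lambda>x. inverse (f x))" using nz by (intro continuous_on_inverse) auto
  then show ?case by simp
next
  case (Suc k)
  have i: "Ck_on k UNIV (\<lambda>x. inverse (f x))"
    by (rule Suc.IH[OF Ck_on_Suc_imp[OF Suc.prems]])
  show ?case
  proof (rule Ck_on_SucI)
    fix x v
    show "((\<lambda>x. inverse (f x)) has_derivative
        (\<lambda>v. - (inverse (f x) * frechet_derivative f (at x) v * inverse (f x)))) (at x)"
      by (rule Deriv.has_derivative_inverse[OF nz[of x] Ck_on_SucD(1)[OF Suc.prems]])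
    have "Ck_on k UNIV (\<lambda>x. inverse (f x) * frechet_derivative f (at x) v)"
      by (rule Ck_on_mult[OF i Ck_on_SucD(2)[OF Suc.prems]])
    then have "Ck_on k UNIV (\<lambda>x. inverse (f x) * frechet_derivative f (at x) v * inverse (f x))"
      using i by (rule Ck_on_mult)
    then show "Ck_on k UNIV (\<lambda>x. - (inverse (f x) * frechet_derivative f (at x) v * inverse (f x)))"
      by (rule Ck_on_linear_compose[OF bounded_linear_minus[OF bounded_linear_ident]])
  qed
qed

lemma real_linear_complex:
  assumes "linear (L :: complex \<Rightarrow> complex)"
  shows "L v = of_real (Re v) * L 1 + of_real (Im v) * L \<i>"
proof -
  have "L v = L (Re v *\<^sub>R 1 + Im v *\<^sub>R \<i>)"
    by (rule arg_cong[of _ _ L]) (simp add: complex_eq_iff)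
  then show ?thesis
    unfolding linear_add[OF assms] linear_scale[OF assms] by (simp add: scaleR_conv_of_real)
qed

text \<open>
  The derivative \<open>f' (g x) (g' x v)\<close> depends on \<open>x\<close> through \<open>g\<close> and through the argument \<open>g' x v\<close>. Expanding
  this argument in the real basis \<open>1, \<i>\<close> of the plane turns the chain rule into a sum of products
  to which the induction hypothesis applies.
\<close>

lemma Ck_on_compose:
  fixes f :: "complex \<Rightarrow> complex" and g :: "'a::euclidean_space \<Rightarrow> complex"
  assumes "Ck_on k UNIV f" "Ck_on k UNIV g"
  shows "Ck_on k UNIV (\<lambda>x. f (g x))"
  using assms
proof (induction k arbitrary: f)
  case 0
  then show ?case using continuous_on_compose2[of UNIV f UNIV g] by simp
next
  case (Suc k)
  let ?f = "\<lambda>u x. frechet_derivative f (at (g x)) u"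
  have c: "Ck_on k UNIV (?f u)" for u
    by (rule Suc.IH[OF Ck_on_SucD(2)[OF Suc.prems(1)] Ck_on_Suc_imp[OF Suc.prems(2)]])
  show ?case
  proof (rule Ck_on_SucI)
    show "((\<lambda>x. f (g x)) has_derivative (\<lambda>v. ?f (frechet_derivative g (at x) v) x)) (at x)" for x
      using has_derivative_compose[OF Ck_on_SucD(1)[OF Suc.prems(2)] Ck_on_SucD(1)[OF Suc.prems(1)]] .
    have eq: "?f (frechet_derivative g (at x) v) x =
        of_real (Re (frechet_derivative g (at x) v)) * ?f 1 x
        + of_real (Im (frechet_derivative g (at x) v)) * ?f \<i> x" for v x
      by (rule real_linear_complex)
        (rule has_derivative_linear[OF Ck_on_SucD(1)[OF Suc.prems(1)]])
    have L: "bounded_linear (\<lambda>z. of_real (Re z) :: complex)" "bounded_linear (\<lambda>z. of_real (Im z) :: complex)"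
      by (intro bounded_linear_compose[OF bounded_linear_of_real] bounded_linear_Re bounded_linear_Im)+
    show "Ck_on k UNIV (\<lambda>x. ?f (frechet_derivative g (at x) v) x)" for v
      unfolding eq
      by (rule Ck_on_add[OF Ck_on_mult[OF Ck_on_linear_compose[OF L(1)] c]
            Ck_on_mult[OF Ck_on_linear_compose[OF L(2)] c]];
          rule Ck_on_SucD(2)[OF Suc.prems(2)])
  qed
qed

definition dir_deriv :: "complex \<Rightarrow> (complex \<Rightarrow> complex) \<Rightarrow> complex \<Rightarrow> complex" where
  "dir_deriv v f z = frechet_derivative f (at z) v"

abbreviation smooth :: "(complex \<Rightarrow> complex) \<Rightarrow> bool" where
  "smooth f \<equiv> smooth_on UNIV f"

lemma smooth_has_derivative:
  assumes "smooth f"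
  shows "(f has_derivative (\<lambda>v. dir_deriv v f z)) (at z)"
proof -
  have "Ck_on (Suc 0) UNIV f" using assms unfolding smooth_on_def by blast
  then show ?thesis unfolding dir_deriv_def by (rule Ck_on_SucD(1))
qed

lemma dir_deriv_eqI: "(f has_derivative f') (at z) \<Longrightarrow> dir_deriv v f z = f' v"
  unfolding dir_deriv_def by (simp add: frechet_derivative_at[symmetric])

lemma smooth_dir_deriv: "smooth f \<Longrightarrow> smooth (dir_deriv v f)"
  unfolding smooth_on_def dir_deriv_def[abs_def] by (blast intro: Ck_on_SucD(2))

lemma smooth_continuous: "smooth f \<Longrightarrow> continuous_on A f"
  unfolding smooth_on_def by (blast intro: Ck_on_imp_continuous continuous_on_subset)

lemma smooth_const: "smooth (\<lambda>z. c)"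
  by (simp add: smooth_on_def Ck_on_const)

lemma smooth_linear: "bounded_linear L \<Longrightarrow> smooth L"
  by (simp add: smooth_on_def Ck_on_bounded_linear)

lemma smooth_add: "smooth f \<Longrightarrow> smooth g \<Longrightarrow> smooth (\<lambda>z. f z + g z)"
  by (simp add: smooth_on_def Ck_on_add)

lemma smooth_mult: "smooth f \<Longrightarrow> smooth g \<Longrightarrow> smooth (\<lambda>z. f z * g z)"
  by (simp add: smooth_on_def Ck_on_mult)

lemma smooth_uminus: "smooth f \<Longrightarrow> smooth (\<lambda>z. - f z)"
  using smooth_mult[OF smooth_const[of "-1"], of f] by simp

lemma smooth_diff: "smooth f \<Longrightarrow> smooth g \<Longrightarrow> smooth (\<lambda>z. f z - g z)"
  using smooth_add[OF _ smooth_uminus, of f g] by simp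

lemma smooth_cnj: "smooth f \<Longrightarrow> smooth (\<lambda>z. cnj (f z))"
  unfolding smooth_on_def by (blast intro: Ck_on_linear_compose[OF bounded_linear_cnj])

lemma smooth_exp: "smooth f \<Longrightarrow> smooth (\<lambda>z. exp (f z))"
  by (simp add: smooth_on_def Ck_on_exp)

lemma smooth_inverse: "smooth f \<Longrightarrow> (\<And>z. f z \<noteq> 0) \<Longrightarrow> smooth (\<lambda>z. inverse (f z))"
  by (simp add: smooth_on_def Ck_on_inverse)

lemma dir_deriv_const: "dir_deriv v (\<lambda>z. c) z = 0"
  by (rule dir_deriv_eqI) simp

lemma dir_deriv_linear: "bounded_linear L \<Longrightarrow> dir_deriv v L z = L v"
  by (rule dir_deriv_eqI) (rule bounded_linear_imp_has_derivative)

lemma dir_deriv_add: "smooth f \<Longrightarrow> smooth g \<Longrightarrow> dir_deriv v (\<lambda>z. f z + g z) z = dir_deriv v f z + dir_deriv v g z"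
  by (rule dir_deriv_eqI) (intro has_derivative_add smooth_has_derivative)

lemma dir_deriv_diff: "smooth f \<Longrightarrow> smooth g \<Longrightarrow> dir_deriv v (\<lambda>z. f z - g z) z = dir_deriv v f z - dir_deriv v g z"
  by (rule dir_deriv_eqI) (intro has_derivative_diff smooth_has_derivative)

lemma dir_deriv_mult: "smooth f \<Longrightarrow> smooth g \<Longrightarrow> dir_deriv v (\<lambda>z. f z * g z) z = f z * dir_deriv v g z + dir_deriv v f z * g z"
  by (rule dir_deriv_eqI) (intro has_derivative_mult smooth_has_derivative)

lemma dir_deriv_cnj: "smooth f \<Longrightarrow> dir_deriv v (\<lambda>z. cnj (f z)) z = cnj (dir_deriv v f z)"
  by (rule dir_deriv_eqI) (intro bounded_linear.has_derivative[OF bounded_linear_cnj] smooth_has_derivative)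

lemma dir_deriv_exp: "smooth f \<Longrightarrow> dir_deriv v (\<lambda>z. exp (f z)) z = exp (f z) * dir_deriv v f z"
  by (rule dir_deriv_eqI)
    (rule has_derivative_compose[OF smooth_has_derivative DERIV_exp[unfolded has_field_derivative_def]])

lemma dir_deriv_real_linear: "smooth f \<Longrightarrow> dir_deriv v f z = of_real (Re v) * dir_deriv 1 f z + of_real (Im v) * dir_deriv \<i> f z"
  using real_linear_complex[OF has_derivative_linear[OF smooth_has_derivative]] .

section \<open>Periodic functions and their mean values\<close>

definition periodic :: "(complex \<Rightarrow> 'a) \<Rightarrow> bool" where
  "periodic f \<longleftrightarrow> (\<forall>z::complex. f (z + 2 * pi) = f z \<and> f (z + 2 * pi * \<i>) = f z)"

definition mean :: "(complex \<Rightarrow> 'a::banach) \<Rightarrow> 'a" where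
  "mean f = (1 / (4 * pi\<^sup>2)) *\<^sub>R
     integral (cbox (0, 0) (2 * pi, 2 * pi)) (\<lambda>p. f (Complex (fst p) (snd p)))"

lemma continuous_on_Complex_fst_snd: "continuous_on A (\<lambda>p. Complex (fst p) (snd p))"
  by (simp add: Complex_eq) (intro continuous_intros)

lemma mean_integrable:
  fixes f :: "complex \<Rightarrow> 'a::banach"
  assumes "continuous_on UNIV f"
  shows "(\<lambda>p. f (Complex (fst p) (snd p))) integrable_on cbox (0, 0) (2 * pi, 2 * pi)"
  by (rule integrable_continuous) (simp add: continuous_on_compose2[OF assms continuous_on_Complex_fst_snd])

lemma mean_add:
  "continuous_on UNIV f \<Longrightarrow> continuous_on UNIV g \<Longrightarrow> mean (\<lambda>z. f z + g z) = mean f + mean g"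
  unfolding mean_def by (simp add: integral_add mean_integrable scaleR_add_right)

lemma mean_diff:
  "continuous_on UNIV f \<Longrightarrow> continuous_on UNIV g \<Longrightarrow> mean (\<lambda>z. f z - g z) = mean f - mean g"
  unfolding mean_def by (simp add: integral_diff mean_integrable scaleR_diff_right)

lemma mean_bounded_linear:
  assumes "bounded_linear L" "continuous_on UNIV f"
  shows "mean (\<lambda>z. L (f z)) = L (mean f)"
proof -
  have "integral (cbox (0, 0) (2 * pi, 2 * pi)) (L \<circ> (\<lambda>p. f (Complex (fst p) (snd p)))) =
      L (integral (cbox (0, 0) (2 * pi, 2 * pi)) (\<lambda>p. f (Complex (fst p) (snd p))))"
    by (rule integral_linear[OF mean_integrable[OF assms(2)] assms(1)])
  then show ?thesis
    unfolding mean_def by (simp add: o_def linear_scale[OF bounded_linear.linear[OF assms(1)]])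
qed

lemma mean_cmult:
  fixes f :: "complex \<Rightarrow> 'a::{banach,real_normed_algebra}"
  shows "continuous_on UNIV f \<Longrightarrow> mean (\<lambda>z. c * f z) = c * mean f"
  by (rule mean_bounded_linear[OF bounded_linear_mult_right])

lemma mean_cnj: "continuous_on UNIV f \<Longrightarrow> mean (\<lambda>z. cnj (f z)) = cnj (mean f)"
  by (rule mean_bounded_linear[OF bounded_linear_cnj])

lemma mean_of_real: "continuous_on UNIV f \<Longrightarrow> mean (\<lambda>z. complex_of_real (f z)) = of_real (mean f)"
  by (rule mean_bounded_linear[OF bounded_linear_of_real])

lemma mean_const: "mean (\<lambda>z. c) = c"
  by (simp add: mean_def content_Pair power2_eq_square)

lemma mean_sum:
  assumes "finite A" "\<And>i. i \<in> A \<Longrightarrow> continuous_on UNIV (f i)"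
  shows "mean (\<lambda>z. \<Sum>i\<in>A. f i z) = (\<Sum>i\<in>A. mean (f i))"
  using assms
proof (induction A rule: finite_induct)
  case empty
  then show ?case by (simp add: mean_const)
next
  case (insert i A)
  then have "mean (\<lambda>z. f i z + (\<Sum>i\<in>A. f i z)) = mean (f i) + mean (\<lambda>z. \<Sum>i\<in>A. f i z)"
    by (intro mean_add continuous_on_sum) auto
  then show ?case using insert by simp
qed

lemma mean_mono:
  fixes f g :: "complex \<Rightarrow> real"
  assumes "continuous_on UNIV f" "continuous_on UNIV g" "\<And>z. f z \<le> g z"
  shows "mean f \<le> mean g"
  unfolding mean_def
  by (intro scaleR_left_mono integral_le mean_integrable assms) auto

lemma mean_nonneg:
  fixes f :: "complex \<Rightarrow> real"
  assumes "continuous_on UNIV f" "\<And>z. 0 \<le> f z"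
  shows "0 \<le> mean f"
  using mean_mono[OF continuous_on_const assms] by (simp add: mean_const)

lemma norm_mean_le:
  assumes "continuous_on UNIV f"
  shows "norm (mean f) \<le> mean (\<lambda>z. norm (f z))"
proof -
  have "norm (integral (cbox (0, 0) (2 * pi, 2 * pi)) (\<lambda>p. f (Complex (fst p) (snd p))))
      \<le> integral (cbox (0, 0) (2 * pi, 2 * pi)) (\<lambda>p. norm (f (Complex (fst p) (snd p))))"
    by (rule integral_norm_bound_integral)
      (use mean_integrable[OF assms] mean_integrable[OF continuous_on_norm[OF assms]] in auto)
  then show ?thesis
    unfolding mean_def by (simp add: divide_right_mono)
qed

lemma mean_iterated:
  assumes "continuous_on UNIV f"
  shows "mean f = (1 / (4 * pi\<^sup>2)) *\<^sub>R
    integral {0..2*pi} (\<lambda>x. integral {0..2*pi} (\<lambda>y. f (Complex x y)))"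
  unfolding mean_def
  using integral_prod_continuous[of 0 0 "2*pi" "2*pi" "\<lambda>p. f (Complex (fst p) (snd p))"]
    continuous_on_compose2[OF assms continuous_on_Complex_fst_snd]
  by simp

lemma mean_iterated_swap:
  assumes "continuous_on UNIV f"
  shows "mean f = (1 / (4 * pi\<^sup>2)) *\<^sub>R
    integral {0..2*pi} (\<lambda>y. integral {0..2*pi} (\<lambda>x. f (Complex x y)))"
proof -
  have "continuous_on (cbox (0, 0) (2*pi, 2*pi)) (\<lambda>(x, y). f (Complex x y))"
    using continuous_on_compose2[OF assms continuous_on_Complex_fst_snd] by (simp add: split_def)
  from integral_swap_continuous[OF this] show ?thesis
    by (simp add: mean_iterated[OF assms])
qed

definition period :: "int \<Rightarrow> int \<Rightarrow> complex" where
  "period m n = Complex (2 * pi * m) (2 * pi * n)"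

lemma periodic_shift:
  assumes "periodic f"
  shows "f (z + period m n) = f z"
proof -
  have ind: "f (z + of_int m * c) = f z" if c: "\<And>z. f (z + c) = f z" for c z :: complex and m :: int
  proof -
    have n: "f (z + of_nat j * c) = f z" for j z
    proof (induction j)
      case (Suc j)
      then show ?case using c[of "z + of_nat j * c"] by (simp add: algebra_simps)
    qed simp
    show ?thesis
    proof (cases m rule: int_cases2)
      case (nonneg j)
      then show ?thesis using n[of z j] by simp
    next
      case (nonpos j)
      then show ?thesis using n[of "z - of_nat j * c" j] by simp
    qed
  qed
  have per: "f (z + 2 * pi) = f z" "f (z + 2 * pi * \<i>) = f z" for z :: complex
    using assms by (auto simp: periodic_def)
  show ?thesis
    using ind[OF per(1), of z m] ind[OF per(2), of "z + of_int m * (2 * pi)" n]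
    by (simp add: period_def Complex_eq algebra_simps)
qed

lemma periodic_reduce:
  fixes z :: complex
  obtains w where "Re w \<in> {0..2*pi}" "Im w \<in> {0..2*pi}"
    "\<exists>m n. z = w + period m n"
proof -
  define m where "m = \<lfloor>Re z / (2 * pi)\<rfloor>"
  define n where "n = \<lfloor>Im z / (2 * pi)\<rfloor>"
  define w where "w = Complex (Re z - 2 * pi * m) (Im z - 2 * pi * n)"
  have *: "x - 2 * pi * of_int \<lfloor>x / (2 * pi)\<rfloor> \<in> {0..2*pi}" for x :: real
  proof -
    have "of_int \<lfloor>x / (2 * pi)\<rfloor> * (2 * pi) \<le> x" "x < (of_int \<lfloor>x / (2 * pi)\<rfloor> + 1) * (2 * pi)"
      by (intro floor_divide_lower floor_divide_upper; simp)+
    then show ?thesis by (simp add: algebra_simps)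
  qed
  show thesis
  proof (rule that)
    show "Re w \<in> {0..2*pi}" "Im w \<in> {0..2*pi}" using * by (auto simp: w_def m_def n_def)
    have "z = w + period m n"
      by (simp add: w_def period_def complex_eq_iff)
    then show "\<exists>m n. z = w + period m n" by blast
  qed
qed

lemma periodic_bounded:
  fixes f :: "complex \<Rightarrow> 'a::real_normed_vector"
  assumes "periodic f" "continuous_on UNIV f"
  obtains B where "B > 0" "\<And>z. norm (f z) \<le> B"
proof -
  have "compact (f ` cbox 0 (Complex (2*pi) (2*pi)))"
    using assms(2) by (intro compact_continuous_image compact_cbox) (auto intro: continuous_on_subset)
  then obtain B where B: "B > 0" "\<And>w. w \<in> cbox 0 (Complex (2*pi) (2*pi)) \<Longrightarrow> norm (f w) \<le> B"
    using compact_imp_bounded bounded_pos by (metis image_eqI)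
  have "norm (f z) \<le> B" for z
  proof -
    obtain w m n where w: "Re w \<in> {0..2*pi}" "Im w \<in> {0..2*pi}"
      "z = w + period m n"
      using periodic_reduce[of z] by metis
    then have "w \<in> cbox 0 (Complex (2*pi) (2*pi))" by (auto simp: in_cbox_complex_iff)
    then show ?thesis using B(2) periodic_shift[OF assms(1)] w(3) by metis
  qed
  then show thesis using B(1) that by blast
qed

text \<open>
  A continuous nonnegative function with integral zero over the square vanishes there, and the
  periods carry this to the whole plane.
\<close>

lemma mean_eq_0_imp:
  fixes f :: "complex \<Rightarrow> real"
  assumes "continuous_on UNIV f" "\<And>z. 0 \<le> f z" "mean f = 0" "periodic f"
  shows "f z = 0"
proof -
  have i0: "integral (cbox (0, 0) (2 * pi, 2 * pi)) (\<lambda>p. f (Complex (fst p) (snd p))) = 0"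
    using assms(3) by (simp add: mean_def)
  have "box (0::real, 0::real) (2 * pi, 2 * pi) \<noteq> {}"
    by (simp add: box_ne_empty Basis_prod_def)
  then have 0: "f (Complex (fst p) (snd p)) = 0" if "p \<in> cbox (0, 0) (2 * pi, 2 * pi)" for p
    using integral_cbox_eq_0_iff[of "(0,0)" "(2*pi,2*pi)" "\<lambda>p. f (Complex (fst p) (snd p))"]
      continuous_on_compose2[OF assms(1) continuous_on_Complex_fst_snd] assms(2) i0 that
    by simp
  obtain w m n where w: "Re w \<in> {0..2*pi}" "Im w \<in> {0..2*pi}"
    "z = w + period m n"
    using periodic_reduce[of z] by metis
  have "f w = 0" using 0[of "(Re w, Im w)"] w by (simp add: cbox_Pair_eq)
  then show ?thesis using periodic_shift[OF assms(4)] w(3) by metis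
qed

definition smooth_periodic :: "(complex \<Rightarrow> complex) \<Rightarrow> bool" where
  "smooth_periodic f \<longleftrightarrow> smooth f \<and> periodic f"

lemma smooth_periodic_smooth: "smooth_periodic f \<Longrightarrow> smooth f"
  by (simp add: smooth_periodic_def)

lemma smooth_periodic_cont: "smooth_periodic f \<Longrightarrow> continuous_on A f"
  by (simp add: smooth_periodic_def smooth_continuous)

lemma dir_deriv_translate:
  assumes "smooth f" shows "dir_deriv v (\<lambda>z. f (z + c)) z = dir_deriv v f (z + c)"
proof (rule dir_deriv_eqI)
  have "((\<lambda>z. z + c) has_derivative (\<lambda>v. v)) (at z)"
    using has_derivative_add[OF has_derivative_ident has_derivative_const] by simp
  then show "((\<lambda>z. f (z + c)) has_derivative (\<lambda>v. dir_deriv v f (z + c))) (at z)"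
    by (rule has_derivative_compose[OF _ smooth_has_derivative[OF assms]])
qed

lemma smooth_periodic_dir_deriv: "smooth_periodic f \<Longrightarrow> smooth_periodic (dir_deriv v f)"
  unfolding smooth_periodic_def periodic_def
  using dir_deriv_translate[of f v "2*pi"] dir_deriv_translate[of f v "2*pi*\<i>"] by (simp add: smooth_dir_deriv)

lemma smooth_periodic_add: "smooth_periodic f \<Longrightarrow> smooth_periodic g \<Longrightarrow> smooth_periodic (\<lambda>z. f z + g z)"
  by (simp add: smooth_periodic_def periodic_def smooth_add)

lemma smooth_periodic_diff: "smooth_periodic f \<Longrightarrow> smooth_periodic g \<Longrightarrow> smooth_periodic (\<lambda>z. f z - g z)"
  by (simp add: smooth_periodic_def periodic_def smooth_diff)

lemma smooth_periodic_mult: "smooth_periodic f \<Longrightarrow> smooth_periodic g \<Longrightarrow> smooth_periodic (\<lambda>z. f z * g z)"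
  by (simp add: smooth_periodic_def periodic_def smooth_mult)

lemma smooth_periodic_const: "smooth_periodic (\<lambda>z. c)"
  by (simp add: smooth_periodic_def periodic_def smooth_const)

lemma smooth_periodic_cnj: "smooth_periodic f \<Longrightarrow> smooth_periodic (\<lambda>z. cnj (f z))"
  by (simp add: smooth_periodic_def periodic_def smooth_cnj)

text \<open>
  The fundamental theorem of calculus along a straight line whose end points have the same
  value under \<open>f\<close>; it is used for the two families of segments parallel to the axes.
\<close>

lemma integral_derivative_closed_curve:
  fixes \<gamma> :: "real \<Rightarrow> complex"
  assumes "smooth f" "\<And>t. (\<gamma> has_vector_derivative v) (at t)" "f (\<gamma> (2*pi)) = f (\<gamma> 0)"
  shows "integral {0..2*pi} (\<lambda>t. dir_deriv v f (\<gamma> t)) = 0"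
proof -
  have "((\<lambda>t. dir_deriv v f (\<gamma> t)) has_integral (f (\<gamma> (2*pi)) - f (\<gamma> 0))) {0..2*pi}"
  proof (rule fundamental_theorem_of_calculus)
    fix t :: real
    have "((\<lambda>t. f (\<gamma> t)) has_derivative (\<lambda>h. dir_deriv (h *\<^sub>R v) f (\<gamma> t))) (at t)"
      using has_derivative_compose[OF assms(2)[unfolded has_vector_derivative_def]
          smooth_has_derivative[OF assms(1)]] .
    moreover have "dir_deriv (h *\<^sub>R v) f (\<gamma> t) = h *\<^sub>R dir_deriv v f (\<gamma> t)" for h
      using linear_scale[OF has_derivative_linear[OF smooth_has_derivative[OF assms(1)]]] .
    ultimately show "((\<lambda>t. f (\<gamma> t)) has_vector_derivative dir_deriv v f (\<gamma> t)) (at t within {0..2*pi})"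
      by (simp add: has_vector_derivative_def has_derivative_at_withinI)
  qed simp
  then show ?thesis using assms(3) by (simp add: integral_unique)
qed

text \<open>
  Integration by parts on the torus: there is no boundary term.
\<close>

lemma mean_dir_deriv:
  assumes "smooth_periodic f"
  shows "mean (dir_deriv v f) = 0"
proof -
  have sm: "smooth f" and per: "f (z + 2 * pi) = f z" "f (z + 2 * pi * \<i>) = f z" for z :: complex
    using assms by (auto simp: smooth_periodic_def periodic_def)
  note c = smooth_continuous[OF smooth_dir_deriv[OF sm]]
  have "integral {0..2*pi} (\<lambda>t. dir_deriv 1 f (Complex t y)) = 0" for y
  proof (rule integral_derivative_closed_curve[OF sm])
    show "((\<lambda>t. Complex t y) has_vector_derivative 1) (at t)" for t
      by (auto simp: Complex_eq intro!: derivative_eq_intros)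
    show "f (Complex (2*pi) y) = f (Complex 0 y)"
      using per(1)[of "Complex 0 y"] by (simp add: Complex_eq add.commute)
  qed
  then have 1: "mean (dir_deriv 1 f) = 0" using mean_iterated_swap[OF c] by simp
  have "integral {0..2*pi} (\<lambda>t. dir_deriv \<i> f (Complex x t)) = 0" for x
  proof (rule integral_derivative_closed_curve[OF sm])
    show "((\<lambda>t. Complex x t) has_vector_derivative \<i>) (at t)" for t
      by (auto simp: Complex_eq intro!: derivative_eq_intros)
    show "f (Complex x (2*pi)) = f (Complex x 0)"
      using per(2)[of "Complex x 0"] by (simp add: Complex_eq mult.commute)
  qed
  then have 2: "mean (dir_deriv \<i> f) = 0" using mean_iterated[OF c] by simp
  have "mean (dir_deriv v f) = mean (\<lambda>z. of_real (Re v) * dir_deriv 1 f z + of_real (Im v) * dir_deriv \<i> f z)"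
    using dir_deriv_real_linear[OF sm, of v] by (intro arg_cong[of _ _ mean] ext)
  also have "\<dots> = 0"
    by (simp add: mean_add mean_cmult c continuous_on_mult_left 1 2)
  finally show ?thesis .
qed

section \<open>Fourier modes and the inequality of Bessel\<close>

text \<open>
  The modes are indexed by natural numbers, through an enumeration of pairs of integers in which \<open>0\<close>
  stands for the pair \<open>(0, 0)\<close>, so that Fourier series are ordinary series.
\<close>

definition freq_pair :: "nat \<Rightarrow> int \<times> int" where
  "freq_pair k = map_prod int_decode int_decode (prod_decode k)"

text \<open>
  For the mode with the pair \<open>(m, n)\<close> this is \<open>\<i> (m x + n y)\<close>. As a function of \<open>v\<close> it is at once the exponent
  of the mode and the multiplier by which the derivative in the direction \<open>v\<close> acts on it.
\<close>

definition freq :: "nat \<Rightarrow> complex \<Rightarrow> complex" where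
  "freq k v = \<i> * of_real (of_int (fst (freq_pair k)) * Re v + of_int (snd (freq_pair k)) * Im v)"

definition wave :: "nat \<Rightarrow> complex \<Rightarrow> complex" where
  "wave k z = exp (freq k z)"

lemma bij_freq_pair: "bij freq_pair"
proof -
  have "freq_pair = map_prod int_decode int_decode \<circ> prod_decode"
    by (auto simp: freq_pair_def fun_eq_iff)
  moreover have m: "bij (map_prod int_decode int_decode)"
    using bij_betw_map_prod[OF bij_int_decode bij_int_decode] by simp
  ultimately show ?thesis using bij_comp[OF bij_prod_decode m] by metis
qed

lemma freq_pair_0: "freq_pair 0 = (0, 0)"
proof -
  have "prod_decode 0 = (0, 0)" using prod_encode_inverse[of "(0,0)"] by (simp add: prod_encode_def)
  moreover have "int_decode 0 = 0" using int_encode_inverse[of 0] by (simp add: int_encode_def sum_encode_def)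
  ultimately show ?thesis by (simp add: freq_pair_def)
qed

lemma freq_0 [simp]: "freq 0 v = 0"
  by (simp add: freq_def freq_pair_0)

lemma freq_eq_0_iff: "freq k 1 = 0 \<and> freq k \<i> = 0 \<longleftrightarrow> k = 0"
proof
  assume "freq k 1 = 0 \<and> freq k \<i> = 0"
  then have "freq_pair k = freq_pair 0" by (simp add: freq_def freq_pair_0 prod_eq_iff)
  then show "k = 0" using bij_freq_pair by (simp add: bij_def inj_eq)
qed simp

lemma freq_inj: "freq k 1 = freq l 1 \<Longrightarrow> freq k \<i> = freq l \<i> \<Longrightarrow> k = l"
proof -
  assume "freq k 1 = freq l 1" "freq k \<i> = freq l \<i>"
  then have "freq_pair k = freq_pair l" by (simp add: freq_def prod_eq_iff)
  then show "k = l" using bij_freq_pair by (simp add: bij_def inj_eq)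
qed

lemma cnj_freq: "cnj (freq k v) = - freq k v"
  by (simp add: freq_def)

lemma Re_freq [simp]: "Re (freq k v) = 0"
  by (simp add: freq_def)

lemma bounded_linear_freq: "bounded_linear (freq k)"
  unfolding freq_def
  by (intro bounded_linear_intros bounded_linear_compose[OF bounded_linear_mult_right]
      bounded_linear_compose[OF bounded_linear_of_real] bounded_linear_Re bounded_linear_Im)

lemma wave_0 [simp]: "wave 0 z = 1"
  by (simp add: wave_def)

lemma norm_wave [simp]: "cmod (wave k z) = 1"
  by (simp add: wave_def)

lemma exp_2pi_i_int: "exp (\<i> * of_real (2 * pi * of_int m)) = 1"
  using exp_integer_2pi[of "of_int m"] by (simp add: mult_ac)

lemma smooth_periodic_wave: "smooth_periodic (wave k)"
proof -
  have "smooth (wave k)"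
    unfolding wave_def[abs_def] by (rule smooth_exp[OF smooth_linear[OF bounded_linear_freq]])
  moreover have "wave k (z + 2 * pi) = wave k z" for z :: complex
  proof -
    have "freq k (z + 2 * pi) = freq k z + \<i> * of_real (2 * pi * of_int (fst (freq_pair k)))"
      by (simp add: freq_def algebra_simps)
    then show ?thesis by (simp only: wave_def exp_add exp_2pi_i_int) simp
  qed
  moreover have "wave k (z + 2 * pi * \<i>) = wave k z" for z :: complex
  proof -
    have "freq k (z + 2 * pi * \<i>) = freq k z + \<i> * of_real (2 * pi * of_int (snd (freq_pair k)))"
      by (simp add: freq_def algebra_simps)
    then show ?thesis by (simp only: wave_def exp_add exp_2pi_i_int) simp
  qed
  ultimately show ?thesis by (simp add: smooth_periodic_def periodic_def)
qed

lemmas wave_cont = smooth_periodic_cont[OF smooth_periodic_wave]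

lemma dir_deriv_wave: "dir_deriv v (wave k) z = freq k v * wave k z"
  using dir_deriv_exp[OF smooth_linear[OF bounded_linear_freq[of k]], of v z]
    dir_deriv_linear[OF bounded_linear_freq[of k], of v z]
  by (simp add: wave_def[abs_def])

lemma wave_mult_cnj [simp]: "wave k z * cnj (wave k z) = 1"
  by (simp add: complex_norm_square[symmetric])

text \<open>
  The product is an eigenfunction of every directional derivative, with eigenvalue
  \<open>freq k v - freq l v\<close>. As derivatives have mean zero, its mean vanishes as soon as one of these eigenvalues does not.
\<close>

lemma mean_wave_wave: "mean (\<lambda>z. wave k z * cnj (wave l z)) = (if k = l then 1 else 0)"
proof (cases "k = l")
  case True
  then show ?thesis by (simp add: mean_const)
next
  case False
  let ?w = "\<lambda>z. wave k z * cnj (wave l z)"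
  have sp: "smooth_periodic ?w"
    by (intro smooth_periodic_mult smooth_periodic_cnj smooth_periodic_wave)
  have sm: "smooth (wave j)" for j by (rule smooth_periodic_smooth[OF smooth_periodic_wave])
  have "dir_deriv v ?w = (\<lambda>z. (freq k v - freq l v) * ?w z)" for v
    by (rule ext) (simp add: dir_deriv_mult sm smooth_cnj dir_deriv_cnj dir_deriv_wave cnj_freq algebra_simps)
  then have "(freq k v - freq l v) * mean ?w = 0" for v
    using mean_dir_deriv[OF sp, of v] mean_cmult[OF smooth_periodic_cont[OF sp], of "freq k v - freq l v"] by simp
  moreover have "freq k 1 \<noteq> freq l 1 \<or> freq k \<i> \<noteq> freq l \<i>" using freq_inj False by blast
  ultimately have "mean ?w = 0" by (metis eq_iff_diff_eq_0 mult_eq_0_iff)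
  then show ?thesis using False by simp
qed

definition fourier_coef :: "(complex \<Rightarrow> complex) \<Rightarrow> nat \<Rightarrow> complex" where
  "fourier_coef f k = mean (\<lambda>z. f z * cnj (wave k z))"

definition mean_sq :: "(complex \<Rightarrow> complex) \<Rightarrow> real" where
  "mean_sq f = mean (\<lambda>z. (cmod (f z))\<^sup>2)"

lemma cont_cnj_wave: "continuous_on A (\<lambda>z. cnj (wave k z))"
  by (intro continuous_intros wave_cont)

lemma fourier_coef_diff: "continuous_on UNIV f \<Longrightarrow> continuous_on UNIV g \<Longrightarrow>
    fourier_coef (\<lambda>z. f z - g z) k = fourier_coef f k - fourier_coef g k"
  unfolding fourier_coef_def by (simp add: mean_diff[symmetric] continuous_on_mult cont_cnj_wave left_diff_distrib)

lemma fourier_coef_dir_deriv: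
  assumes "smooth_periodic f"
  shows "fourier_coef (dir_deriv v f) k = freq k v * fourier_coef f k"
proof -
  have sp: "smooth_periodic (\<lambda>z. f z * cnj (wave k z))"
    by (intro smooth_periodic_mult smooth_periodic_cnj smooth_periodic_wave assms)
  have sm: "smooth f" "smooth (wave k)" using assms smooth_periodic_wave by (auto simp: smooth_periodic_def)
  have c: "continuous_on UNIV (\<lambda>z. dir_deriv v f z * cnj (wave k z))" "continuous_on UNIV (\<lambda>z. f z * cnj (wave k z))"
    using smooth_periodic_cont[OF smooth_periodic_dir_deriv[OF assms]] smooth_periodic_cont[OF sp]
    by (auto intro!: continuous_on_mult cont_cnj_wave)
  have "0 = mean (dir_deriv v (\<lambda>z. f z * cnj (wave k z)))" by (simp add: mean_dir_deriv[OF sp])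
  also have "dir_deriv v (\<lambda>z. f z * cnj (wave k z)) =
      (\<lambda>z. dir_deriv v f z * cnj (wave k z) - freq k v * (f z * cnj (wave k z)))"
    by (rule ext) (simp add: dir_deriv_mult sm smooth_cnj dir_deriv_cnj dir_deriv_wave cnj_freq algebra_simps)
  also have "mean \<dots> = fourier_coef (dir_deriv v f) k - freq k v * fourier_coef f k"
    unfolding fourier_coef_def by (simp only: mean_diff[OF c(1) continuous_on_mult_left[OF c(2)]] mean_cmult[OF c(2)])
  finally show ?thesis by simp
qed

lemma cont_cmod_sq: "continuous_on UNIV f \<Longrightarrow> continuous_on UNIV (\<lambda>z. (cmod (f z))\<^sup>2)"
  by (intro continuous_intros)

lemma mean_sq_nonneg: "continuous_on UNIV f \<Longrightarrow> 0 \<le> mean_sq f"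
  unfolding mean_sq_def by (rule mean_nonneg[OF cont_cmod_sq]) auto

lemma of_real_mean_sq: "continuous_on UNIV f \<Longrightarrow> of_real (mean_sq f) = mean (\<lambda>z. f z * cnj (f z))"
  unfolding mean_sq_def by (simp add: mean_of_real[symmetric] cont_cmod_sq complex_norm_square[symmetric] del: of_real_power)

lemma mean_wave_poly:
  assumes "finite A" "continuous_on UNIV f"
  shows "mean (\<lambda>z. f z * cnj (\<Sum>k\<in>A. c k * wave k z)) = (\<Sum>k\<in>A. cnj (c k) * fourier_coef f k)"
proof -
  have "(\<lambda>z. f z * cnj (\<Sum>k\<in>A. c k * wave k z)) = (\<lambda>z. \<Sum>k\<in>A. cnj (c k) * (f z * cnj (wave k z)))"
    by (simp add: sum_distrib_left mult.left_commute)
  then have "mean (\<lambda>z. f z * cnj (\<Sum>k\<in>A. c k * wave k z)) =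
      mean (\<lambda>z. \<Sum>k\<in>A. cnj (c k) * (f z * cnj (wave k z)))" by simp
  also have "\<dots> = (\<Sum>k\<in>A. cnj (c k) * fourier_coef f k)"
    unfolding fourier_coef_def
    by (subst mean_sum[OF assms(1)])
      (auto intro!: continuous_intros assms cont_cnj_wave simp: mean_cmult[OF continuous_on_mult[OF assms(2) cont_cnj_wave]])
  finally show ?thesis .
qed

lemma continuous_on_wave_poly: "continuous_on S (\<lambda>z. \<Sum>k\<in>A. c k * wave k z)"
  by (intro continuous_intros wave_cont)

lemma fourier_coef_poly:
  assumes "finite A"
  shows "fourier_coef (\<lambda>z. \<Sum>k\<in>A. c k * wave k z) j = (if j \<in> A then c j else 0)"
proof -
  have "(\<lambda>z. (\<Sum>k\<in>A. c k * wave k z) * cnj (wave j z)) = (\<lambda>z. \<Sum>k\<in>A. c k * (wave k z * cnj (wave j z)))"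
    by (simp add: sum_distrib_right mult.assoc)
  then have "fourier_coef (\<lambda>z. \<Sum>k\<in>A. c k * wave k z) j = mean (\<lambda>z. \<Sum>k\<in>A. c k * (wave k z * cnj (wave j z)))"
    by (simp add: fourier_coef_def)
  also have "\<dots> = (\<Sum>k\<in>A. mean (\<lambda>z. c k * (wave k z * cnj (wave j z))))"
    by (rule mean_sum[OF assms]) (intro continuous_intros wave_cont)
  also have "\<dots> = (\<Sum>k\<in>A. c k * (if k = j then 1 else 0))"
    by (simp add: mean_cmult[OF continuous_on_mult[OF wave_cont cont_cnj_wave]] mean_wave_wave)
  also have "\<dots> = (if j \<in> A then c j else 0)"
    using assms by (simp add: if_distrib sum.delta cong: if_cong)
  finally show ?thesis .
qed

lemma mean_sq_poly:
  assumes "finite A"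
  shows "mean_sq (\<lambda>z. \<Sum>k\<in>A. c k * wave k z) = (\<Sum>k\<in>A. (cmod (c k))\<^sup>2)"
proof -
  have "complex_of_real (mean_sq (\<lambda>z. \<Sum>k\<in>A. c k * wave k z)) = (\<Sum>k\<in>A. cnj (c k) * c k)"
    by (simp only: of_real_mean_sq[OF continuous_on_wave_poly] mean_wave_poly[OF assms continuous_on_wave_poly] fourier_coef_poly[OF assms])
      (auto intro: sum.cong)
  also have "\<dots> = of_real (\<Sum>k\<in>A. (cmod (c k))\<^sup>2)"
    by (simp add: complex_norm_square[symmetric] mult.commute del: of_real_power)
  finally show ?thesis by (simp only: of_real_eq_iff)
qed

text \<open>
  Both sides differ by the mean square of \<open>f\<close> minus its partial Fourier sum over \<open>A\<close>.
\<close>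

lemma bessel:
  assumes "finite A" "continuous_on UNIV f"
  shows "(\<Sum>k\<in>A. (cmod (fourier_coef f k))\<^sup>2) \<le> mean_sq f"
proof -
  let ?P = "\<lambda>z. \<Sum>k\<in>A. fourier_coef f k * wave k z"
  let ?s = "\<Sum>k\<in>A. (cmod (fourier_coef f k))\<^sup>2"
  have cP: "continuous_on UNIV ?P" by (rule continuous_on_wave_poly)
  note ci = continuous_intros assms(2) cP
  have s: "(\<Sum>k\<in>A. cnj (fourier_coef f k) * fourier_coef f k) = of_real ?s"
    by (simp add: complex_norm_square[symmetric] mult.commute del: of_real_power)
  have 1: "mean (\<lambda>z. f z * cnj (?P z)) = of_real ?s"
    using mean_wave_poly[OF assms] s by simp
  have 2: "mean (\<lambda>z. ?P z * cnj (f z)) = of_real ?s"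
  proof -
    have "mean (\<lambda>z. ?P z * cnj (f z)) = mean (\<lambda>z. cnj (f z * cnj (?P z)))"
      by (simp add: mult.commute)
    also have "\<dots> = cnj (mean (\<lambda>z. f z * cnj (?P z)))"
      by (intro mean_cnj ci)
    finally show ?thesis using 1 by simp
  qed
  have 3: "mean (\<lambda>z. ?P z * cnj (?P z)) = of_real ?s"
    using of_real_mean_sq[OF cP] mean_sq_poly[OF assms(1), of "fourier_coef f"] by simp
  have "complex_of_real (mean_sq (\<lambda>z. f z - ?P z)) = mean (\<lambda>z. (f z - ?P z) * cnj (f z - ?P z))"
    by (intro of_real_mean_sq ci)
  also have "\<dots> = mean (\<lambda>z. (f z * cnj (f z) - f z * cnj (?P z)) - (?P z * cnj (f z) - ?P z * cnj (?P z)))"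
    by (rule arg_cong[of _ _ mean]) (rule ext, simp only: complex_cnj_diff, simp only: algebra_simps)
  also have "\<dots> = (mean (\<lambda>z. f z * cnj (f z)) - mean (\<lambda>z. f z * cnj (?P z)))
      - (mean (\<lambda>z. ?P z * cnj (f z)) - mean (\<lambda>z. ?P z * cnj (?P z)))"
    by (subst mean_diff, (intro ci)+)+ (rule refl)
  also have "\<dots> = of_real (mean_sq f - ?s)"
    by (simp only: 1 2 3 of_real_mean_sq[OF assms(2), symmetric]) simp
  finally have "mean_sq (\<lambda>z. f z - ?P z) = mean_sq f - ?s" by (simp only: of_real_eq_iff)
  moreover have "0 \<le> mean_sq (\<lambda>z. f z - ?P z)" by (intro mean_sq_nonneg ci)
  ultimately show ?thesis by simp
qed

lemma fourier_coef_sq_le: "continuous_on UNIV f \<Longrightarrow> (cmod (fourier_coef f k))\<^sup>2 \<le> mean_sq f"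
  using bessel[of "{k}" f] by simp

section \<open>Uniqueness of Fourier coefficients\<close>

definition fourier1 :: "(real \<Rightarrow> complex) \<Rightarrow> int \<Rightarrow> complex" where
  "fourier1 h m = integral {0..2*pi} (\<lambda>x. h x * cis (- (of_int m * x)))"

definition index :: "int \<Rightarrow> int \<Rightarrow> nat" where
  "index m n = inv freq_pair (m, n)"

lemma freq_pair_index [simp]: "freq_pair (index m n) = (m, n)"
  unfolding index_def using bij_freq_pair by (simp add: bij_is_surj surj_f_inv_f)

lemma cnj_wave_index: "cnj (wave (index m n) (Complex x y)) = cis (- (of_int m * x)) * cis (- (of_int n * y))"
  by (simp add: wave_def freq_def cis_conv_exp exp_add[symmetric] exp_cnj algebra_simps)

text \<open>
  Extending \<open>h\<close> constantly in the other variable makes the inequality of Bessel for two variables available for one.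
  Only the values of \<open>h\<close> on the interval matter, so it is first extended by constants to the
  real line.
\<close>

lemma fourier1_eq_fourier_coef:
  assumes "continuous_on {0..2*pi} h"
  obtains f where "continuous_on UNIV f" "\<And>m. fourier1 h m = of_real (2 * pi) * fourier_coef f (index m 0)"
proof
  define f where "f z = h (max 0 (min (2*pi) (Re z)))" for z
  show cf: "continuous_on UNIV f"
    unfolding f_def by (rule continuous_on_compose2[OF assms]) (auto intro!: continuous_intros)
  fix m
  have "fourier_coef f (index m 0) = (1 / (4 * pi\<^sup>2)) *\<^sub>R
      integral {0..2*pi} (\<lambda>y. integral {0..2*pi} (\<lambda>x. f (Complex x y) * cis (- (of_int m * x))))"
    unfolding fourier_coef_def
    by (subst mean_iterated_swap) (auto intro!: continuous_on_mult cf cont_cnj_wave simp: cnj_wave_index)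
  also have "(\<lambda>y. integral {0..2*pi} (\<lambda>x. f (Complex x y) * cis (- (of_int m * x)))) = (\<lambda>y. fourier1 h m)"
    unfolding fourier1_def by (intro ext integral_cong) (simp add: f_def)
  also have "integral {0..2*pi} (\<lambda>y. fourier1 h m) = of_real (2 * pi) * fourier1 h m"
    by (simp add: scaleR_conv_of_real)
  finally show "fourier1 h m = of_real (2 * pi) * fourier_coef f (index m 0)"
    by (simp add: scaleR_conv_of_real power2_eq_square)
qed

text \<open>
  By the inequality of Bessel, the coefficients are square summable, so infinitely many of them
  cannot have the same nonzero modulus.
\<close>

lemma fourier1_const_norm_0:
  assumes h: "continuous_on {0..2*pi} h" and M: "infinite M"
    and c: "\<And>m. m \<in> M \<Longrightarrow> cmod (fourier1 h m) = c"
  shows "c = 0"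
proof (rule ccontr)
  assume "c \<noteq> 0"
  obtain f where f: "continuous_on UNIV f" "\<And>m. fourier1 h m = of_real (2 * pi) * fourier_coef f (index m 0)"
    using fourier1_eq_fourier_coef[OF h] by blast
  define d where "d = (c / (2 * pi))\<^sup>2"
  have d: "d > 0" using \<open>c \<noteq> 0\<close> by (simp add: d_def)
  obtain N :: nat where N: "mean_sq f / d < N" using reals_Archimedean2 by blast
  obtain A where A: "finite A" "card A = N" "A \<subseteq> M" using infinite_arbitrarily_large[OF M] by blast
  have inj: "inj_on (\<lambda>m. index m 0) A"
    by (rule inj_onI) (metis freq_pair_index prod.inject)
  have "(cmod (fourier_coef f (index m 0)))\<^sup>2 = d" if "m \<in> A" for m
  proof -
    have "2 * pi * cmod (fourier_coef f (index m 0)) = c"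
      using c[of m] f(2)[of m] that A(3) by (auto simp: norm_mult)
    then have "cmod (fourier_coef f (index m 0)) = c / (2 * pi)" by (simp add: field_simps)
    then show ?thesis by (simp only: d_def)
  qed
  then have "of_nat N * d = (\<Sum>m\<in>A. (cmod (fourier_coef f (index m 0)))\<^sup>2)"
    using A by simp
  also have "\<dots> = (\<Sum>k\<in>(\<lambda>m. index m 0) ` A. (cmod (fourier_coef f k))\<^sup>2)"
    by (simp add: sum.reindex[OF inj])
  also have "\<dots> \<le> mean_sq f" by (rule bessel) (use A f in auto)
  finally have "of_nat N \<le> mean_sq f / d" using d by (simp add: pos_le_divide_eq)
  then show False using N by simp
qed

lemma fourier1_one: "fourier1 (\<lambda>x. 1) m = (if m = 0 then 2 * pi else 0)"
proof -
  have "fourier_coef (\<lambda>z. 1) (index m 0) = (if m = 0 then 1 else 0)"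
  proof -
    have "index m 0 = 0 \<longleftrightarrow> m = 0"
      using inj_eq[OF bij_is_inj[OF bij_freq_pair], of "index m 0" 0] by (auto simp: freq_pair_0)
    then show ?thesis
      using mean_wave_wave[of 0 "index m 0"] by (auto simp: fourier_coef_def eq_commute[of 0])
  qed
  moreover have "fourier_coef (\<lambda>z. 1) (index m 0) = (1 / (4 * pi\<^sup>2)) *\<^sub>R
      integral {0..2*pi} (\<lambda>y. fourier1 (\<lambda>x. 1) m)"
    unfolding fourier_coef_def fourier1_def
    by (subst mean_iterated_swap) (auto intro!: cont_cnj_wave simp: cnj_wave_index)
  ultimately show ?thesis
    by (auto simp: scaleR_conv_of_real power2_eq_square field_simps split: if_splits)
qed

lemma fourier1_add_mult:
  assumes "continuous_on {0..2*pi} g"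
  shows "fourier1 (\<lambda>x. c + (cis (x - x0) - 1) * g x) m =
    c * fourier1 (\<lambda>x. 1) m + cis (- x0) * fourier1 g (m - 1) - fourier1 g m"
proof -
  have i: "(\<lambda>x. g x * cis (- (of_int j * x))) integrable_on {0..2*pi}" for j
    by (intro integrable_continuous_real continuous_intros assms)
  have i1: "(\<lambda>x. 1 * cis (- (of_int j * x))) integrable_on {0..2*pi}" for j
    by (intro integrable_continuous_real continuous_intros)
  have "(c + (cis (x - x0) - 1) * g x) * cis (- (of_int m * x)) =
      c * (1 * cis (- (of_int m * x))) + (cis (- x0) * (g x * cis (- (of_int (m - 1) * x)))
        - g x * cis (- (of_int m * x)))" for x
  proof -
    have "cis (x - x0) * cis (- (of_int m * x)) = cis (- x0) * cis (- (of_int (m - 1) * x))"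
      by (simp add: cis_mult algebra_simps)
    then show ?thesis by (simp add: algebra_simps)
  qed
  then have "fourier1 (\<lambda>x. c + (cis (x - x0) - 1) * g x) m =
      integral {0..2*pi} (\<lambda>x. c * (1 * cis (- (of_int m * x))) +
        (cis (- x0) * (g x * cis (- (of_int (m - 1) * x))) - g x * cis (- (of_int m * x))))"
    by (simp only: fourier1_def)
  also have "\<dots> = integral {0..2*pi} (\<lambda>x. c * (1 * cis (- (of_int m * x)))) +
      (integral {0..2*pi} (\<lambda>x. cis (- x0) * (g x * cis (- (of_int (m - 1) * x))))
        - integral {0..2*pi} (\<lambda>x. g x * cis (- (of_int m * x))))"
    by (subst integral_add integral_diff;
        (intro integrable_diff integrable_on_mult_right i i1)?)+ (rule refl)
  also have "\<dots> = c * fourier1 (\<lambda>x. 1) m + (cis (- x0) * fourier1 g (m - 1) - fourier1 g m)"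
    by (simp only: integral_mult_right fourier1_def)
  finally show ?thesis by simp
qed

lemma cis_eq_1_small:
  assumes "\<bar>t\<bar> < 2 * pi" "cis t = 1" shows "t = 0"
proof -
  have "cos t = 1" using assms(2) by (simp add: complex_eq_iff)
  then obtain n :: int where "t = of_int n * 2 * pi" using cos_one_2pi_int by blast
  moreover from this have "\<bar>of_int n :: real\<bar> < 1" using assms(1) by (simp add: abs_mult)
  then have "n = 0" by linarith
  ultimately show ?thesis by simp
qed

text \<open>
  Divide \<open>\<phi> - \<phi> x0\<close> by \<open>cis (x - x0) - 1\<close>. The quotient \<open>g\<close> is continuous, because \<open>\<phi>\<close> is
  differentiable at \<open>x0\<close> and \<open>x0\<close> is the only zero of the denominator. If all coefficients of \<open>\<phi>\<close> vanish,
  then consecutive coefficients of \<open>g\<close> agree up to the unimodular factor \<open>cis (- x0)\<close>, except for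
  a jump of size \<open>2 \<pi> |\<phi> x0|\<close> between the indices \<open>-1\<close> and \<open>0\<close>. Square summability makes the coefficients zero on
  both sides of the jump, so there is no jump.
\<close>

lemma fourier1_unique_at:
  assumes cont: "continuous_on {0..2*pi} \<phi>" and x0: "0 < x0" "x0 < 2 * pi"
    and der: "(\<phi> has_vector_derivative \<phi>') (at x0)"
    and zero: "\<And>m. fourier1 \<phi> m = 0"
  shows "\<phi> x0 = 0"
proof -
  define g where "g x = (if x = x0 then \<phi>' / \<i> else (\<phi> x - \<phi> x0) / (cis (x - x0) - 1))" for x
  have ne: "cis (x - x0) \<noteq> 1" if "x \<in> {0..2*pi}" "x \<noteq> x0" for x
  proof -
    have "\<bar>x - x0\<bar> < 2 * pi" using that x0 unfolding abs_less_iff atLeastAtMost_iff by linarith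
    then show ?thesis using cis_eq_1_small[of "x - x0"] that by auto
  qed
  have lim: "(g \<longlongrightarrow> \<phi>' / \<i>) (at x0)"
  proof -
    have q: "((\<lambda>x. (f x - f x0) / of_real (x - x0)) \<longlongrightarrow> D) (at x0)"
      if "(f has_vector_derivative D) (at x0)" for f :: "real \<Rightarrow> complex" and D
    proof -
      have 0: "((\<lambda>x. cmod ((f x - f x0) - (x - x0) *\<^sub>R D) / norm (x - x0)) \<longlongrightarrow> 0) (at x0)"
        using that unfolding has_vector_derivative_def has_derivative_iff_norm by blast
      have "cmod ((f x - f x0) - (x - x0) *\<^sub>R D) / norm (x - x0) = cmod ((f x - f x0) / of_real (x - x0) - D)"
        if "x \<noteq> x0" for x
      proof -
        have "(f x - f x0) / of_real (x - x0) - D = ((f x - f x0) - (x - x0) *\<^sub>R D) / of_real (x - x0)"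
          using that by (simp add: scaleR_conv_of_real field_simps)
        then show ?thesis by (simp add: norm_divide del: of_real_diff)
      qed
      then have "\<forall>\<^sub>F x in at x0. cmod ((f x - f x0) - (x - x0) *\<^sub>R D) / norm (x - x0)
          = cmod ((f x - f x0) / of_real (x - x0) - D)"
        unfolding eventually_at_filter by simp
      from Lim_transform_eventually[OF 0 this] show ?thesis
        by (rule LIM_zero_cancel[OF tendsto_norm_zero_cancel])
    qed
    have "((\<lambda>w. exp (\<i> * (w - of_real x0))) has_field_derivative \<i>) (at (of_real x0))"
      by (auto intro!: derivative_eq_intros)
    from has_vector_derivative_real_field[OF this]
    have "((\<lambda>x. cis (x - x0)) has_vector_derivative \<i>) (at x0)" by (simp add: cis_conv_exp)
    from q[OF this] have c: "((\<lambda>x. (cis (x - x0) - 1) / of_real (x - x0)) \<longlongrightarrow> \<i>) (at x0)" by simp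
    have "((\<lambda>x. ((\<phi> x - \<phi> x0) / of_real (x - x0)) / ((cis (x - x0) - 1) / of_real (x - x0))) \<longlongrightarrow> \<phi>' / \<i>) (at x0)"
      by (intro tendsto_divide q[OF der] c) simp
    moreover have "\<forall>\<^sub>F x in at x0. ((\<phi> x - \<phi> x0) / of_real (x - x0)) / ((cis (x - x0) - 1) / of_real (x - x0)) = g x"
      by (auto simp: eventually_at_filter g_def)
    ultimately show ?thesis by (rule Lim_transform_eventually)
  qed
  have cg: "continuous_on {0..2*pi} g"
    unfolding continuous_on_eq_continuous_within
  proof
    fix x assume x: "x \<in> {0..2*pi}"
    show "continuous (at x within {0..2*pi}) g"
    proof (cases "x = x0")
      case True
      have "(g \<longlongrightarrow> g x0) (at x0 within {0..2*pi})"
        by (rule tendsto_mono[OF at_le]) (use lim in \<open>auto simp: g_def\<close>)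
      then show ?thesis using True by (simp add: continuous_within)
    next
      case False
      have "continuous (at x within {0..2*pi}) \<phi>"
        using cont x by (simp add: continuous_on_eq_continuous_within)
      then have "continuous (at x within {0..2*pi}) (\<lambda>x. (\<phi> x - \<phi> x0) / (cis (x - x0) - 1))"
      proof (intro continuous_at_within_divide continuous_diff continuous_const)
        have "continuous_on UNIV (\<lambda>x. cis (x - x0))" by (intro continuous_intros)
        then show "continuous (at x within {0..2*pi}) (\<lambda>x. cis (x - x0))"
          by (simp add: continuous_on_eq_continuous_at continuous_at_imp_continuous_at_within)
      qed (use ne[OF x False] in auto)
      moreover have "\<forall>\<^sub>F y in at x within {0..2*pi}. (\<phi> y - \<phi> x0) / (cis (y - x0) - 1) = g y"
        using eventually_neq_at_within[of x0 x "{0..2*pi}"] by eventually_elim (simp add: g_def)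
      ultimately show ?thesis
        unfolding continuous_within
        using False Lim_transform_eventually[of _ "g x" _ g] by (simp add: g_def[of x])
    qed
  qed
  have "\<phi> x = \<phi> x0 + (cis (x - x0) - 1) * g x" if "x \<in> {0..2*pi}" for x
    using ne[OF that] by (auto simp: g_def)
  then have "fourier1 \<phi> m = fourier1 (\<lambda>x. \<phi> x0 + (cis (x - x0) - 1) * g x) m" for m
    unfolding fourier1_def by (intro integral_cong) auto
  then have rec: "0 = \<phi> x0 * fourier1 (\<lambda>x. 1) m + cis (- x0) * fourier1 g (m - 1) - fourier1 g m" for m
    using zero[of m] fourier1_add_mult[OF cg] by metis
  then have step: "fourier1 g m = cis (- x0) * fourier1 g (m - 1)" if "m \<noteq> 0" for m
    using rec[of m] that by (simp add: fourier1_one)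
  then have ns: "cmod (fourier1 g m) = cmod (fourier1 g (m - 1))" if "m \<noteq> 0" for m
    using that by (simp add: norm_mult)
  have up: "cmod (fourier1 g (int n)) = cmod (fourier1 g 0)" for n
    by (induction n) (use ns[of "1 + int _"] in simp_all)
  have down: "cmod (fourier1 g (- 1 - int n)) = cmod (fourier1 g (- 1))" for n
  proof (induction n)
    case (Suc n)
    then show ?case using ns[of "- 1 - int n"] by (simp add: algebra_simps)
  qed simp
  have "cmod (fourier1 g 0) = 0"
    by (rule fourier1_const_norm_0[OF cg, of "range int"])
      (use up in \<open>auto simp: finite_image_iff\<close>)
  moreover have "cmod (fourier1 g (-1)) = 0"
    by (rule fourier1_const_norm_0[OF cg, of "range (\<lambda>n. - 1 - int n)"])
      (use down in \<open>auto simp: finite_image_iff inj_on_def\<close>)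
  ultimately have "\<phi> x0 * fourier1 (\<lambda>x. 1) 0 = 0" using rec[of 0] by simp
  then show ?thesis by (simp add: fourier1_one)
qed

text \<open>
  The one-dimensional result, once in each variable: the partial coefficient
  \<open>F n x\<close>, taken in \<open>y\<close> only, has vanishing coefficients in \<open>x\<close>.
\<close>

lemma fourier_coef_eq_0_imp:
  assumes sp: "smooth_periodic f" and zero: "\<And>k. fourier_coef f k = 0"
  shows "f z = 0"
proof -
  have sm: "smooth f" and per: "periodic f" using sp by (auto simp: smooth_periodic_def)
  note cf = smooth_continuous[OF sm]
  have cC: "continuous_on A (\<lambda>p. h (Complex (fst p) (snd p)))" if "continuous_on UNIV h" for h :: "complex \<Rightarrow> complex" and A
    using continuous_on_compose2[OF that continuous_on_Complex_fst_snd] by simp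
  have dx: "((\<lambda>x. f (Complex x y)) has_vector_derivative dir_deriv 1 f (Complex x y)) (at x)" for x y
  proof -
    have "((\<lambda>x. Complex x y) has_derivative (\<lambda>h. of_real h)) (at x)"
      by (auto simp: Complex_eq intro!: derivative_eq_intros)
    from has_derivative_compose[OF this smooth_has_derivative[OF sm]]
    show ?thesis by (simp add: has_vector_derivative_def dir_deriv_real_linear[OF sm, of "of_real _"] scaleR_conv_of_real)
  qed
  have dy: "((\<lambda>y. f (Complex x y)) has_vector_derivative dir_deriv \<i> f (Complex x y)) (at y)" for x y
  proof -
    have "((\<lambda>y. Complex x y) has_derivative (\<lambda>h. \<i> * of_real h)) (at y)"
      by (auto simp: Complex_eq intro!: derivative_eq_intros)
    from has_derivative_compose[OF this smooth_has_derivative[OF sm]]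
    show ?thesis by (simp add: has_vector_derivative_def dir_deriv_real_linear[OF sm, of "\<i> * of_real _"] scaleR_conv_of_real)
  qed
  define F where "F n x = fourier1 (\<lambda>y. f (Complex x y)) n" for n x
  have dF: "(F n has_vector_derivative integral (cbox 0 (2*pi)) (\<lambda>y. dir_deriv 1 f (Complex x y) * cis (- (of_int n * y)))) (at x)" for n x
  proof -
    have "((\<lambda>x. integral (cbox 0 (2*pi)) (\<lambda>y. f (Complex x y) * cis (- (of_int n * y)))) has_vector_derivative
        integral (cbox 0 (2*pi)) (\<lambda>y. dir_deriv 1 f (Complex x y) * cis (- (of_int n * y)))) (at x within UNIV)"
    proof (rule leibniz_rule_vector_derivative)
      show "((\<lambda>x. f (Complex x y) * cis (- (of_int n * y))) has_vector_derivative
          dir_deriv 1 f (Complex x y) * cis (- (of_int n * y))) (at x within UNIV)" for x y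
        using has_vector_derivative_mult_left[OF dx] by simp
      show "(\<lambda>y. f (Complex x y) * cis (- (of_int n * y))) integrable_on cbox 0 (2*pi)" for x
        by (intro integrable_continuous continuous_intros continuous_on_compose2[OF cf[of UNIV]])
          (auto simp: Complex_eq intro!: continuous_intros)
      show "continuous_on (UNIV \<times> cbox 0 (2*pi)) (\<lambda>(x, y). dir_deriv 1 f (Complex x y) * cis (- (of_int n * y)))"
        unfolding split_def by (intro continuous_intros cC smooth_continuous smooth_dir_deriv sm)
    qed auto
    then show ?thesis by (simp add: F_def[abs_def] fourier1_def)
  qed
  have cF: "continuous_on A (F n)" for n A
    using dF has_vector_derivative_continuous continuous_at_imp_continuous_on by blast
  have F0: "F n x = 0" if "0 < x" "x < 2 * pi" for n x
  proof (rule fourier1_unique_at[OF cF that dF])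
    fix m
    have "0 = fourier_coef f (index m n)" by (simp add: zero)
    also have "\<dots> = (1 / (4 * pi\<^sup>2)) *\<^sub>R integral {0..2*pi} (\<lambda>x. integral {0..2*pi}
        (\<lambda>y. cis (- (of_int m * x)) * (f (Complex x y) * cis (- (of_int n * y)))))"
      unfolding fourier_coef_def
      by (subst mean_iterated) (auto intro!: continuous_on_mult cf cont_cnj_wave simp: cnj_wave_index mult_ac)
    also have "\<dots> = (1 / (4 * pi\<^sup>2)) *\<^sub>R fourier1 (F n) m"
      by (simp add: F_def fourier1_def mult.commute)
    finally show "fourier1 (F n) m = 0" by simp
  qed
  have f0: "f (Complex x y) = 0" if "0 < x" "x < 2 * pi" "0 < y" "y < 2 * pi" for x y
  proof (rule fourier1_unique_at[OF _ that(3,4) dy])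
    show "continuous_on {0..2*pi} (\<lambda>y. f (Complex x y))"
      by (intro continuous_on_compose2[OF cf[of UNIV]]) (auto simp: Complex_eq intro!: continuous_intros)
    show "fourier1 (\<lambda>y. f (Complex x y)) n = 0" for n
      using F0[OF that(1,2), of n] by (simp add: F_def)
  qed
  obtain w m n where w: "Re w \<in> {0..2*pi}" "Im w \<in> {0..2*pi}" "z = w + period m n"
    using periodic_reduce[of z] by metis
  let ?B = "box 0 (Complex (2*pi) (2*pi))"
  have "closure ?B = cbox 0 (Complex (2*pi) (2*pi))"
    by (rule closure_box) (auto simp: box_ne_empty Basis_complex_def)
  moreover have "f u = 0" if "u \<in> ?B" for u
    using f0[of "Re u" "Im u"] that by (simp add: in_box_complex_iff)
  moreover have "w \<in> cbox 0 (Complex (2*pi) (2*pi))" using w by (simp add: in_cbox_complex_iff)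
  ultimately have "f w = 0" using continuous_constant_on_closure[OF cf, of ?B 0 w] by simp
  then show ?thesis using periodic_shift[OF per] w(3) by simp
qed

section \<open>Rapidly decreasing Fourier series\<close>

lemma int_weight_bounded:
  obtains B :: real where "\<And>A. finite A \<Longrightarrow> (\<Sum>m\<in>A. 1 / (1 + (real_of_int m)\<^sup>2)) \<le> B"
proof
  let ?v = "\<lambda>m::int. 1 / (1 + (real_of_int m)\<^sup>2)"
  let ?u = "\<lambda>n::nat. 1 / (1 + (real n)\<^sup>2)"
  have su: "summable ?u"
  proof (rule summable_comparison_test')
    show "summable (\<lambda>n. inverse (real n ^ 2))" by (rule inverse_power_summable) simp
    show "norm (?u n) \<le> inverse (real n ^ 2)" if "1 \<le> n" for n
      using that by (simp add: inverse_eq_divide frac_le)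
  qed
  fix A :: "int set" assume A: "finite A"
  obtain N where N: "\<And>m. m \<in> A \<Longrightarrow> nat \<bar>m\<bar> \<le> N"
    using finite_imageI[OF A, of "\<lambda>m. nat \<bar>m\<bar>"] finite_nat_set_iff_bounded_le by (metis imageI)
  have sub: "A \<subseteq> int ` {..N} \<union> (\<lambda>n. - int n) ` {..N}"
  proof
    fix m assume m: "m \<in> A"
    have "m = int (nat \<bar>m\<bar>) \<or> m = - int (nat \<bar>m\<bar>)" by auto
    then show "m \<in> int ` {..N} \<union> (\<lambda>n. - int n) ` {..N}" using N[OF m] by blast
  qed
  have "sum ?v A \<le> sum ?v (int ` {..N} \<union> (\<lambda>n. - int n) ` {..N})"
    by (rule sum_mono2[OF _ sub]) auto
  also have "\<dots> \<le> sum ?v (int ` {..N}) + sum ?v ((\<lambda>n. - int n) ` {..N})"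
    by (subst sum.union_inter[symmetric]) (auto intro: sum_nonneg)
  also have "\<dots> = 2 * (\<Sum>n\<le>N. ?u n)"
    by (simp add: sum.reindex inj_on_def)
  also have "\<dots> \<le> 2 * suminf ?u"
    by (intro mult_left_mono sum_le_suminf su) auto
  finally show "sum ?v A \<le> 2 * suminf ?u" .
qed

lemma norm_freq_1: "cmod (freq k 1) = \<bar>real_of_int (fst (freq_pair k))\<bar>"
  by (simp add: freq_def norm_mult)

lemma norm_freq_i: "cmod (freq k \<i>) = \<bar>real_of_int (snd (freq_pair k))\<bar>"
  by (simp add: freq_def norm_mult)

lemma summable_weight: "summable (\<lambda>k. 1 / ((1 + (cmod (freq k 1))\<^sup>2) * (1 + (cmod (freq k \<i>))\<^sup>2)))"
proof -
  let ?v = "\<lambda>m::int. 1 / (1 + (real_of_int m)\<^sup>2)"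
  obtain B where B: "\<And>A. finite A \<Longrightarrow> sum ?v A \<le> B" using int_weight_bounded by blast
  show ?thesis
  proof (rule summableI_nonneg_bounded)
    fix K
    let ?P = "freq_pair ` {..<K}"
    have "(\<Sum>k<K. 1 / ((1 + (cmod (freq k 1))\<^sup>2) * (1 + (cmod (freq k \<i>))\<^sup>2))) =
        (\<Sum>k<K. ?v (fst (freq_pair k)) * ?v (snd (freq_pair k)))"
      by (simp add: norm_freq_1 norm_freq_i)
    also have "\<dots> = (\<Sum>p\<in>?P. ?v (fst p) * ?v (snd p))"
      by (subst sum.reindex) (auto intro: inj_on_subset[OF bij_is_inj[OF bij_freq_pair]])
    also have "\<dots> \<le> (\<Sum>p\<in>fst ` ?P \<times> snd ` ?P. ?v (fst p) * ?v (snd p))"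
      by (rule sum_mono2[OF _ subset_fst_snd]) auto
    also have "\<dots> = sum ?v (fst ` ?P) * sum ?v (snd ` ?P)"
      by (simp add: sum_product sum.cartesian_product case_prod_unfold)
    also have "\<dots> \<le> B * B"
      by (intro mult_mono B sum_nonneg) (auto intro: order_trans[OF _ B[of "{}"]])
    finally show "(\<Sum>k<K. 1 / ((1 + (cmod (freq k 1))\<^sup>2) * (1 + (cmod (freq k \<i>))\<^sup>2))) \<le> B * B" .
  qed auto
qed

text \<open>
  Since \<open>freq k 1\<close> and \<open>freq k \<i>\<close> are \<open>\<i>\<close> times the integers that label the mode \<open>k\<close>, this is decay
  faster than any power of the frequency.
\<close>

definition rapid :: "(nat \<Rightarrow> complex) \<Rightarrow> bool" where
  "rapid c \<longleftrightarrow> (\<forall>p q. \<exists>C. \<forall>k. cmod (freq k 1) ^ p * cmod (freq k \<i>) ^ q * cmod (c k) \<le> C)"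

lemma rapid_mono:
  assumes "rapid c" "\<And>k. cmod (d k) \<le> M * cmod (c k)" "M \<ge> 0"
  shows "rapid d"
  unfolding rapid_def
proof (intro allI)
  fix p q
  obtain C where C: "\<And>k. cmod (freq k 1) ^ p * cmod (freq k \<i>) ^ q * cmod (c k) \<le> C"
    using assms(1) unfolding rapid_def by blast
  have "cmod (freq k 1) ^ p * cmod (freq k \<i>) ^ q * cmod (d k) \<le> M * C" for k
  proof -
    have "cmod (freq k 1) ^ p * cmod (freq k \<i>) ^ q * cmod (d k)
        \<le> cmod (freq k 1) ^ p * cmod (freq k \<i>) ^ q * (M * cmod (c k))"
      by (intro mult_left_mono assms) auto
    also have "\<dots> = M * (cmod (freq k 1) ^ p * cmod (freq k \<i>) ^ q * cmod (c k))" by simp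
    also have "\<dots> \<le> M * C" by (intro mult_left_mono C assms)
    finally show ?thesis .
  qed
  then show "\<exists>C. \<forall>k. cmod (freq k 1) ^ p * cmod (freq k \<i>) ^ q * cmod (d k) \<le> C" by blast
qed

lemma rapid_add:
  assumes "rapid c" "rapid d"
  shows "rapid (\<lambda>k. c k + d k)"
  unfolding rapid_def
proof (intro allI)
  fix p q
  obtain C D where C: "\<And>k. cmod (freq k 1) ^ p * cmod (freq k \<i>) ^ q * cmod (c k) \<le> C"
    and D: "\<And>k. cmod (freq k 1) ^ p * cmod (freq k \<i>) ^ q * cmod (d k) \<le> D"
    using assms unfolding rapid_def by meson
  have "cmod (freq k 1) ^ p * cmod (freq k \<i>) ^ q * cmod (c k + d k) \<le> C + D" for k
  proof -
    have "cmod (freq k 1) ^ p * cmod (freq k \<i>) ^ q * cmod (c k + d k)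
        \<le> cmod (freq k 1) ^ p * cmod (freq k \<i>) ^ q * (cmod (c k) + cmod (d k))"
      by (intro mult_left_mono norm_triangle_ineq) auto
    then show ?thesis using C[of k] D[of k] by (simp only: distrib_left)
  qed
  then show "\<exists>C. \<forall>k. cmod (freq k 1) ^ p * cmod (freq k \<i>) ^ q * cmod (c k + d k) \<le> C" by blast
qed

lemma freq_linear: "freq k v = of_real (Re v) * freq k 1 + of_real (Im v) * freq k \<i>"
  by (simp add: freq_def algebra_simps)

lemma rapid_freq_basis:
  assumes "rapid c" shows "rapid (\<lambda>k. freq k 1 * c k)" "rapid (\<lambda>k. freq k \<i> * c k)"
proof -
  have 1: "\<exists>C. \<forall>k. cmod (freq k 1) ^ Suc p * cmod (freq k \<i>) ^ q * cmod (c k) \<le> C"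
    and 2: "\<exists>C. \<forall>k. cmod (freq k 1) ^ p * cmod (freq k \<i>) ^ Suc q * cmod (c k) \<le> C" for p q
    using assms unfolding rapid_def by blast+
  show "rapid (\<lambda>k. freq k 1 * c k)" "rapid (\<lambda>k. freq k \<i> * c k)"
    unfolding rapid_def norm_mult using 1 2 by (simp_all add: mult_ac)
qed

lemma rapid_freq:
  assumes "rapid c" shows "rapid (\<lambda>k. freq k v * c k)"
proof -
  have "rapid (\<lambda>k. of_real (Re v) * (freq k 1 * c k))" "rapid (\<lambda>k. of_real (Im v) * (freq k \<i> * c k))"
    by (rule rapid_mono[OF rapid_freq_basis(1)[OF assms], of _ "\<bar>Re v\<bar>"] rapid_mono[OF rapid_freq_basis(2)[OF assms], of _ "\<bar>Im v\<bar>"];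
        simp add: norm_mult)+
  from rapid_add[OF this] show ?thesis
    by (simp add: freq_linear[of _ v] algebra_simps)
qed

lemma rapid_summable:
  assumes "rapid c" shows "summable (\<lambda>k. cmod (c k))"
proof -
  have ex: "\<exists>C. \<forall>k. cmod (freq k 1) ^ p * cmod (freq k \<i>) ^ q * cmod (c k) \<le> C" for p q
    using assms unfolding rapid_def by blast
  obtain C1 C2 C3 C4 where C:
    "\<And>k. cmod (freq k 1) ^ 0 * cmod (freq k \<i>) ^ 0 * cmod (c k) \<le> C1"
    "\<And>k. cmod (freq k 1) ^ 2 * cmod (freq k \<i>) ^ 0 * cmod (c k) \<le> C2"
    "\<And>k. cmod (freq k 1) ^ 0 * cmod (freq k \<i>) ^ 2 * cmod (c k) \<le> C3"
    "\<And>k. cmod (freq k 1) ^ 2 * cmod (freq k \<i>) ^ 2 * cmod (c k) \<le> C4"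
    using ex by meson
  define D where "D = C1 + C2 + C3 + C4"
  have "summable (\<lambda>k. D * (1 / ((1 + (cmod (freq k 1))\<^sup>2) * (1 + (cmod (freq k \<i>))\<^sup>2))))"
    by (intro summable_mult summable_weight)
  then show ?thesis
  proof (rule summable_comparison_test'[where N = 0])
    fix k
    let ?W = "(1 + (cmod (freq k 1))\<^sup>2) * (1 + (cmod (freq k \<i>))\<^sup>2)"
    have "?W > 0" by (intro mult_pos_pos add_pos_nonneg) auto
    moreover have "cmod (c k) * ?W \<le> D"
      using C[of k] by (simp add: D_def algebra_simps)
    ultimately show "norm (cmod (c k)) \<le> D * (1 / ?W)"
      by (simp add: pos_le_divide_eq)
  qed
qed

definition fourier_series :: "(nat \<Rightarrow> complex) \<Rightarrow> complex \<Rightarrow> complex" where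
  "fourier_series c z = (\<Sum>k. c k * wave k z)"

lemma fourier_series_summable: "rapid c \<Longrightarrow> summable (\<lambda>k. c k * wave k z)"
  by (rule summable_norm_cancel) (simp add: norm_mult rapid_summable)

lemma fourier_series_sums: "rapid c \<Longrightarrow> (\<lambda>k. c k * wave k z) sums fourier_series c z"
  unfolding fourier_series_def using fourier_series_summable by (rule summable_sums)

lemma fourier_series_add: "rapid c \<Longrightarrow> rapid d \<Longrightarrow> fourier_series (\<lambda>k. c k + d k) z = fourier_series c z + fourier_series d z"
  unfolding fourier_series_def by (simp add: suminf_add[OF fourier_series_summable fourier_series_summable] distrib_right)

lemma fourier_series_diff: "rapid c \<Longrightarrow> rapid d \<Longrightarrow> fourier_series (\<lambda>k. c k - d k) z = fourier_series c z - fourier_series d z"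
  unfolding fourier_series_def by (simp add: suminf_diff[OF fourier_series_summable fourier_series_summable] left_diff_distrib)

lemma fourier_series_cmult: "rapid c \<Longrightarrow> fourier_series (\<lambda>k. a * c k) z = a * fourier_series c z"
  unfolding fourier_series_def by (simp add: suminf_mult[OF fourier_series_summable] mult.assoc)

lemma fourier_series_single: "fourier_series (\<lambda>k. if k = 0 then b else 0) z = b"
proof -
  have "(\<lambda>k. (if k = 0 then b else 0) * wave k z) sums (\<Sum>k\<in>{0}. (if k = 0 then b else 0) * wave k z)"
    by (rule sums_finite) auto
  then show ?thesis by (simp add: fourier_series_def sums_iff)
qed

lemma fourier_series_uniform:
  "rapid c \<Longrightarrow> uniform_limit UNIV (\<lambda>n z. \<Sum>k<n. c k * wave k z) (fourier_series c) sequentially"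
  unfolding fourier_series_def[abs_def]
  by (rule Weierstrass_m_test[where M = "\<lambda>k. cmod (c k)"]) (auto simp: norm_mult rapid_summable)

lemma fourier_series_tail:
  assumes "rapid c" "e > 0"
  shows "\<forall>\<^sub>F n in sequentially. \<forall>z. cmod ((\<Sum>k<n. c k * wave k z) - fourier_series c z) \<le> e"
  using uniform_limitD[OF fourier_series_uniform[OF assms(1)] assms(2)]
  by (auto simp: dist_norm elim!: eventually_mono intro: less_imp_le)

lemma fourier_series_freq_linear:
  assumes "rapid c"
  shows "fourier_series (\<lambda>k. freq k v * c k) z =
    of_real (Re v) * fourier_series (\<lambda>k. freq k 1 * c k) z + of_real (Im v) * fourier_series (\<lambda>k. freq k \<i> * c k) z"
proof -
  note r = rapid_freq_basis[OF assms]
  have r': "rapid (\<lambda>k. a * (freq k 1 * c k))" "rapid (\<lambda>k. a * (freq k \<i> * c k))" for a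
    by (rule rapid_mono[OF r(1), of _ "cmod a"] rapid_mono[OF r(2), of _ "cmod a"]; simp add: norm_mult)+
  have "(\<lambda>k. freq k v * c k) =
      (\<lambda>k. of_real (Re v) * (freq k 1 * c k) + of_real (Im v) * (freq k \<i> * c k))"
    by (rule ext) (simp add: freq_linear[of _ v] algebra_simps)
  then show ?thesis
    by (simp only: fourier_series_add[OF r'] fourier_series_cmult[OF r(1)] fourier_series_cmult[OF r(2)])
qed

text \<open>
  Differentiation multiplies the coefficients by \<open>freq k v\<close>, which preserves rapid decay; so the
  derivative is again a series of the same kind, and smoothness follows by induction.
\<close>

lemma fourier_series_has_derivative:
  assumes "rapid c"
  shows "(fourier_series c has_derivative (\<lambda>v. fourier_series (\<lambda>k. freq k v * c k) z)) (at z)"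
proof -
  let ?S = "\<lambda>c n z. \<Sum>k<n. c k * wave k z"
  note r = rapid_freq_basis[OF assms]
  have "\<exists>g. \<forall>x\<in>UNIV. (\<lambda>n. c n * wave n x) sums g x \<and>
      (g has_derivative (\<lambda>v. fourier_series (\<lambda>k. freq k v * c k) x)) (at x within UNIV)"
  proof (rule has_derivative_series)
    show "((\<lambda>x. c n * wave n x) has_derivative (\<lambda>v. freq n v * c n * wave n x)) (at x within UNIV)" for n x
      using has_derivative_mult_right[OF smooth_has_derivative[OF smooth_periodic_smooth[OF smooth_periodic_wave[of n]], of x], of "c n"]
      by (simp add: dir_deriv_wave mult_ac)
    fix e :: real assume e: "e > 0"
    have "\<forall>\<^sub>F n in sequentially. (\<forall>z. cmod (?S (\<lambda>k. freq k 1 * c k) n z - fourier_series (\<lambda>k. freq k 1 * c k) z) \<le> e/2)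
        \<and> (\<forall>z. cmod (?S (\<lambda>k. freq k \<i> * c k) n z - fourier_series (\<lambda>k. freq k \<i> * c k) z) \<le> e/2)"
      using e by (intro eventually_conj fourier_series_tail r) auto
    then show "\<forall>\<^sub>F n in sequentially. \<forall>x\<in>UNIV. \<forall>h.
        norm ((\<Sum>i<n. freq i h * c i * wave i x) - fourier_series (\<lambda>k. freq k h * c k) x) \<le> e * norm h"
    proof eventually_elim
      case (elim n)
      show ?case
      proof (intro ballI allI)
        fix x h
        let ?d1 = "?S (\<lambda>k. freq k 1 * c k) n x - fourier_series (\<lambda>k. freq k 1 * c k) x"
        let ?d2 = "?S (\<lambda>k. freq k \<i> * c k) n x - fourier_series (\<lambda>k. freq k \<i> * c k) x"
        have "(\<Sum>i<n. freq i h * c i * wave i x) =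
            of_real (Re h) * ?S (\<lambda>k. freq k 1 * c k) n x + of_real (Im h) * ?S (\<lambda>k. freq k \<i> * c k) n x"
          unfolding sum_distrib_left sum.distrib[symmetric]
          by (rule sum.cong[OF refl]) (simp add: freq_linear[of _ h] algebra_simps)
        then have eq: "(\<Sum>i<n. freq i h * c i * wave i x) - fourier_series (\<lambda>k. freq k h * c k) x =
            of_real (Re h) * ?d1 + of_real (Im h) * ?d2"
          by (simp only: fourier_series_freq_linear[OF assms, of h]) (simp add: algebra_simps)
        have "cmod (of_real (Re h) * ?d1 + of_real (Im h) * ?d2) \<le> \<bar>Re h\<bar> * cmod ?d1 + \<bar>Im h\<bar> * cmod ?d2"
          by (rule order_trans[OF norm_triangle_ineq]) (simp add: norm_mult)
        also have "\<dots> \<le> cmod h * (e/2) + cmod h * (e/2)"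
          by (intro add_mono mult_mono abs_Re_le_cmod abs_Im_le_cmod norm_ge_zero elim[THEN conjunct1, rule_format]
              elim[THEN conjunct2, rule_format])
        also have "\<dots> = e * norm h" by (simp add: field_simps)
        finally show "norm ((\<Sum>i<n. freq i h * c i * wave i x) - fourier_series (\<lambda>k. freq k h * c k) x) \<le> e * norm h"
          by (simp only: eq)
      qed
    qed
  qed (use fourier_series_sums[OF assms] in auto)
  then obtain g where g: "\<And>x. (\<lambda>n. c n * wave n x) sums g x"
    "\<And>x. (g has_derivative (\<lambda>v. fourier_series (\<lambda>k. freq k v * c k) x)) (at x)" by auto
  have "g = fourier_series c" using sums_unique2[OF g(1) fourier_series_sums[OF assms]] by auto
  then show ?thesis using g(2) by simp
qed

lemma fourier_series_Ck: "rapid c \<Longrightarrow> Ck_on n UNIV (fourier_series c)"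
proof (induction n arbitrary: c)
  case 0
  then show ?case
    using has_derivative_continuous[OF fourier_series_has_derivative[OF 0]]
    by (simp add: continuous_on_eq_continuous_at)
next
  case (Suc n)
  show ?case
    by (rule Ck_on_SucI[OF fourier_series_has_derivative[OF Suc.prems]]) (rule Suc.IH[OF rapid_freq[OF Suc.prems]])
qed

lemma smooth_periodic_fourier_series: "rapid c \<Longrightarrow> smooth_periodic (fourier_series c)"
  using smooth_periodic_wave unfolding smooth_periodic_def periodic_def
  by (simp add: smooth_on_def fourier_series_Ck fourier_series_def)

lemma dir_deriv_fourier_series: "rapid c \<Longrightarrow> dir_deriv v (fourier_series c) z = fourier_series (\<lambda>k. freq k v * c k) z"
  by (rule dir_deriv_eqI[OF fourier_series_has_derivative])

lemma fourier_coef_fourier_series: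
  assumes "rapid c" shows "fourier_coef (fourier_series c) j = c j"
proof -
  note cs = smooth_periodic_cont[OF smooth_periodic_fourier_series[OF assms]]
  have "cmod (fourier_coef (fourier_series c) j - c j) \<le> e" if e: "e > 0" for e
  proof -
    have ev: "\<forall>\<^sub>F n in sequentially. (\<forall>z. cmod ((\<Sum>k<n. c k * wave k z) - fourier_series c z) \<le> e) \<and> n > j"
      using fourier_series_tail[OF assms e] eventually_gt_at_top by (rule eventually_conj)
    obtain n where n: "\<And>z. cmod ((\<Sum>k<n. c k * wave k z) - fourier_series c z) \<le> e" "n > j"
      using eventually_happens'[OF sequentially_bot ev] by blast
    have cn: "continuous_on UNIV (\<lambda>z. (\<Sum>k<n. c k * wave k z) - fourier_series c z)"
      by (intro continuous_intros continuous_on_wave_poly cs wave_cont)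
    have "c j - fourier_coef (fourier_series c) j = fourier_coef (\<lambda>z. (\<Sum>k<n. c k * wave k z) - fourier_series c z) j"
      using n(2) by (simp add: fourier_coef_diff[OF continuous_on_wave_poly cs] fourier_coef_poly)
    also have "cmod \<dots> \<le> mean (\<lambda>z. cmod (((\<Sum>k<n. c k * wave k z) - fourier_series c z) * cnj (wave j z)))"
      unfolding fourier_coef_def by (rule norm_mean_le) (intro continuous_on_mult cn cont_cnj_wave)
    also have "\<dots> \<le> mean (\<lambda>z. e)"
      using n(1) by (intro mean_mono continuous_on_norm continuous_on_mult cn cont_cnj_wave continuous_on_const)
        (simp add: norm_mult)
    also have "\<dots> = e" by (simp add: mean_const)
    finally show ?thesis by (simp add: norm_minus_commute)
  qed
  then have "cmod (fourier_coef (fourier_series c) j - c j) \<le> 0" by (rule field_le_epsilon) simp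
  then show ?thesis by simp
qed

text \<open>
  One half of the identity of Parseval, in the form in which only bounds for the partial sums are known.
\<close>

lemma mean_sq_fourier_series_le:
  assumes "rapid c" and C: "\<And>n. (\<Sum>k<n. (cmod (c k))\<^sup>2) \<le> C"
  shows "mean_sq (fourier_series c) \<le> C"
proof -
  define B where "B = (\<Sum>k. cmod (c k))"
  have B0: "B \<ge> 0" unfolding B_def by (intro suminf_nonneg rapid_summable assms) auto
  have cs: "continuous_on UNIV (fourier_series c)" by (rule smooth_periodic_cont[OF smooth_periodic_fourier_series[OF assms(1)]])
  have "mean_sq (fourier_series c) \<le> C + e" if e: "e > 0" for e
  proof -
    define d where "d = min 1 (e / (2 * B + 1))"
    have d: "d > 0" "d \<le> 1" using e B0 by (auto simp: d_def)
    have "d * (2 * B + 1) \<le> e / (2 * B + 1) * (2 * B + 1)"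
      using B0 by (intro mult_right_mono) (auto simp: d_def)
    then have de: "d * (2 * B + 1) \<le> e" using B0 by simp
    obtain n where n: "\<And>z. cmod ((\<Sum>k<n. c k * wave k z) - fourier_series c z) \<le> d"
      using eventually_happens'[OF sequentially_bot fourier_series_tail[OF assms(1) d(1)]] by blast
    let ?F = "\<lambda>z. \<Sum>k<n. c k * wave k z"
    have "(cmod (fourier_series c z))\<^sup>2 \<le> (cmod (?F z))\<^sup>2 + e" for z
    proof -
      have F: "cmod (?F z) \<le> B"
      proof -
        have "cmod (?F z) \<le> (\<Sum>k<n. cmod (c k))" by (rule order_trans[OF norm_sum]) (simp add: norm_mult)
        also have "\<dots> \<le> B" unfolding B_def by (intro sum_le_suminf rapid_summable assms) auto
        finally show ?thesis .
      qed
      have "cmod (fourier_series c z) \<le> cmod (?F z) + d"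
        using n[of z] norm_triangle_sub[of "fourier_series c z" "?F z"] by (simp add: norm_minus_commute)
      then have "(cmod (fourier_series c z))\<^sup>2 \<le> (cmod (?F z) + d)\<^sup>2" by (intro power_mono) auto
      also have "\<dots> = (cmod (?F z))\<^sup>2 + d * (2 * cmod (?F z) + d)" by (simp add: power2_eq_square algebra_simps)
      also have "\<dots> \<le> (cmod (?F z))\<^sup>2 + d * (2 * B + 1)"
        using F d by (intro add_left_mono mult_left_mono add_mono) auto
      finally show ?thesis using de by linarith
    qed
    then have "mean_sq (fourier_series c) \<le> mean (\<lambda>z. (cmod (?F z))\<^sup>2 + e)"
      unfolding mean_sq_def by (intro mean_mono continuous_intros cs continuous_on_wave_poly wave_cont)
    also have "\<dots> = mean_sq ?F + e"
      unfolding mean_sq_def by (subst mean_add) (auto intro!: continuous_intros continuous_on_wave_poly wave_cont simp: mean_const)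
    also have "\<dots> \<le> C + e" using mean_sq_poly[of "{..<n}" c] C[of n] by simp
    finally show ?thesis .
  qed
  then show ?thesis by (rule field_le_epsilon)
qed

section \<open>Mean square bounds for derivatives of all orders\<close>

lemma mean_sq_le:
  assumes "continuous_on UNIV f" "continuous_on UNIV g" "continuous_on UNIV h"
    and le: "\<And>z. (cmod (f z))\<^sup>2 \<le> A * (cmod (g z))\<^sup>2 + B * (cmod (h z))\<^sup>2"
  shows "mean_sq f \<le> A * mean_sq g + B * mean_sq h"
proof -
  have "mean_sq f \<le> mean (\<lambda>z. A * (cmod (g z))\<^sup>2 + B * (cmod (h z))\<^sup>2)"
    unfolding mean_sq_def by (intro mean_mono cont_cmod_sq continuous_on_add continuous_on_mult_left assms)
  also have "\<dots> = A * mean_sq g + B * mean_sq h"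
    unfolding mean_sq_def
    by (simp only: mean_add[OF continuous_on_mult_left[OF cont_cmod_sq[OF assms(2)]]
          continuous_on_mult_left[OF cont_cmod_sq[OF assms(3)]]]
        mean_cmult[OF cont_cmod_sq[OF assms(2)]] mean_cmult[OF cont_cmod_sq[OF assms(3)]])
  finally show ?thesis .
qed

lemma cmod_add_sq_le: "(cmod (a + b))\<^sup>2 \<le> 2 * (cmod a)\<^sup>2 + 2 * (cmod b)\<^sup>2"
proof -
  have "(cmod (a + b))\<^sup>2 \<le> (cmod a + cmod b)\<^sup>2" by (intro power_mono norm_triangle_ineq) auto
  also have "\<dots> \<le> 2 * (cmod a)\<^sup>2 + 2 * (cmod b)\<^sup>2"
    using zero_le_power2[of "cmod a - cmod b"] by (simp add: power2_sum power2_diff)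
  finally show ?thesis .
qed

lemma mean_sq_add_le:
  assumes "continuous_on UNIV f" "continuous_on UNIV g"
  shows "mean_sq (\<lambda>z. f z + g z) \<le> 2 * mean_sq f + 2 * mean_sq g"
  by (rule mean_sq_le) (intro continuous_on_add assms cmod_add_sq_le)+

lemma mean_sq_mult_le:
  assumes "continuous_on UNIV f" "continuous_on UNIV m" and k: "\<And>z. cmod (m z) \<le> k"
  shows "mean_sq (\<lambda>z. m z * f z) \<le> k\<^sup>2 * mean_sq f"
proof -
  have "mean_sq (\<lambda>z. m z * f z) \<le> k\<^sup>2 * mean_sq f + 0 * mean_sq f"
  proof (rule mean_sq_le)
    show "(cmod (m z * f z))\<^sup>2 \<le> k\<^sup>2 * (cmod (f z))\<^sup>2 + 0 * (cmod (f z))\<^sup>2" for z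
      using k[of z] by (simp add: norm_mult power_mult_distrib mult_right_mono power_mono)
  qed (intro continuous_on_mult assms)+
  then show ?thesis by simp
qed

text \<open>
  Convexity of the square takes the place of the triangle inequality for the norm of
  \<open>L\<^sup>2\<close>: \<open>k a + b\<close> is the convex combination of \<open>a\<close> and \<open>b / (1 - k)\<close> with the weights \<open>k\<close> and \<open>1 - k\<close>.
\<close>

lemma mean_sq_affine_le:
  assumes cont: "continuous_on UNIV f" "continuous_on UNIV m" "continuous_on UNIV r"
    and k: "\<And>z. cmod (m z) \<le> k" "0 \<le> k" "k < 1"
  shows "mean_sq (\<lambda>z. m z * f z + r z) \<le> k * mean_sq f + 1 / (1 - k) * mean_sq r"
proof (rule mean_sq_le)
  fix z
  let ?a = "cmod (f z)" and ?b = "cmod (r z)"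
  have "cmod (m z * f z + r z) \<le> k * ?a + ?b"
    using norm_triangle_ineq[of "m z * f z" "r z"] mult_right_mono[OF k(1)[of z], of ?a]
    by (simp add: norm_mult)
  then have "(cmod (m z * f z + r z))\<^sup>2 \<le> (k * ?a + ?b)\<^sup>2" by (intro power_mono) auto
  also have "\<dots> \<le> k * ?a\<^sup>2 + 1 / (1 - k) * ?b\<^sup>2"
  proof -
    \<comment> \<open>the defect in the convexity inequality, multiplied by \<open>1 - k\<close>\<close>
    have "0 \<le> k * ((1 - k) * ?a - ?b)\<^sup>2" using k by simp
    also have "k * ((1 - k) * ?a - ?b)\<^sup>2 = (1 - k) * (k * ?a\<^sup>2) + ?b\<^sup>2 - (1 - k) * (k * ?a + ?b)\<^sup>2"
      by (simp add: power2_eq_square algebra_simps)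
    finally have "(1 - k) * (k * ?a + ?b)\<^sup>2 \<le> (1 - k) * (k * ?a\<^sup>2) + ?b\<^sup>2" by simp
    then have "(k * ?a + ?b)\<^sup>2 \<le> ((1 - k) * (k * ?a\<^sup>2) + ?b\<^sup>2) / (1 - k)"
      using k by (simp add: pos_le_divide_eq mult.commute)
    also have "\<dots> = k * ?a\<^sup>2 + 1 / (1 - k) * ?b\<^sup>2" using k by (simp add: add_divide_distrib)
    finally show ?thesis .
  qed
  finally show "(cmod (m z * f z + r z))\<^sup>2 \<le> k * ?a\<^sup>2 + 1 / (1 - k) * ?b\<^sup>2" .
qed (intro continuous_on_add continuous_on_mult cont)+

text \<open>
  A sequence of functions is bounded in the Sobolev space of order \<open>l\<close>. The recursion over the first
  derivatives makes the product rule applicable without binomial coefficients.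
\<close>

primrec L2_bounded :: "nat \<Rightarrow> (nat \<Rightarrow> complex \<Rightarrow> complex) \<Rightarrow> bool" where
  "L2_bounded 0 f \<longleftrightarrow> (\<exists>C. \<forall>j. mean_sq (f j) \<le> C)"
| "L2_bounded (Suc l) f \<longleftrightarrow> (\<exists>C. \<forall>j. mean_sq (f j) \<le> C) \<and> (\<forall>v. L2_bounded l (\<lambda>j. dir_deriv v (f j)))"

lemma L2_bounded_Suc_imp: "L2_bounded (Suc l) f \<Longrightarrow> L2_bounded l f"
proof (induction l arbitrary: f)
  case (Suc l)
  have b: "\<exists>C. \<forall>j. mean_sq (f j) \<le> C" "\<And>v. L2_bounded (Suc l) (\<lambda>j. dir_deriv v (f j))"
    using Suc.prems by auto
  have "L2_bounded l (\<lambda>j. dir_deriv v (f j))" for v by (rule Suc.IH[OF b(2)])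
  then show ?case using b(1) by simp
qed simp

lemma dir_deriv_add_fun: "smooth f \<Longrightarrow> smooth g \<Longrightarrow> dir_deriv v (\<lambda>z. f z + g z) = (\<lambda>z. dir_deriv v f z + dir_deriv v g z)"
  by (rule ext) (rule dir_deriv_add)

lemma dir_deriv_mult_fun: "smooth f \<Longrightarrow> smooth g \<Longrightarrow> dir_deriv v (\<lambda>z. f z * g z) = (\<lambda>z. f z * dir_deriv v g z + dir_deriv v f z * g z)"
  by (rule ext) (rule dir_deriv_mult)

lemma L2_bounded_add:
  assumes "\<And>j. smooth_periodic (f j)" "\<And>j. smooth_periodic (g j)" "L2_bounded l f" "L2_bounded l g"
  shows "L2_bounded l (\<lambda>j z. f j z + g j z)"
  using assms
proof (induction l arbitrary: f g)
  case 0
  then obtain C D where "\<And>j. mean_sq (f j) \<le> C" "\<And>j. mean_sq (g j) \<le> D" by auto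
  then have "mean_sq (\<lambda>z. f j z + g j z) \<le> 2 * C + 2 * D" for j
    by (intro order_trans[OF mean_sq_add_le[OF smooth_periodic_cont[OF 0(1)] smooth_periodic_cont[OF 0(2)]]]
        add_mono mult_left_mono) auto
  then show ?case by auto
next
  case (Suc l)
  have "L2_bounded 0 f" "L2_bounded 0 g" using Suc.prems(3,4) by simp_all
  then obtain C D where "\<And>j. mean_sq (f j) \<le> C" "\<And>j. mean_sq (g j) \<le> D" by auto
  then have "mean_sq (\<lambda>z. f j z + g j z) \<le> 2 * C + 2 * D" for j
    by (intro order_trans[OF mean_sq_add_le[OF smooth_periodic_cont[OF Suc.prems(1)] smooth_periodic_cont[OF Suc.prems(2)]]]
        add_mono mult_left_mono) auto
  then have "\<exists>C. \<forall>j. mean_sq (\<lambda>z. f j z + g j z) \<le> C" by blast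
  moreover have "L2_bounded l (\<lambda>j. dir_deriv v (\<lambda>z. f j z + g j z))" for v
    unfolding dir_deriv_add_fun[OF smooth_periodic_smooth[OF Suc.prems(1)] smooth_periodic_smooth[OF Suc.prems(2)]]
    using Suc.prems by (intro Suc.IH smooth_periodic_dir_deriv) simp_all
  ultimately show ?case by simp
qed

lemma L2_bounded_mult:
  assumes "smooth_periodic a" "\<And>j. smooth_periodic (f j)" "L2_bounded l f"
  shows "L2_bounded l (\<lambda>j z. a z * f j z)"
  using assms
proof (induction l arbitrary: a f)
  case 0
  obtain B where B: "\<And>z. cmod (a z) \<le> B"
    using periodic_bounded[of a] 0(1) smooth_periodic_cont smooth_periodic_def by metis
  obtain C where "\<And>j. mean_sq (f j) \<le> C" using 0 by auto
  then have "mean_sq (\<lambda>z. a z * f j z) \<le> B\<^sup>2 * C" for j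
    by (intro order_trans[OF mean_sq_mult_le[OF smooth_periodic_cont[OF 0(2)] smooth_periodic_cont[OF 0(1)] B]]
        mult_left_mono) auto
  then show ?case by auto
next
  case (Suc l)
  obtain B where B: "\<And>z. cmod (a z) \<le> B"
    using periodic_bounded[of a] Suc.prems(1) smooth_periodic_cont smooth_periodic_def by metis
  have b: "L2_bounded l (\<lambda>j. dir_deriv v (f j))" for v using Suc.prems(3) by simp
  obtain C where "\<And>j. mean_sq (f j) \<le> C" using Suc.prems(3) by auto
  then have "mean_sq (\<lambda>z. a z * f j z) \<le> B\<^sup>2 * C" for j
    by (intro order_trans[OF mean_sq_mult_le[OF smooth_periodic_cont[OF Suc.prems(2)] smooth_periodic_cont[OF Suc.prems(1)] B]]
        mult_left_mono) auto
  then have "\<exists>C. \<forall>j. mean_sq (\<lambda>z. a z * f j z) \<le> C" by blast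
  moreover have "L2_bounded l (\<lambda>j. dir_deriv v (\<lambda>z. a z * f j z))" for v
    unfolding dir_deriv_mult_fun[OF smooth_periodic_smooth[OF Suc.prems(1)] smooth_periodic_smooth[OF Suc.prems(2)]]
    by (rule L2_bounded_add[OF smooth_periodic_mult[OF Suc.prems(1) smooth_periodic_dir_deriv[OF Suc.prems(2)]]
          smooth_periodic_mult[OF smooth_periodic_dir_deriv[OF Suc.prems(1)] Suc.prems(2)]
          Suc.IH[OF Suc.prems(1) smooth_periodic_dir_deriv[OF Suc.prems(2)] b]
          Suc.IH[OF smooth_periodic_dir_deriv[OF Suc.prems(1)] Suc.prems(2) L2_bounded_Suc_imp[OF Suc.prems(3)]]])
  ultimately show ?case by simp
qed

lemma L2_bounded_const: "L2_bounded l (\<lambda>j. r)"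
  by (induction l arbitrary: r) auto

section \<open>Fourier inversion\<close>

text \<open>
  A derivative in the direction \<open>1\<close> or \<open>\<i>\<close> contributes one factor \<open>freq k 1\<close> or \<open>freq k \<i>\<close> to the coefficient, and
  coefficients are bounded by the mean square. The bound is the same for all members of the
  sequence and thus survives the passage to a limit.
\<close>

lemma fourier_coef_rapid_family:
  assumes "\<And>j. smooth_periodic (f j)" "\<And>l. L2_bounded l f"
  shows "\<exists>C. \<forall>j k. cmod (freq k 1) ^ p * cmod (freq k \<i>) ^ q * cmod (fourier_coef (f j) k) \<le> C"
  using assms
proof (induction p arbitrary: f)
  case 0
  then show ?case
  proof (induction q arbitrary: f)
    case 0
    obtain C where C: "\<And>j. mean_sq (f j) \<le> C" using 0(2)[of 0] by auto
    have "cmod (fourier_coef (f j) k) \<le> sqrt C" for j k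
      using fourier_coef_sq_le[OF smooth_periodic_cont[OF 0(1)], of j k] C[of j]
      by (intro real_le_rsqrt) (rule order_trans)
    then show ?case by auto
  next
    case (Suc q)
    have "L2_bounded l (\<lambda>j. dir_deriv \<i> (f j))" for l using Suc.prems(2)[of "Suc l"] by simp
    from Suc.IH[OF smooth_periodic_dir_deriv[OF Suc.prems(1)] this]
    show ?case by (simp add: fourier_coef_dir_deriv[OF Suc.prems(1)] norm_mult mult_ac)
  qed
next
  case (Suc p)
  have "L2_bounded l (\<lambda>j. dir_deriv 1 (f j))" for l using Suc.prems(2)[of "Suc l"] by simp
  from Suc.IH[OF smooth_periodic_dir_deriv[OF Suc.prems(1)] this]
  show ?case by (simp add: fourier_coef_dir_deriv[OF Suc.prems(1)] norm_mult mult_ac)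
qed

lemma fourier_coef_rapid: "smooth_periodic f \<Longrightarrow> rapid (fourier_coef f)"
  using fourier_coef_rapid_family[of "\<lambda>j. f"] unfolding rapid_def by (simp add: L2_bounded_const)

lemma fourier_unique:
  assumes "smooth_periodic f" "smooth_periodic g" "\<And>k. fourier_coef f k = fourier_coef g k"
  shows "f = g"
proof
  fix z
  have "f z - g z = 0"
    by (rule fourier_coef_eq_0_imp[of "\<lambda>z. f z - g z"])
      (simp_all add: smooth_periodic_diff fourier_coef_diff[OF smooth_periodic_cont smooth_periodic_cont] assms)
  then show "f z = g z" by simp
qed

lemma fourier_inversion: "smooth_periodic f \<Longrightarrow> fourier_series (fourier_coef f) = f"
  by (rule fourier_unique) (simp_all add: smooth_periodic_fourier_series fourier_coef_rapid fourier_coef_fourier_series)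

text \<open>
  On Fourier series, both sides multiply the coefficients by \<open>freq k v * freq k w\<close>.
\<close>

lemma dir_deriv_commute:
  assumes "smooth_periodic f"
  shows "dir_deriv v (dir_deriv w f) z = dir_deriv w (dir_deriv v f) z"
proof -
  note r = fourier_coef_rapid[OF assms]
  have 1: "dir_deriv v (fourier_series (fourier_coef f)) = fourier_series (\<lambda>k. freq k v * fourier_coef f k)" for v
    by (rule ext) (rule dir_deriv_fourier_series[OF r])
  have "dir_deriv v (dir_deriv w (fourier_series (fourier_coef f))) z = dir_deriv w (dir_deriv v (fourier_series (fourier_coef f))) z"
    unfolding 1 dir_deriv_fourier_series[OF rapid_freq[OF r]] by (simp add: mult.left_commute)
  then show ?thesis by (simp only: fourier_inversion[OF assms])
qed

section \<open>The Beurling transform\<close>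

text \<open>
  On the mode \<open>k\<close>, the operators \<open>2 \<partial>\<^bsub>z\<^esub>\<close> and \<open>2 \<partial>\<^bsub>zbar\<^esub>\<close> act as multiplication by the numerator and
  the denominator.
\<close>

definition beurling_symbol :: "nat \<Rightarrow> complex" where
  "beurling_symbol k = (freq k 1 - \<i> * freq k \<i>) / (freq k 1 + \<i> * freq k \<i>)"

text \<open>
  The mode \<open>0\<close> is not in the range of \<open>\<partial>\<^bsub>zbar\<^esub>\<close> on periodic functions. It is represented by the nonperiodic function
  \<open>c zbar - cnj c z\<close>, whose derivatives are \<open>c\<close> and \<open>- cnj c\<close> and whose values are purely imaginary.
\<close>

definition beurling_coef :: "(nat \<Rightarrow> complex) \<Rightarrow> nat \<Rightarrow> complex" where
  "beurling_coef c k = (if k = 0 then - cnj (c 0) else beurling_symbol k * c k)"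

definition beurling :: "(complex \<Rightarrow> complex) \<Rightarrow> complex \<Rightarrow> complex" where
  "beurling g = fourier_series (beurling_coef (fourier_coef g))"

lemma dbar_symbol_bounds:
  assumes "k \<noteq> 0" shows "freq k 1 + \<i> * freq k \<i> \<noteq> 0" "cmod (beurling_symbol k) = 1"
    "1 \<le> cmod (freq k 1 + \<i> * freq k \<i>)"
proof -
  define a where "a = fst (freq_pair k)"
  define b where "b = snd (freq_pair k)"
  have f: "freq k 1 = \<i> * of_int a" "freq k \<i> = \<i> * of_int b"
    by (simp_all add: freq_def a_def b_def)
  have ab: "a \<noteq> 0 \<or> b \<noteq> 0" using freq_eq_0_iff[of k] assms by (auto simp: f)
  have eq: "freq k 1 + \<i> * freq k \<i> = Complex (- of_int b) (of_int a)"
    "freq k 1 - \<i> * freq k \<i> = Complex (of_int b) (of_int a)"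
    by (simp_all add: f complex_eq_iff)
  show ne: "freq k 1 + \<i> * freq k \<i> \<noteq> 0" using ab by (auto simp: eq complex_eq_iff)
  have "cmod (freq k 1 - \<i> * freq k \<i>) = cmod (freq k 1 + \<i> * freq k \<i>)"
    by (simp add: eq cmod_def)
  then show "cmod (beurling_symbol k) = 1"
    using ne by (simp add: beurling_symbol_def norm_divide)
  have "1 \<le> \<bar>of_int a :: real\<bar> \<or> 1 \<le> \<bar>of_int b :: real\<bar>" using ab by linarith
  then show "1 \<le> cmod (freq k 1 + \<i> * freq k \<i>)"
    using abs_Re_le_cmod[of "Complex (- of_int b) (of_int a)"] abs_Im_le_cmod[of "Complex (- of_int b) (of_int a)"]
    by (auto simp: eq)
qed

lemma norm_beurling_coef [simp]: "cmod (beurling_coef c k) = cmod (c k)"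
  by (simp add: beurling_coef_def norm_mult dbar_symbol_bounds)

lemma rapid_beurling_coef: "rapid c \<Longrightarrow> rapid (beurling_coef c)"
  by (rule rapid_mono[where M = 1]) auto

lemma smooth_periodic_beurling: "smooth_periodic g \<Longrightarrow> smooth_periodic (beurling g)"
  unfolding beurling_def by (intro smooth_periodic_fourier_series rapid_beurling_coef fourier_coef_rapid)

lemma mean_sq_beurling_le:
  assumes "smooth_periodic g" "\<And>n. (\<Sum>k<n. (cmod (fourier_coef g k))\<^sup>2) \<le> C"
  shows "mean_sq (beurling g) \<le> C"
  unfolding beurling_def
  by (rule mean_sq_fourier_series_le) (simp_all add: rapid_beurling_coef fourier_coef_rapid assms)

text \<open>
  The multipliers have modulus 1, so the claim is the inequality of Bessel for \<open>g\<close>.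
\<close>

lemma mean_sq_beurling: "smooth_periodic g \<Longrightarrow> mean_sq (beurling g) \<le> mean_sq g"
  by (rule mean_sq_beurling_le) (simp_all add: bessel smooth_periodic_cont)

lemma beurling_diff:
  assumes "smooth_periodic f" "smooth_periodic g"
  shows "beurling (\<lambda>z. f z - g z) = (\<lambda>z. beurling f z - beurling g z)"
proof
  fix z
  have "beurling_coef (fourier_coef (\<lambda>z. f z - g z)) = (\<lambda>k. beurling_coef (fourier_coef f) k - beurling_coef (fourier_coef g) k)"
    by (rule ext)
      (simp add: beurling_coef_def fourier_coef_diff[OF smooth_periodic_cont smooth_periodic_cont] assms right_diff_distrib)
  then show "beurling (\<lambda>z. f z - g z) z = beurling f z - beurling g z"
    unfolding beurling_def by (simp only: fourier_series_diff rapid_beurling_coef fourier_coef_rapid assms)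
qed

lemma dir_deriv_beurling:
  assumes "smooth_periodic g"
  shows "dir_deriv v (beurling g) = beurling (dir_deriv v g)"
proof
  fix z
  have "(\<lambda>k. freq k v * beurling_coef (fourier_coef g) k) = beurling_coef (fourier_coef (dir_deriv v g))"
    by (rule ext) (simp add: beurling_coef_def fourier_coef_dir_deriv[OF assms])
  then show "dir_deriv v (beurling g) z = beurling (dir_deriv v g) z"
    unfolding beurling_def dir_deriv_fourier_series[OF rapid_beurling_coef[OF fourier_coef_rapid[OF assms]]] by simp
qed

lemma L2_bounded_beurling:
  assumes "\<And>j. smooth_periodic (g j)" "L2_bounded l g"
  shows "L2_bounded l (\<lambda>j. beurling (g j))"
  using assms
proof (induction l arbitrary: g)
  case 0
  then obtain C where "\<And>j. mean_sq (g j) \<le> C" by auto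
  then have "mean_sq (beurling (g j)) \<le> C" for j
    using mean_sq_beurling[OF 0(1)] by (rule order_trans[rotated])
  then show ?case by auto
next
  case (Suc l)
  then obtain C where "\<And>j. mean_sq (g j) \<le> C" by auto
  then have "mean_sq (beurling (g j)) \<le> C" for j
    using mean_sq_beurling[OF Suc.prems(1)] by (rule order_trans[rotated])
  then have "\<exists>C. \<forall>j. mean_sq (beurling (g j)) \<le> C" by blast
  moreover have "L2_bounded l (\<lambda>j. dir_deriv v (beurling (g j)))" for v
    unfolding dir_deriv_beurling[OF Suc.prems(1)]
    by (rule Suc.IH[OF smooth_periodic_dir_deriv[OF Suc.prems(1)]]) (use Suc.prems(2) in simp)
  ultimately show ?case by simp
qed

section \<open>The inhomogeneous Beltrami equation\<close>

lemma mean_sq_mult_beurling_le: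
  assumes \<mu>: "smooth_periodic \<mu>" "\<And>z. cmod (\<mu> z) \<le> k" and "smooth_periodic g"
  shows "mean_sq (\<lambda>z. \<mu> z * beurling g z) \<le> k\<^sup>2 * mean_sq (beurling g)"
  by (intro mean_sq_mult_le smooth_periodic_cont smooth_periodic_beurling assms)

text \<open>
  Since \<open>beurling\<close> commutes with derivatives, differentiating the recursion gives the same recursion for the
  derivatives \<open>dir_deriv v (g j)\<close>, with the inhomogeneity
  \<open>dir_deriv v \<mu> * beurling (g j) + dir_deriv v (r j)\<close>. It involves derivatives of \<open>g j\<close> of lower order only. For this
  induction, \<open>r\<close> must be allowed to depend on \<open>j\<close>.
\<close>

lemma L2_bounded_iteration:
  assumes \<mu>: "smooth_periodic \<mu>" "\<And>z. cmod (\<mu> z) \<le> k" "0 \<le> k" "k < 1"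
    and "\<And>j. smooth_periodic (g j)" "\<And>j. smooth_periodic (r j)" "L2_bounded l r"
    and "\<And>j. g (Suc j) = (\<lambda>z. \<mu> z * beurling (g j) z + r j z)"
  shows "L2_bounded l g"
  using assms(5-8)
proof (induction l arbitrary: g r)
  case 0
  obtain C where C: "\<And>j. mean_sq (r j) \<le> C" using 0(3) by auto
  \<comment> \<open>\<open>B\<close> bounds the initial value and is preserved by the estimate \<open>x \<mapsto> k x + R\<close> for one step\<close>
  define R where "R = 1 / (1 - k) * C"
  define B where "B = mean_sq (g 0) + R / (1 - k)"
  have R0: "0 \<le> R" using C[of 0] mean_sq_nonneg[OF smooth_periodic_cont[OF 0(2)], of 0] \<mu> by (simp add: R_def)
  have g0: "0 \<le> mean_sq (g 0)" by (rule mean_sq_nonneg[OF smooth_periodic_cont[OF 0(1)]])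
  have kB: "k * B + R \<le> B"
  proof -
    have "(1 - k) * B = (1 - k) * mean_sq (g 0) + R" using \<mu> by (simp add: B_def distrib_left)
    moreover have "0 \<le> (1 - k) * mean_sq (g 0)" using \<mu> g0 by simp
    ultimately show ?thesis by (simp add: algebra_simps)
  qed
  have "mean_sq (g j) \<le> B" for j
  proof (induction j)
    case 0
    show ?case using R0 \<mu> by (simp add: B_def)
  next
    case (Suc j)
    have "mean_sq (g (Suc j)) \<le> k * mean_sq (beurling (g j)) + 1 / (1 - k) * mean_sq (r j)"
      unfolding 0(4)
      by (intro mean_sq_affine_le smooth_periodic_cont smooth_periodic_beurling 0 \<mu>)
    also have "\<dots> \<le> k * B + R"
      unfolding R_def
      using \<mu> by (intro add_mono mult_left_mono C order_trans[OF mean_sq_beurling[OF 0(1)] Suc.IH]) auto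
    finally show ?case using kB by linarith
  qed
  then show ?case by auto
next
  case (Suc l)
  have rl: "L2_bounded l r" by (rule L2_bounded_Suc_imp[OF Suc.prems(3)])
  have gl: "L2_bounded l g" by (rule Suc.IH[OF Suc.prems(1,2) rl Suc.prems(4)])
  note bl = smooth_periodic_beurling[OF Suc.prems(1)]
  have "L2_bounded l (\<lambda>j. dir_deriv v (g j))" for v
  proof (rule Suc.IH[where r = "\<lambda>j z. dir_deriv v \<mu> z * beurling (g j) z + dir_deriv v (r j) z"])
    show "L2_bounded l (\<lambda>j z. dir_deriv v \<mu> z * beurling (g j) z + dir_deriv v (r j) z)"
    proof (rule L2_bounded_add)
      show "L2_bounded l (\<lambda>j z. dir_deriv v \<mu> z * beurling (g j) z)"
        by (rule L2_bounded_mult[OF smooth_periodic_dir_deriv[OF \<mu>(1)] bl L2_bounded_beurling[OF Suc.prems(1) gl]])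
      show "L2_bounded l (\<lambda>j. dir_deriv v (r j))" using Suc.prems(3) by simp
    qed (intro smooth_periodic_mult smooth_periodic_dir_deriv bl \<mu> Suc.prems)+
    show "dir_deriv v (g (Suc j)) = (\<lambda>z. \<mu> z * beurling (dir_deriv v (g j)) z + (dir_deriv v \<mu> z * beurling (g j) z + dir_deriv v (r j) z))" for j
      unfolding Suc.prems(4)[of j]
      by (simp add: dir_deriv_add_fun dir_deriv_mult_fun smooth_mult smooth_periodic_smooth bl \<mu>(1) Suc.prems(2)
          dir_deriv_beurling[OF Suc.prems(1)] add.assoc)
  qed (intro smooth_periodic_add smooth_periodic_mult smooth_periodic_dir_deriv bl \<mu> Suc.prems)+
  moreover have "\<exists>C. \<forall>j. mean_sq (g j) \<le> C" using gl by (cases l) auto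
  ultimately show ?case by simp
qed

text \<open>
  The iterates \<open>g j\<close> form a Cauchy sequence in mean square, because the map contracts differences. So each Fourier
  coefficient converges, and the limits decrease rapidly by the uniform bounds on all derivatives. The
  limits are therefore the coefficients of a smooth function \<open>\<psi>\<close>. Both sides of the
  equation for \<open>\<psi>\<close> have the same Fourier coefficients.
\<close>

lemma beurling_fixed_point:
  assumes \<mu>: "smooth_periodic \<mu>" "\<And>z. cmod (\<mu> z) \<le> k" "0 \<le> k" "k < 1"
    and r: "smooth_periodic r"
  obtains \<psi> where "smooth_periodic \<psi>" "\<psi> = (\<lambda>z. \<mu> z * beurling \<psi> z + r z)"
proof -
  define g where "g = rec_nat (\<lambda>z. 0) (\<lambda>j G z. \<mu> z * beurling G z + r z)"
  have g_0: "g 0 = (\<lambda>z. 0)" and g_Suc: "g (Suc j) = (\<lambda>z. \<mu> z * beurling (g j) z + r z)" for j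
    by (simp_all add: g_def)
  have sp: "smooth_periodic (g j)" for j
    by (induction j)
      (auto simp: g_0 g_Suc smooth_periodic_const intro!: smooth_periodic_add smooth_periodic_mult
        smooth_periodic_beurling \<mu> r)
  have bounded: "L2_bounded l g" for l
    by (rule L2_bounded_iteration[where r = "\<lambda>j. r" and g = g, OF \<mu> sp r L2_bounded_const[of _ r] g_Suc])
  obtain C where C: "\<And>j. mean_sq (g j) \<le> C" using bounded[of 0] by auto
  \<comment> \<open>comparing \<open>g (i + n)\<close> with \<open>g n\<close> directly, instead of summing consecutive differences, requires no triangle inequality\<close>
  have contr: "mean_sq (\<lambda>z. g (i + n) z - g n z) \<le> (k\<^sup>2) ^ n * C" for i n
  proof (induction n)
    case 0
    then show ?case using C[of i] by (simp add: g_0)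
  next
    case (Suc n)
    let ?d = "\<lambda>z. g (i + n) z - g n z"
    have d: "smooth_periodic ?d" by (intro smooth_periodic_diff sp)
    have "(\<lambda>z. g (i + Suc n) z - g (Suc n) z) = (\<lambda>z. \<mu> z * beurling ?d z)"
      by (simp add: g_Suc beurling_diff sp right_diff_distrib)
    then have "mean_sq (\<lambda>z. g (i + Suc n) z - g (Suc n) z) \<le> k\<^sup>2 * mean_sq (beurling ?d)"
      using mean_sq_mult_beurling_le[OF \<mu>(1,2) d] by simp
    also have "\<dots> \<le> k\<^sup>2 * ((k\<^sup>2) ^ n * C)"
      by (intro mult_left_mono order_trans[OF mean_sq_beurling[OF d] Suc.IH]) auto
    finally show ?case by simp
  qed
  have k2: "0 \<le> k\<^sup>2" "k\<^sup>2 < 1" using \<mu>(3,4) by (simp_all add: abs_square_less_1)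
  have C0: "0 \<le> C" using C[of 0] by (simp add: g_0 mean_sq_def mean_const)
  have small: "(\<lambda>n. (k\<^sup>2) ^ n * C) \<longlonglongrightarrow> 0"
    using tendsto_mult_left_zero[OF LIMSEQ_realpow_zero[OF k2], of C] by simp
  have fourier_coef_contr: "(\<Sum>m<K. (cmod (fourier_coef (g (i + n)) m - fourier_coef (g n) m))\<^sup>2) \<le> (k\<^sup>2) ^ n * C" for K i n
  proof -
    have "(\<Sum>m<K. (cmod (fourier_coef (g (i + n)) m - fourier_coef (g n) m))\<^sup>2) \<le> mean_sq (\<lambda>z. g (i + n) z - g n z)"
      using bessel[of "{..<K}" "\<lambda>z. g (i + n) z - g n z"]
      by (simp add: fourier_coef_diff smooth_periodic_cont[OF sp] smooth_periodic_cont[OF smooth_periodic_diff[OF sp sp]])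
    then show ?thesis using contr by (rule order_trans)
  qed
  have "Cauchy (\<lambda>j. fourier_coef (g j) m)" for m
  proof (rule CauchyI')
    fix e :: real assume e: "0 < e"
    then have "\<forall>\<^sub>F n in sequentially. (k\<^sup>2) ^ n * C < e\<^sup>2"
      using order_tendstoD(2)[OF small, of "e\<^sup>2"] by simp
    then obtain N where N: "\<And>n. n \<ge> N \<Longrightarrow> (k\<^sup>2) ^ n * C < e\<^sup>2" unfolding eventually_sequentially by blast
    have "dist (fourier_coef (g n) m) (fourier_coef (g j) m) < e" if "n \<ge> N" "j > n" for n j
    proof -
      have "(cmod (fourier_coef (g (j - n + n)) m - fourier_coef (g n) m))\<^sup>2
          \<le> (\<Sum>m<Suc m. (cmod (fourier_coef (g (j - n + n)) m - fourier_coef (g n) m))\<^sup>2)"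
        by (rule member_le_sum) auto
      also have "\<dots> \<le> (k\<^sup>2) ^ n * C" by (rule fourier_coef_contr)
      also have "\<dots> < e\<^sup>2" by (rule N[OF that(1)])
      finally have "cmod (fourier_coef (g j) m - fourier_coef (g n) m) < e"
        using that e by (intro power_less_imp_less_base[of _ 2 e]) auto
      then show ?thesis by (simp add: dist_norm norm_minus_commute)
    qed
    then show "\<exists>M. \<forall>n\<ge>M. \<forall>j>n. dist (fourier_coef (g n) m) (fourier_coef (g j) m) < e" by blast
  qed
  then have "\<exists>L. (\<lambda>j. fourier_coef (g j) m) \<longlonglongrightarrow> L" for m
    by (simp add: Cauchy_convergent_iff convergent_def)
  then obtain c where c: "\<And>m. (\<lambda>j. fourier_coef (g j) m) \<longlonglongrightarrow> c m" by metis
  have rc: "rapid c"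
    unfolding rapid_def
  proof (intro allI)
    fix p q
    obtain D where D: "\<And>j m. cmod (freq m 1) ^ p * cmod (freq m \<i>) ^ q * cmod (fourier_coef (g j) m) \<le> D"
      using fourier_coef_rapid_family[OF sp bounded, of p q] by blast
    have "cmod (freq m 1) ^ p * cmod (freq m \<i>) ^ q * cmod (c m) \<le> D" for m
      by (rule LIMSEQ_le_const2[OF tendsto_mult_left[OF tendsto_norm[OF c]]]) (use D in blast)
    then show "\<exists>D. \<forall>m. cmod (freq m 1) ^ p * cmod (freq m \<i>) ^ q * cmod (c m) \<le> D" by blast
  qed
  define \<psi> where "\<psi> = fourier_series c"
  have sp\<psi>: "smooth_periodic \<psi>" unfolding \<psi>_def by (rule smooth_periodic_fourier_series[OF rc])
  have fourier_coef\<psi>: "fourier_coef \<psi> m = c m" for m unfolding \<psi>_def by (rule fourier_coef_fourier_series[OF rc])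
  \<comment> \<open>the limit \<open>i \<longlonglongrightarrow> \<infinity>\<close> is taken in finite partial sums, as only the coefficients of \<open>\<psi>\<close> are known\<close>
  have lim_contr: "(\<Sum>m<K. (cmod (fourier_coef (\<lambda>z. \<psi> z - g n z) m))\<^sup>2) \<le> (k\<^sup>2) ^ n * C" for K n
  proof (rule LIMSEQ_le_const2)
    show "(\<lambda>i. \<Sum>m<K. (cmod (fourier_coef (g (i + n)) m - fourier_coef (g n) m))\<^sup>2) \<longlonglongrightarrow>
        (\<Sum>m<K. (cmod (fourier_coef (\<lambda>z. \<psi> z - g n z) m))\<^sup>2)"
      by (simp add: fourier_coef_diff smooth_periodic_cont[OF sp] smooth_periodic_cont[OF sp\<psi>] fourier_coef\<psi>)
        (intro tendsto_sum tendsto_power tendsto_norm tendsto_diff tendsto_const LIMSEQ_ignore_initial_segment c)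
  qed (use fourier_coef_contr in blast)
  define h where "h = (\<lambda>z. \<mu> z * beurling \<psi> z + r z)"
  have sph: "smooth_periodic h"
    unfolding h_def by (intro smooth_periodic_add smooth_periodic_mult smooth_periodic_beurling \<mu> r sp\<psi>)
  have "fourier_coef h m = c m" for m
  proof -
    have bound: "(cmod (fourier_coef h m - fourier_coef (g (Suc n)) m))\<^sup>2 \<le> (k\<^sup>2) ^ n * C" for n
    proof -
      let ?d = "\<lambda>z. \<psi> z - g n z"
      have d: "smooth_periodic ?d" by (intro smooth_periodic_diff sp sp\<psi>)
      have "(\<lambda>z. h z - g (Suc n) z) = (\<lambda>z. \<mu> z * beurling ?d z)"
        by (simp add: h_def g_Suc beurling_diff sp sp\<psi> right_diff_distrib)
      then have "fourier_coef h m - fourier_coef (g (Suc n)) m = fourier_coef (\<lambda>z. \<mu> z * beurling ?d z) m"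
        by (simp add: fourier_coef_diff[symmetric] smooth_periodic_cont[OF sp] smooth_periodic_cont[OF sph] del: g_Suc)
      then have "(cmod (fourier_coef h m - fourier_coef (g (Suc n)) m))\<^sup>2 \<le> mean_sq (\<lambda>z. \<mu> z * beurling ?d z)"
        by (simp add: fourier_coef_sq_le smooth_periodic_cont[OF smooth_periodic_mult[OF \<mu>(1) smooth_periodic_beurling[OF d]]])
      also have "\<dots> \<le> k\<^sup>2 * mean_sq (beurling ?d)" by (rule mean_sq_mult_beurling_le[OF \<mu>(1,2) d])
      also have "\<dots> \<le> 1 * ((k\<^sup>2) ^ n * C)"
        using k2 C0 by (intro mult_mono mean_sq_beurling_le[OF d lim_contr] mean_sq_nonneg
            smooth_periodic_cont[OF smooth_periodic_beurling[OF d]]) auto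
      finally show ?thesis by simp
    qed
    have "(\<lambda>n. (cmod (fourier_coef h m - fourier_coef (g (Suc n)) m))\<^sup>2) \<longlonglongrightarrow> 0"
      by (rule tendsto_sandwich[OF _ _ tendsto_const small]) (use bound in auto)
    moreover have "(\<lambda>n. (cmod (fourier_coef h m - fourier_coef (g (Suc n)) m))\<^sup>2) \<longlonglongrightarrow> (cmod (fourier_coef h m - c m))\<^sup>2"
      by (intro tendsto_power tendsto_norm tendsto_diff tendsto_const LIMSEQ_Suc c)
    ultimately have "(cmod (fourier_coef h m - c m))\<^sup>2 = 0" by (rule LIMSEQ_unique[rotated])
    then show ?thesis by simp
  qed
  then have "\<psi> = h" by (intro fourier_unique sp\<psi> sph) (simp add: fourier_coef\<psi>)
  then show thesis using that[OF sp\<psi>] unfolding h_def by blast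
qed

definition dz :: "(complex \<Rightarrow> complex) \<Rightarrow> complex \<Rightarrow> complex" where
  "dz f z = (dir_deriv 1 f z - \<i> * dir_deriv \<i> f z) / 2"

definition dzbar :: "(complex \<Rightarrow> complex) \<Rightarrow> complex \<Rightarrow> complex" where
  "dzbar f z = (dir_deriv 1 f z + \<i> * dir_deriv \<i> f z) / 2"

text \<open>
  The function \<open>p + b zbar - cnj b z\<close> solves \<open>h\<^bsub>zbar\<^esub> = \<mu> h\<^bsub>z\<^esub> + r\<close>. Here \<open>\<psi> = h\<^bsub>zbar\<^esub>\<close> is the fixed point of
  \<open>\<psi> = \<mu> * beurling \<psi> + r\<close>, \<open>b\<close> is its mean value, and \<open>p\<close> arises from \<open>\<psi>\<close> by dividing its other modes by the
  symbol of \<open>\<partial>\<^bsub>zbar\<^esub>\<close>.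
\<close>

lemma beltrami_inhomogeneous:
  assumes \<mu>: "smooth_periodic \<mu>" "\<And>z. cmod (\<mu> z) \<le> k" "0 \<le> k" "k < 1"
    and r: "smooth_periodic r"
  obtains p b where "smooth_periodic p" "\<And>z. dzbar p z + b = \<mu> z * (dz p z - cnj b) + r z"
proof -
  obtain \<psi> where \<psi>: "smooth_periodic \<psi>" "\<psi> = (\<lambda>z. \<mu> z * beurling \<psi> z + r z)"
    using beurling_fixed_point[OF assms] .
  define c where "c = fourier_coef \<psi>"
  have rc: "rapid c" unfolding c_def by (rule fourier_coef_rapid[OF \<psi>(1)])
  define d where "d k = (if k = 0 then 0 else 2 * c k / (freq k 1 + \<i> * freq k \<i>))" for k
  have rd: "rapid d"
  proof (rule rapid_mono[OF rc])
    fix k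
    show "cmod (d k) \<le> 2 * cmod (c k)"
    proof (cases "k = 0")
      case False
      then have "1 \<le> cmod (freq k 1 + \<i> * freq k \<i>)" by (rule dbar_symbol_bounds)
      then have "2 * cmod (c k) / cmod (freq k 1 + \<i> * freq k \<i>) \<le> 2 * cmod (c k) / 1"
        by (intro divide_left_mono) auto
      then show ?thesis using False by (simp add: d_def norm_divide norm_mult)
    qed (simp add: d_def)
  qed simp
  define p where "p = fourier_series d"
  have spp: "smooth_periodic p" unfolding p_def by (rule smooth_periodic_fourier_series[OF rd])
  have rm: "rapid (\<lambda>k. a * e k)" if "rapid e" for a e
    by (rule rapid_mono[OF that, of _ "cmod a"]) (auto simp: norm_mult)
  note rf = rapid_freq[OF rd]
  have dzb_p: "dzbar p z = fourier_series (\<lambda>k. if k = 0 then 0 else c k) z" for z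
  proof -
    have "dzbar p z = 1/2 * (fourier_series (\<lambda>k. freq k 1 * d k) z + \<i> * fourier_series (\<lambda>k. freq k \<i> * d k) z)"
      by (simp add: dzbar_def p_def dir_deriv_fourier_series[OF rd])
    also have "\<dots> = fourier_series (\<lambda>k. 1/2 * (freq k 1 * d k + \<i> * (freq k \<i> * d k))) z"
      by (simp only: fourier_series_cmult[OF rapid_add[OF rf rm[OF rf]]] fourier_series_add[OF rf rm[OF rf]] fourier_series_cmult[OF rf])
    also have "(\<lambda>k. 1/2 * (freq k 1 * d k + \<i> * (freq k \<i> * d k))) = (\<lambda>k. if k = 0 then 0 else c k)"
    proof
      fix k
      have "1/2 * (freq k 1 * d k + \<i> * (freq k \<i> * d k)) = (freq k 1 + \<i> * freq k \<i>) * d k / 2"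
        by (simp add: algebra_simps)
      also have "\<dots> = (if k = 0 then 0 else c k)"
        using dbar_symbol_bounds(1)[of k] by (simp add: d_def)
      finally show "1/2 * (freq k 1 * d k + \<i> * (freq k \<i> * d k)) = (if k = 0 then 0 else c k)" .
    qed
    finally show ?thesis .
  qed
  have dz_p: "dz p z = fourier_series (\<lambda>k. if k = 0 then 0 else beurling_symbol k * c k) z" for z
  proof -
    have "dz p z = 1/2 * (fourier_series (\<lambda>k. freq k 1 * d k) z + (- \<i>) * fourier_series (\<lambda>k. freq k \<i> * d k) z)"
      by (simp add: dz_def p_def dir_deriv_fourier_series[OF rd])
    also have "\<dots> = fourier_series (\<lambda>k. 1/2 * (freq k 1 * d k + (- \<i>) * (freq k \<i> * d k))) z"
      by (simp only: fourier_series_cmult[OF rapid_add[OF rf rm[OF rf]]] fourier_series_add[OF rf rm[OF rf]] fourier_series_cmult[OF rf])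
    also have "(\<lambda>k. 1/2 * (freq k 1 * d k + (- \<i>) * (freq k \<i> * d k))) = (\<lambda>k. if k = 0 then 0 else beurling_symbol k * c k)"
    proof
      fix k
      have "1/2 * (freq k 1 * d k + (- \<i>) * (freq k \<i> * d k)) = (freq k 1 - \<i> * freq k \<i>) * d k / 2"
        by (simp add: algebra_simps)
      also have "\<dots> = (if k = 0 then 0 else beurling_symbol k * c k)"
        by (simp add: d_def beurling_symbol_def)
      finally show "1/2 * (freq k 1 * d k + (- \<i>) * (freq k \<i> * d k)) = (if k = 0 then 0 else beurling_symbol k * c k)" .
    qed
    finally show ?thesis .
  qed
  have r0: "rapid (\<lambda>k. if k = 0 then b else 0)" for b
    by (rule rapid_mono[OF fourier_coef_rapid[OF smooth_periodic_const[of b]], of _ 1])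
      (simp_all add: fourier_coef_def mean_const)
  have r1: "rapid (\<lambda>k. if k = 0 then 0 else c k)" "rapid (\<lambda>k. if k = 0 then 0 else beurling_symbol k * c k)"
    by (rule rapid_mono[OF rc, of _ 1]; simp add: norm_mult dbar_symbol_bounds)+
  have e1: "dzbar p z + c 0 = \<psi> z" for z
  proof -
    have "c = (\<lambda>k. (if k = 0 then 0 else c k) + (if k = 0 then c 0 else 0))" by auto
    then have "fourier_series c z = fourier_series (\<lambda>k. if k = 0 then 0 else c k) z + fourier_series (\<lambda>k. if k = 0 then c 0 else 0) z"
      using fourier_series_add[OF r1(1) r0[of "c 0"], of z] by (simp only:)
    then show ?thesis
      using fourier_inversion[OF \<psi>(1)] by (simp add: dzb_p fourier_series_single c_def)
  qed
  have e2: "dz p z - cnj (c 0) = beurling \<psi> z" for z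
  proof -
    have "beurling_coef c = (\<lambda>k. (if k = 0 then 0 else beurling_symbol k * c k) + (if k = 0 then - cnj (c 0) else 0))"
      by (auto simp: beurling_coef_def)
    then have "beurling \<psi> z = fourier_series (\<lambda>k. if k = 0 then 0 else beurling_symbol k * c k) z
        + fourier_series (\<lambda>k. if k = 0 then - cnj (c 0) else 0) z"
      using fourier_series_add[OF r1(2) r0[of "- cnj (c 0)"], of z] by (simp only: beurling_def c_def[symmetric])
    then show ?thesis by (simp add: dz_p fourier_series_single)
  qed
  have "dzbar p z + c 0 = \<mu> z * (dz p z - cnj (c 0)) + r z" for z
    using \<psi>(2) unfolding e1 e2 by metis
  then show thesis using that[OF spp] by blast
qed

section \<open>Wirtinger derivatives\<close>

lemma smooth_derivative_wirtinger:
  assumes "smooth f"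
  shows "(f has_derivative (\<lambda>v. dz f z * v + dzbar f z * cnj v)) (at z)"
proof -
  have "dir_deriv v f z = dz f z * v + dzbar f z * cnj v" for v
    using dir_deriv_real_linear[OF assms, of v z]
    by (simp add: dz_def dzbar_def complex_eq_iff field_simps)
  then show ?thesis using smooth_has_derivative[OF assms, of z] by simp
qed

lemma wirtingerI:
  assumes "(f has_derivative (\<lambda>v. a * v + b * cnj v)) (at z)"
  shows "dz f z = a" "dzbar f z = b"
  using dir_deriv_eqI[OF assms] by (simp_all add: dz_def dzbar_def algebra_simps)

lemma dz_add: "smooth f \<Longrightarrow> smooth g \<Longrightarrow> dz (\<lambda>z. f z + g z) z = dz f z + dz g z"
  and dzbar_add: "smooth f \<Longrightarrow> smooth g \<Longrightarrow> dzbar (\<lambda>z. f z + g z) z = dzbar f z + dzbar g z"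
  by (simp_all add: dz_def dzbar_def dir_deriv_add) (simp_all add: field_simps)

lemma dz_mult: "smooth f \<Longrightarrow> smooth g \<Longrightarrow> dz (\<lambda>z. f z * g z) z = f z * dz g z + dz f z * g z"
  and dzbar_mult: "smooth f \<Longrightarrow> smooth g \<Longrightarrow> dzbar (\<lambda>z. f z * g z) z = f z * dzbar g z + dzbar f z * g z"
  by (simp_all add: dz_def dzbar_def dir_deriv_mult) (simp_all add: field_simps)

lemma dz_exp: "smooth f \<Longrightarrow> dz (\<lambda>z. exp (f z)) z = exp (f z) * dz f z"
  and dzbar_exp: "smooth f \<Longrightarrow> dzbar (\<lambda>z. exp (f z)) z = exp (f z) * dzbar f z"
  by (simp_all add: dz_def dzbar_def dir_deriv_exp) (simp_all add: field_simps)

lemma dz_const: "dz (\<lambda>z. c) z = 0" and dzbar_const: "dzbar (\<lambda>z. c) z = 0"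
  by (simp_all add: dz_def dzbar_def dir_deriv_const)

lemma bounded_linear_wirtinger: "bounded_linear (\<lambda>z. a * z + b * cnj z)"
  by (intro bounded_linear_add bounded_linear_mult_right
      bounded_linear_compose[OF bounded_linear_mult_right bounded_linear_cnj])

lemmas smooth_wirtinger = smooth_linear[OF bounded_linear_wirtinger]

lemma dz_linear: "dz (\<lambda>z. a * z + b * cnj z) z = a" and dzbar_linear: "dzbar (\<lambda>z. a * z + b * cnj z) z = b"
  by (rule wirtingerI; rule bounded_linear_imp_has_derivative[OF bounded_linear_wirtinger])+

lemma smooth_periodic_cmult: "smooth_periodic f \<Longrightarrow> smooth_periodic (\<lambda>z. c * f z)"
  by (rule smooth_periodic_mult[OF smooth_periodic_const])

lemma dz_eq: "dz f = (\<lambda>z. (1/2) * (dir_deriv 1 f z - \<i> * dir_deriv \<i> f z))"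
  and dzbar_eq: "dzbar f = (\<lambda>z. (1/2) * (dir_deriv 1 f z + \<i> * dir_deriv \<i> f z))"
  by (simp_all add: dz_def[abs_def] dzbar_def[abs_def])

lemma smooth_periodic_dz: "smooth_periodic f \<Longrightarrow> smooth_periodic (dz f)"
  and smooth_periodic_dzbar: "smooth_periodic f \<Longrightarrow> smooth_periodic (dzbar f)"
  unfolding dz_eq dzbar_eq
  by (intro smooth_periodic_cmult smooth_periodic_add smooth_periodic_diff smooth_periodic_dir_deriv; assumption)+

lemma smooth_dz: "smooth f \<Longrightarrow> smooth (dz f)"
  unfolding dz_eq by (intro smooth_mult[OF smooth_const] smooth_diff smooth_dir_deriv)

lemma mean_dz: "smooth_periodic f \<Longrightarrow> mean (dz f) = 0"
  and mean_dzbar: "smooth_periodic f \<Longrightarrow> mean (dzbar f) = 0"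
proof -
  assume f: "smooth_periodic f"
  note c = smooth_periodic_cont[OF smooth_periodic_dir_deriv[OF f]]
  note c' = smooth_periodic_cont[OF smooth_periodic_cmult[OF smooth_periodic_dir_deriv[OF f]]]
  show "mean (dz f) = 0" "mean (dzbar f) = 0"
    unfolding dz_eq dzbar_eq
    by (simp_all only: mean_cmult[OF continuous_on_diff[OF c c']] mean_cmult[OF continuous_on_add[OF c c']]
        mean_diff[OF c c'] mean_add[OF c c'] mean_cmult[OF c] mean_dir_deriv[OF f]) simp_all
qed

lemma dz_dzbar_commute:
  assumes "smooth_periodic f" shows "dzbar (dz f) z = dz (dzbar f) z"
proof -
  note s = smooth_periodic_smooth[OF smooth_periodic_dir_deriv[OF assms]]
  note s' = smooth_periodic_smooth[OF smooth_periodic_cmult[OF smooth_periodic_dir_deriv[OF assms]]]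
  have d: "dir_deriv v (\<lambda>z. c * dir_deriv w f z) z = c * dir_deriv v (dir_deriv w f) z" for v w c
    using dir_deriv_mult[OF smooth_const[of c] s[of w], of v z] by (simp add: dir_deriv_const)
  have 1: "dir_deriv v (dz f) z = (dir_deriv v (dir_deriv 1 f) z - \<i> * dir_deriv v (dir_deriv \<i> f) z) / 2" for v
  proof -
    have "dir_deriv v (dz f) z = (1/2) * dir_deriv v (\<lambda>z. dir_deriv 1 f z - \<i> * dir_deriv \<i> f z) z"
      unfolding dz_eq by (subst dir_deriv_mult[OF smooth_const smooth_diff[OF s s']]) (simp add: dir_deriv_const)
    then show ?thesis by (simp add: dir_deriv_diff[OF s s'] d)
  qed
  have 2: "dir_deriv v (dzbar f) z = (dir_deriv v (dir_deriv 1 f) z + \<i> * dir_deriv v (dir_deriv \<i> f) z) / 2" for v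
  proof -
    have "dir_deriv v (dzbar f) z = (1/2) * dir_deriv v (\<lambda>z. dir_deriv 1 f z + \<i> * dir_deriv \<i> f z) z"
      unfolding dzbar_eq by (subst dir_deriv_mult[OF smooth_const smooth_add[OF s s']]) (simp add: dir_deriv_const)
    then show ?thesis by (simp add: dir_deriv_add[OF s s'] d)
  qed
  show ?thesis
    unfolding dz_def[of "dzbar f"] dzbar_def[of "dz f"] 1 2 dir_deriv_commute[OF assms, of \<i> 1]
    by (simp add: field_simps)
qed

section \<open>The energy identity\<close>

text \<open>
  The functions to which the energy identity is applied are built from periodic and linear
  functions by sums, products and the exponential function, and the symmetry of the second
  derivatives is inherited along these operations.
\<close>

definition commuting_partials :: "(complex \<Rightarrow> complex) \<Rightarrow> bool" where
  "commuting_partials f \<longleftrightarrow> smooth f \<and> (\<forall>z. dir_deriv 1 (dir_deriv \<i> f) z = dir_deriv \<i> (dir_deriv 1 f) z)"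

lemma commuting_partials_periodic: "smooth_periodic f \<Longrightarrow> commuting_partials f"
  by (simp add: commuting_partials_def smooth_periodic_smooth dir_deriv_commute)

lemma commuting_partials_linear: "bounded_linear f \<Longrightarrow> commuting_partials f"
proof -
  assume f: "bounded_linear f"
  have "dir_deriv v f = (\<lambda>z. f v)" for v by (rule ext) (rule dir_deriv_linear[OF f])
  then show ?thesis by (simp add: commuting_partials_def smooth_linear f dir_deriv_const)
qed

lemma commuting_partials_add: "commuting_partials f \<Longrightarrow> commuting_partials g \<Longrightarrow> commuting_partials (\<lambda>z. f z + g z)"
  by (simp add: commuting_partials_def smooth_add dir_deriv_add_fun smooth_dir_deriv)

lemma commuting_partials_mult: "commuting_partials f \<Longrightarrow> commuting_partials g \<Longrightarrow> commuting_partials (\<lambda>z. f z * g z)"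
  by (simp add: commuting_partials_def smooth_mult dir_deriv_mult_fun dir_deriv_add_fun smooth_dir_deriv algebra_simps)

lemma commuting_partials_exp:
  assumes "commuting_partials f" shows "commuting_partials (\<lambda>z. exp (f z))"
proof -
  have s: "smooth f" using assms by (simp add: commuting_partials_def)
  have e: "dir_deriv v (\<lambda>z. exp (f z)) = (\<lambda>z. exp (f z) * dir_deriv v f z)" for v
    by (rule ext) (rule dir_deriv_exp[OF s])
  show ?thesis
    using assms by (simp add: commuting_partials_def smooth_exp e dir_deriv_mult_fun[OF smooth_exp smooth_dir_deriv] mult_ac)
qed

text \<open>
  The multipliers have modulus 1, so \<open>cnj G * dir_deriv v G\<close> is periodic although \<open>G\<close> need not be. The
  difference \<open>|G\<^bsub>zbar\<^esub>|\<^sup>2 - |G\<^bsub>z\<^esub>|\<^sup>2\<close> is, up to a constant factor, the density of \<open>d (cnj G dG)\<close>, and derivatives of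
  periodic functions have mean zero.
\<close>

lemma energy_identity:
  assumes G: "commuting_partials G"
    and per: "\<And>z. G (z + of_real (2 * pi)) = \<alpha> * G z" "\<And>z. G (z + of_real (2 * pi) * \<i>) = \<beta> * G z"
    and "cmod \<alpha> = 1" "cmod \<beta> = 1"
  shows "mean_sq (dz G) = mean_sq (dzbar G)"
proof -
  have s: "smooth G" using G by (simp add: commuting_partials_def)
  note sd = smooth_dir_deriv[OF s]
  have ab: "cnj \<alpha> * \<alpha> = 1" "cnj \<beta> * \<beta> = 1"
    using assms(4,5) complex_norm_square[of \<alpha>] complex_norm_square[of \<beta>] by (simp_all add: mult.commute)
  have dper: "dir_deriv v G (z + of_real (2 * pi)) = \<alpha> * dir_deriv v G z" "dir_deriv v G (z + of_real (2 * pi) * \<i>) = \<beta> * dir_deriv v G z" for v z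
  proof -
    have c: "dir_deriv v (\<lambda>z. c * G z) z = c * dir_deriv v G z" for c
      using dir_deriv_mult[OF smooth_const[of c] s, of v z] by (simp add: dir_deriv_const)
    show "dir_deriv v G (z + of_real (2 * pi)) = \<alpha> * dir_deriv v G z" "dir_deriv v G (z + of_real (2 * pi) * \<i>) = \<beta> * dir_deriv v G z"
      unfolding dir_deriv_translate[OF s, symmetric] per c by (rule refl)+
  qed
  have Q: "smooth_periodic (\<lambda>z. cnj (G z) * dir_deriv v G z)" for v
  proof -
    have "smooth (\<lambda>z. cnj (G z) * dir_deriv v G z)" by (intro smooth_mult smooth_cnj s sd)
    moreover have "cnj (\<alpha> * u) * (\<alpha> * w) = cnj u * w" "cnj (\<beta> * u) * (\<beta> * w) = cnj u * w" for u w
      using ab by (metis complex_cnj_mult mult.assoc mult.left_commute mult.right_neutral)+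
    ultimately show ?thesis
      unfolding smooth_periodic_def periodic_def using per dper by simp
  qed
  have J: "\<i> / 2 * (dir_deriv 1 (\<lambda>z. cnj (G z) * dir_deriv \<i> G z) z - dir_deriv \<i> (\<lambda>z. cnj (G z) * dir_deriv 1 G z) z) =
      of_real ((cmod (dzbar G z))\<^sup>2 - (cmod (dz G z))\<^sup>2)" for z
  proof -
    have "dir_deriv 1 (\<lambda>z. cnj (G z) * dir_deriv \<i> G z) z - dir_deriv \<i> (\<lambda>z. cnj (G z) * dir_deriv 1 G z) z =
        cnj (dir_deriv 1 G z) * dir_deriv \<i> G z - cnj (dir_deriv \<i> G z) * dir_deriv 1 G z"
      using G by (simp add: commuting_partials_def dir_deriv_mult smooth_cnj sd dir_deriv_cnj)
    moreover have "complex_of_real ((cmod (dzbar G z))\<^sup>2 - (cmod (dz G z))\<^sup>2) =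
        dzbar G z * cnj (dzbar G z) - dz G z * cnj (dz G z)"
      by (simp only: of_real_diff complex_norm_square)
    ultimately show ?thesis
      by (simp add: dz_def dzbar_def) (simp add: field_simps)
  qed
  have cz: "continuous_on UNIV (dz G)" "continuous_on UNIV (dzbar G)"
    unfolding dz_eq dzbar_eq by (intro continuous_intros smooth_continuous sd)+
  note cQ = smooth_periodic_cont[OF smooth_periodic_dir_deriv[OF Q]]
  have "complex_of_real (mean_sq (dzbar G) - mean_sq (dz G)) =
      mean (\<lambda>z. complex_of_real ((cmod (dzbar G z))\<^sup>2 - (cmod (dz G z))\<^sup>2))"
    unfolding mean_sq_def
    by (simp only: mean_of_real[OF continuous_on_diff[OF cont_cmod_sq[OF cz(2)] cont_cmod_sq[OF cz(1)]]]
        mean_diff[OF cont_cmod_sq[OF cz(2)] cont_cmod_sq[OF cz(1)]])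
  also have "\<dots> = mean (\<lambda>z. \<i> / 2 * (dir_deriv 1 (\<lambda>z. cnj (G z) * dir_deriv \<i> G z) z - dir_deriv \<i> (\<lambda>z. cnj (G z) * dir_deriv 1 G z) z))"
    by (simp only: J)
  also have "\<dots> = 0"
    by (simp only: mean_cmult[OF continuous_on_diff[OF cQ cQ]] mean_diff[OF cQ cQ] mean_dir_deriv[OF Q]) simp
  finally show ?thesis by (simp only: of_real_eq_0_iff right_minus_eq)
qed

text \<open>
  The energy identity gives \<open>mean |G\<^bsub>z\<^esub>|\<^sup>2 = mean |\<mu> G\<^bsub>z\<^esub>|\<^sup>2 \<le> k\<^sup>2 mean |G\<^bsub>z\<^esub>|\<^sup>2\<close>, so \<open>G\<^bsub>z\<^esub>\<close> and with it
  \<open>G\<^bsub>zbar\<^esub>\<close> vanish.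
\<close>

lemma beltrami_constant:
  assumes \<mu>: "continuous_on UNIV \<mu>" "\<And>z. cmod (\<mu> z) \<le> k" "0 \<le> k" "k < 1"
    and G: "commuting_partials G" "\<And>z. dzbar G z = \<mu> z * dz G z"
    and per: "\<And>z. G (z + of_real (2 * pi)) = \<alpha> * G z" "\<And>z. G (z + of_real (2 * pi) * \<i>) = \<beta> * G z"
    and ab: "cmod \<alpha> = 1" "cmod \<beta> = 1"
  shows "G z = G 0"
proof -
  have s: "smooth G" using G by (simp add: commuting_partials_def)
  have cz: "continuous_on UNIV (dz G)" by (rule smooth_continuous[OF smooth_dz[OF s]])
  have "dzbar G = (\<lambda>z. \<mu> z * dz G z)" using G(2) by auto
  then have "mean_sq (dz G) \<le> k\<^sup>2 * mean_sq (dz G)"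
    using energy_identity[OF G(1) per ab] mean_sq_mult_le[OF cz \<mu>(1,2)] by simp
  moreover have "k\<^sup>2 < 1" using \<mu>(3,4) by (simp add: abs_square_less_1)
  moreover have "0 \<le> mean_sq (dz G)" by (rule mean_sq_nonneg[OF cz])
  ultimately have n0: "mean_sq (dz G) = 0"
    by (metis dual_order.antisym mult_le_cancel_right1 not_le)
  have dper: "dz G (z + of_real (2 * pi)) = \<alpha> * dz G z" "dz G (z + of_real (2 * pi) * \<i>) = \<beta> * dz G z" for z
  proof -
    have c: "dir_deriv v (\<lambda>z. c * G z) z = c * dir_deriv v G z" for c v
      using dir_deriv_mult[OF smooth_const[of c] s, of v z] by (simp add: dir_deriv_const)
    show "dz G (z + of_real (2 * pi)) = \<alpha> * dz G z" "dz G (z + of_real (2 * pi) * \<i>) = \<beta> * dz G z"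
      unfolding dz_def dir_deriv_translate[OF s, symmetric] per c by (simp_all add: algebra_simps)
  qed
  have "(cmod (dz G z))\<^sup>2 = 0" for z
  proof (rule mean_eq_0_imp[of "\<lambda>z. (cmod (dz G z))\<^sup>2"])
    show "mean (\<lambda>z. (cmod (dz G z))\<^sup>2) = 0" using n0 by (simp add: mean_sq_def)
    show "periodic (\<lambda>z. (cmod (dz G z))\<^sup>2)"
      using dper ab by (simp add: periodic_def norm_mult)
  qed (auto intro: cont_cmod_sq cz)
  then have "dz G z = 0" for z by simp
  then have "(G has_derivative (\<lambda>v. 0)) (at z)" for z
    using smooth_derivative_wirtinger[OF s, of z] by (simp add: G(2))
  then show ?thesis
    using has_derivative_zero_unique_connected[of UNIV G] by blast
qed

section \<open>A solution without critical points\<close>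

text \<open>
  The equation for \<open>f\<close> says that \<open>f (dz + \<mu> d zbar)\<close> is a closed form. A logarithm of a solution without zeros
  satisfies \<open>\<phi>\<^bsub>zbar\<^esub> = \<mu> \<phi>\<^bsub>z\<^esub> + \<mu>\<^bsub>z\<^esub>\<close>, which can be solved, so \<open>f\<close> is compared with \<open>exp \<phi>\<close>. In the proof \<open>\<psi> = - \<phi>\<close>, and
  the quotient \<open>G = f exp \<psi>\<close> is constant by \<open>beltrami_constant\<close>.
\<close>

lemma closed_section_nonvanishing:
  assumes \<mu>: "smooth_periodic \<mu>" "\<And>z. cmod (\<mu> z) \<le> k" "0 \<le> k" "k < 1"
    and f: "smooth_periodic f" "\<And>z. dzbar f z = dz (\<lambda>w. \<mu> w * f w) z"
    and "f z0 \<noteq> 0"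
  shows "f z \<noteq> 0"
proof -
  have s\<mu>: "smooth \<mu>" and sf: "smooth f" using \<mu>(1) f(1) by (auto simp: smooth_periodic_def)
  obtain p b where p: "smooth_periodic p" "\<And>z. dzbar p z + b = \<mu> z * (dz p z - cnj b) + dz \<mu> z"
    using beltrami_inhomogeneous[OF \<mu> smooth_periodic_dz[OF \<mu>(1)]] by blast
  define \<psi> where "\<psi> z = (- 1) * p z + (cnj b * z + (- b) * cnj z)" for z
  note sp = smooth_periodic_smooth[OF p(1)]
  have s\<psi>: "smooth \<psi>"
    unfolding \<psi>_def by (intro smooth_add smooth_mult smooth_const sp smooth_wirtinger)
  have dz\<psi>: "dz \<psi> z = - dz p z + cnj b" and dzb\<psi>: "dzbar \<psi> z = - dzbar p z - b" for z
  proof -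
    have 1: "smooth (\<lambda>z. (- 1) * p z)" by (intro smooth_mult smooth_const sp)
    show "dz \<psi> z = - dz p z + cnj b" "dzbar \<psi> z = - dzbar p z - b"
      unfolding \<psi>_def dz_add[OF 1 smooth_wirtinger] dzbar_add[OF 1 smooth_wirtinger]
        dz_mult[OF smooth_const sp] dzbar_mult[OF smooth_const sp] dz_linear dzbar_linear dz_const dzbar_const
      by simp_all
  qed
  define e where "e z = exp (\<psi> z)" for z
  have se: "smooth e" unfolding e_def by (rule smooth_exp[OF s\<psi>])
  have dze: "dz e z = e z * dz \<psi> z" and dzbe: "dzbar e z = e z * dzbar \<psi> z" for z
    unfolding e_def by (simp_all add: dz_exp dzbar_exp s\<psi>)
  define G where "G z = f z * e z" for z
  have "commuting_partials \<psi>"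
    unfolding \<psi>_def
    by (intro commuting_partials_add commuting_partials_periodic[OF smooth_periodic_cmult[OF p(1)]]
        commuting_partials_linear[OF bounded_linear_wirtinger])
  then have G: "commuting_partials G"
    unfolding G_def e_def by (intro commuting_partials_mult commuting_partials_exp commuting_partials_periodic[OF f(1)])
  have "dzbar G z = \<mu> z * dz G z" for z
  proof -
    have bz: "dzbar p z = \<mu> z * (dz p z - cnj b) + dz \<mu> z - b" using p(2)[of z] by (simp add: eq_diff_eq)
    show ?thesis
      unfolding G_def dz_mult[OF sf se] dzbar_mult[OF sf se] f(2) dz_mult[OF s\<mu> sf] dze dzbe dz\<psi> dzb\<psi> bz
      by (simp add: algebra_simps)
  qed
  note bel = this
  let ?\<alpha> = "exp (of_real (2 * pi) * (cnj b - b))"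
  let ?\<beta> = "exp (of_real (2 * pi) * \<i> * (cnj b + b))"
  have pp: "p (z + of_real (2 * pi)) = p z" "p (z + of_real (2 * pi) * \<i>) = p z"
    and fp: "f (z + of_real (2 * pi)) = f z" "f (z + of_real (2 * pi) * \<i>) = f z" for z
    using p(1) f(1) by (simp_all add: smooth_periodic_def periodic_def)
  have "\<psi> (z + of_real (2 * pi)) = of_real (2 * pi) * (cnj b - b) + \<psi> z"
    "\<psi> (z + of_real (2 * pi) * \<i>) = of_real (2 * pi) * \<i> * (cnj b + b) + \<psi> z" for z
    unfolding \<psi>_def pp by (simp_all add: algebra_simps)
  then have per: "G (z + of_real (2 * pi)) = ?\<alpha> * G z" "G (z + of_real (2 * pi) * \<i>) = ?\<beta> * G z" for z
    unfolding G_def fp e_def by (simp_all add: exp_add)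
  have "cmod ?\<alpha> = 1" "cmod ?\<beta> = 1" by (simp_all add: norm_exp_eq_Re)
  from beltrami_constant[OF smooth_periodic_cont[OF \<mu>(1)] \<mu>(2-4) G bel per this]
  have "G z = G z0" by metis
  moreover have "G z0 \<noteq> 0" using assms(7) by (simp add: G_def e_def)
  ultimately show ?thesis by (auto simp: G_def)
qed

text \<open>
  The map is \<open>z + h\<close> with \<open>h = p + b zbar - cnj b z\<close> and \<open>h\<^bsub>zbar\<^esub> = \<mu> h\<^bsub>z\<^esub> + \<mu>\<close>, and \<open>f\<close> is its derivative with respect to \<open>z\<close>.
  Commuting \<open>\<partial>\<^bsub>z\<^esub>\<close> with \<open>\<partial>\<^bsub>zbar\<^esub>\<close> shows that \<open>f\<close> solves the equation of the previous lemma.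
\<close>

lemma beltrami_homeomorphism_lift:
  assumes \<mu>: "smooth_periodic \<mu>" "\<And>z. cmod (\<mu> z) \<le> k" "0 \<le> k" "k < 1"
  obtains a b p f where "smooth_periodic p" "smooth_periodic f" "\<And>z. f z \<noteq> 0"
    "\<And>z. ((\<lambda>z. a * z + b * cnj z + p z) has_derivative (\<lambda>v. f z * (v + \<mu> z * cnj v))) (at z)"
proof -
  obtain p b where p: "smooth_periodic p" "\<And>z. dzbar p z + b = \<mu> z * (dz p z - cnj b) + \<mu> z"
    using beltrami_inhomogeneous[OF \<mu> \<mu>(1)] by blast
  define a where "a = 1 - cnj b"
  define f where "f z = dz p z + a" for z
  have spf: "smooth_periodic f"
    unfolding f_def by (intro smooth_periodic_add smooth_periodic_dz smooth_periodic_const p)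
  have bel: "dzbar p z + b = \<mu> z * f z" for z
    using p(2)[of z] by (simp add: f_def a_def algebra_simps)
  have "dzbar f z = dz (\<lambda>w. \<mu> w * f w) z" for z
  proof -
    have "dzbar f z = dzbar (dz p) z"
      unfolding f_def by (simp add: dzbar_add smooth_dz smooth_periodic_smooth p(1) smooth_const dzbar_const)
    also have "\<dots> = dz (dzbar p) z" by (rule dz_dzbar_commute[OF p(1)])
    also have "\<dots> = dz (\<lambda>w. dzbar p w + b) z"
      by (simp add: dz_add smooth_periodic_smooth[OF smooth_periodic_dzbar[OF p(1)]] smooth_const dz_const)
    finally show ?thesis by (simp only: bel)
  qed
  moreover have "\<exists>z0. f z0 \<noteq> 0"
  proof (rule ccontr)
    assume "\<not> (\<exists>z0. f z0 \<noteq> 0)"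
    then have f0: "f z = 0" for z by blast
    have m: "mean (\<lambda>z. h z + c) = mean h + c" if "smooth_periodic h" for h c
      by (simp add: mean_add smooth_periodic_cont[OF that] mean_const)
    have "mean f = a" unfolding f_def m[OF smooth_periodic_dz[OF p(1)]] mean_dz[OF p(1)] by simp
    then have "a = 0" using f0 mean_const[of 0] by (metis ext)
    moreover have "mean (\<lambda>z. dzbar p z + b) = b"
      unfolding m[OF smooth_periodic_dzbar[OF p(1)]] mean_dzbar[OF p(1)] by simp
    then have "b = 0" unfolding bel f0 by (simp add: mean_const)
    ultimately show False by (simp add: a_def)
  qed
  ultimately have nz: "f z \<noteq> 0" for z
    using closed_section_nonvanishing[OF \<mu> spf] by blast
  have "((\<lambda>z. a * z + b * cnj z + p z) has_derivative (\<lambda>v. f z * (v + \<mu> z * cnj v))) (at z)" for z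
  proof -
    have "((\<lambda>z. a * z + b * cnj z + p z) has_derivative
        (\<lambda>v. (a * v + b * cnj v) + (dz p z * v + dzbar p z * cnj v))) (at z)"
      by (intro has_derivative_add bounded_linear_imp_has_derivative[OF bounded_linear_wirtinger]
          smooth_derivative_wirtinger smooth_periodic_smooth p)
    moreover have "(a * v + b * cnj v) + (dz p z * v + dzbar p z * cnj v) = f z * (v + \<mu> z * cnj v)" for v
    proof -
      have "(a * v + b * cnj v) + (dz p z * v + dzbar p z * cnj v) = f z * v + (dzbar p z + b) * cnj v"
        by (simp add: f_def algebra_simps)
      then show ?thesis unfolding bel by (simp add: algebra_simps)
    qed
    ultimately show ?thesis by simp
  qed
  then show thesis using that[OF p(1) spf nz] by blast
qed

section \<open>Locally expanding maps\<close>

text \<open>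
  The boundary of the ball is mapped outside the ball of radius \<open>m r\<close>. Inside that ball, the image of the open
  ball is therefore the same as that of the closed one: it is open by invariance of domain and
  closed by compactness, and the conclusion follows by connectedness.
\<close>

lemma expanding_image_ball:
  fixes H :: "'a::euclidean_space \<Rightarrow> 'a"
  assumes cont: "continuous_on UNIV H" and "0 < m" "0 < r"
    and exp: "\<And>x y. dist x y \<le> 2 * r \<Longrightarrow> m * dist x y \<le> dist (H x) (H y)"
  shows "ball (H z) (m * r) \<subseteq> H ` ball z r"
proof -
  let ?W = "ball (H z) (m * r)"
  have inj: "inj_on H (cball z r)"
  proof (rule inj_onI)
    fix x y assume xy: "x \<in> cball z r" "y \<in> cball z r" "H x = H y"
    have "dist x y \<le> 2 * r"
      using xy(1,2) dist_triangle2[of x y z] by (auto simp: dist_commute)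
    then have "m * dist x y \<le> 0" using exp[of x y] xy(3) by simp
    then show "x = y" using \<open>0 < m\<close> by (simp add: mult_le_0_iff)
  qed
  have op: "open (H ` ball z r)"
    by (rule invariance_of_domain) (auto intro: continuous_on_subset[OF cont] inj_on_subset[OF inj])
  have eq: "?W \<inter> H ` ball z r = ?W \<inter> H ` cball z r"
  proof
    show "?W \<inter> H ` cball z r \<subseteq> ?W \<inter> H ` ball z r"
    proof
      fix y assume "y \<in> ?W \<inter> H ` cball z r"
      then obtain x where x: "x \<in> cball z r" "y = H x" "H x \<in> ?W" by blast
      have "dist z x \<noteq> r" using exp[of z x] x \<open>0 < r\<close> by auto
      then show "y \<in> ?W \<inter> H ` ball z r" using x by auto
    qed
  qed auto
  have cl: "closed (H ` cball z r)"
    by (intro compact_imp_closed compact_continuous_image compact_cball continuous_on_subset[OF cont]) auto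
  have "?W \<inter> H ` ball z r = {} \<or> ?W \<inter> H ` ball z r = ?W"
    using connected_clopen[THEN iffD1, OF connected_ball[of "H z" "m * r"], rule_format, of "?W \<inter> H ` ball z r"]
      openin_open_Int[OF op, of ?W] closedin_closed_Int[OF cl, of ?W] unfolding eq by auto
  moreover have "H z \<in> ?W \<inter> H ` ball z r" using assms(2,3) by auto
  ultimately show ?thesis by blast
qed

text \<open>
  The map is a covering. Preimages of one point have distance at least \<open>\<delta>\<close>, and the inverse
  branches near each of them exist on balls of a radius that is the same for all points, by
  the previous lemma. Lifting the identity through the covering gives the inverse; that it is also a left inverse is
  the uniqueness of lifts.
\<close>

lemma expanding_imp_bij:
  fixes H :: "'a::euclidean_space \<Rightarrow> 'a"
  assumes cont: "continuous_on UNIV H" and m: "0 < m" and d: "0 < \<delta>"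
    and exp: "\<And>x y. dist x y < \<delta> \<Longrightarrow> m * dist x y \<le> dist (H x) (H y)"
  obtains g where "continuous_on UNIV g" "\<And>y. H (g y) = y" "\<And>x. g (H x) = x"
proof -
  define r where "r = \<delta> / 4"
  have r: "0 < r" "2 * r < \<delta>" using d by (auto simp: r_def)
  have img: "ball (H z) (m * r) \<subseteq> H ` ball z r" for z
    by (rule expanding_image_ball[OF cont m r(1)]) (rule exp, use r in simp)
  have mr: "0 < m * r" using m r by simp
  have same: "x = y" if "H x = H y" "dist x y < \<delta>" for x y
    using exp[OF that(2)] that(1) m by (simp add: mult_le_0_iff)
  have "open (range H)"
    unfolding open_contains_ball using img mr by blast
  moreover have "closed (range H)"
  proof -
    have "y \<in> range H" if y: "y \<in> closure (range H)" for y
    proof -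
      obtain z where "dist (H z) y < m * r"
        using y mr by (auto simp: closure_approachable)
      then show ?thesis using img[of z] by (auto simp: subset_iff)
    qed
    then have "closure (range H) = range H" using closure_subset by blast
    then show ?thesis by (metis closed_closure)
  qed
  ultimately have surj: "range H = UNIV" using clopen[of "range H"] by blast
  have cov: "covering_space UNIV H UNIV"
  proof (rule covering_spaceI[OF cont surj])
    fix y :: 'a
    let ?T = "ball y (m * r)"
    let ?u = "\<lambda>x. ball x (2 * r) \<inter> H -` ?T"
    let ?v = "?u ` {x. H x = y}"
    have ope: "open (?u x)" for x
      using cont by (intro open_Int open_ball) (simp add: continuous_on_open_vimage)
    have "\<Union> ?v = UNIV \<inter> H -` ?T"
    proof
      show "UNIV \<inter> H -` ?T \<subseteq> \<Union> ?v"
      proof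
        fix w assume w: "w \<in> UNIV \<inter> H -` ?T"
        then have "y \<in> H ` ball w r" using img[of w] by (auto simp: dist_commute subset_iff)
        then obtain x where x: "dist w x < r" "H x = y" by auto
        then have "w \<in> ?u x" using w r by (auto simp: dist_commute)
        then show "w \<in> \<Union> ?v" using x(2) by blast
      qed
    qed auto
    moreover have "pairwise disjnt ?v"
    proof -
      have "x = x'" if "H x = y" "H x' = y" "w \<in> ?u x" "w \<in> ?u x'" for x x' w
      proof -
        have "dist x x' < \<delta>"
          using that(3,4) dist_triangle2[of x x' w] by (auto simp: r_def)
        then show ?thesis using same that by simp
      qed
      then show ?thesis unfolding pairwise_def disjnt_def by blast
    qed
    moreover have "\<exists>q. homeomorphism (?u x) ?T H q" if x: "H x = y" for x
    proof -
      have inj: "inj_on H (?u x)"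
      proof (rule inj_onI)
        fix w w' assume "w \<in> ?u x" "w' \<in> ?u x" "H w = H w'"
        moreover from this have "dist w w' < \<delta>"
          using dist_triangle2[of w w' x] by (auto simp: r_def dist_commute)
        ultimately show "w = w'" using same by simp
      qed
      have "H ` ?u x = ?T"
      proof
        show "?T \<subseteq> H ` ?u x"
        proof
          fix t assume t: "t \<in> ?T"
          then obtain w where "w \<in> ball x r" "t = H w" using img[of x] x by auto
          then show "t \<in> H ` ?u x" using t r by auto
        qed
      qed auto
      then show ?thesis
        using invariance_of_domain_homeomorphism[OF ope continuous_on_subset[OF cont] _ inj] by (metis order_refl subset_UNIV)
    qed
    ultimately show "\<exists>T. y \<in> T \<and> openin (top_of_set UNIV) T \<and> (\<exists>v. \<Union>v = UNIV \<inter> H -` T \<and>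
        (\<forall>u\<in>v. openin (top_of_set UNIV) u) \<and> pairwise disjnt v \<and> (\<forall>u\<in>v. \<exists>q. homeomorphism u T H q))"
      using mr ope by (intro exI[of _ ?T] conjI exI[of _ ?v]) auto
  qed
  obtain g where g: "continuous_on UNIV g" "g (H 0) = 0" "\<And>y. H (g y) = y"
    by (rule covering_space_lift_strong[OF cov, of 0 "H 0" UNIV "\<lambda>y. y"])
      (auto intro: convex_imp_simply_connected convex_imp_locally_path_connected)
  have "g (H x) = x" for x
    by (rule covering_space_lift_unique[OF cov, of "\<lambda>x. g (H x)" 0 "\<lambda>x. x" UNIV H])
      (auto simp: g cont intro: continuous_on_compose2[OF g(1) cont])
  then show thesis using that g by blast
qed

section \<open>From the solution to a diffeomorphism of tori\<close>

lemma smooth_periodic_lipschitz: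
  assumes "smooth_periodic f"
  obtains B where "B > 0" "\<And>x y. cmod (f x - f y) \<le> B * cmod (x - y)"
proof -
  note s = smooth_periodic_smooth[OF assms]
  have bd: "\<exists>B>0. \<forall>z. cmod (dir_deriv v f z) \<le> B" for v
    using periodic_bounded[of "dir_deriv v f"] smooth_periodic_dir_deriv[OF assms, of v] smooth_periodic_cont
    by (metis smooth_periodic_def)
  obtain B1 B2 where B: "B1 > 0" "B2 > 0" "\<And>z. cmod (dir_deriv 1 f z) \<le> B1" "\<And>z. cmod (dir_deriv \<i> f z) \<le> B2"
    using bd[of 1] bd[of \<i>] by blast
  have "cmod (f x - f y) \<le> (B1 + B2) * cmod (x - y)" for x y
  proof (rule differentiable_bound[where S = UNIV and f' = "\<lambda>z v. dir_deriv v f z"])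
    show "onorm (\<lambda>v. dir_deriv v f z) \<le> B1 + B2" for z
    proof (rule onorm_bound)
      fix v
      have "cmod (dir_deriv v f z) \<le> \<bar>Re v\<bar> * cmod (dir_deriv 1 f z) + \<bar>Im v\<bar> * cmod (dir_deriv \<i> f z)"
        unfolding dir_deriv_real_linear[OF s, of v z]
        by (rule order_trans[OF norm_triangle_ineq]) (simp add: norm_mult)
      also have "\<dots> \<le> cmod v * B1 + cmod v * B2"
        by (intro add_mono mult_mono abs_Re_le_cmod abs_Im_le_cmod B norm_ge_zero)
      finally show "cmod (dir_deriv v f z) \<le> (B1 + B2) * cmod v" by (simp add: algebra_simps)
    qed (use B in simp)
  qed (auto intro: smooth_has_derivative[OF s])
  then show thesis using that[of "B1 + B2"] B by simp
qed

lemma cmod_beltrami_form_ge: "cmod m \<le> k \<Longrightarrow> (1 - k) * cmod v \<le> cmod (v + m * cnj v)"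
  using norm_triangle_ineq4[of "v + m * cnj v" "m * cnj v"] mult_right_mono[of "cmod m" k "cmod v"]
  by (simp add: norm_mult algebra_simps)

text \<open>
  The derivative of \<open>H\<close> expands by at least the factor \<open>2 m\<close>, because \<open>|f|\<close> is bounded below by periodicity and
  \<open>|\<mu>| \<le> k\<close>. The derivative is also Lipschitz continuous. So on balls of a fixed radius \<open>\<delta>\<close>, \<open>H\<close> differs from its
  linearization by a map with Lipschitz constant \<open>m\<close>.
\<close>

lemma beltrami_expanding:
  assumes \<mu>: "smooth_periodic \<mu>" "\<And>z. cmod (\<mu> z) \<le> k" "k < 1"
    and f: "smooth_periodic f" "\<And>z. f z \<noteq> 0"
    and H: "\<And>z. (H has_derivative (\<lambda>v. f z * (v + \<mu> z * cnj v))) (at z)"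
  obtains m \<delta> where "0 < m" "0 < \<delta>" "\<And>x y. dist x y < \<delta> \<Longrightarrow> m * dist x y \<le> dist (H x) (H y)"
proof -
  have "smooth_periodic (\<lambda>z. inverse (f z))"
    using f by (simp add: smooth_periodic_def periodic_def smooth_inverse)
  then obtain C where C: "C > 0" "\<And>z. cmod (inverse (f z)) \<le> C"
    using periodic_bounded smooth_periodic_cont smooth_periodic_def by metis
  have fC: "1 / C \<le> cmod (f z)" for z
  proof -
    have "1 = cmod (inverse (f z)) * cmod (f z)" using f(2)[of z] by (simp add: norm_inverse)
    also have "\<dots> \<le> C * cmod (f z)" by (intro mult_right_mono C norm_ge_zero)
    finally show ?thesis using C(1) by (simp only: pos_divide_le_eq mult.commute)
  qed
  define m where "m = (1 - k) / (2 * C)"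
  have m: "0 < m" using C \<mu>(3) by (simp add: m_def)
  have lower: "2 * m * cmod v \<le> cmod (f z * (v + \<mu> z * cnj v))" for z v
  proof -
    have "2 * m * cmod v = 1 / C * ((1 - k) * cmod v)" using C(1) by (simp add: m_def field_simps)
    also have "\<dots> \<le> cmod (f z) * cmod (v + \<mu> z * cnj v)"
      using \<mu>(3) by (intro mult_mono fC cmod_beltrami_form_ge \<mu>(2)) auto
    finally show ?thesis by (simp add: norm_mult)
  qed
  have spg: "smooth_periodic (\<lambda>z. f z * \<mu> z)" by (rule smooth_periodic_mult[OF f(1) \<mu>(1)])
  obtain Bf Bg where B: "Bf > 0" "Bg > 0" "\<And>x y. cmod (f x - f y) \<le> Bf * cmod (x - y)"
    "\<And>x y. cmod (f x * \<mu> x - f y * \<mu> y) \<le> Bg * cmod (x - y)"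
    using smooth_periodic_lipschitz[OF f(1)] smooth_periodic_lipschitz[OF spg] by metis
  define \<delta> where "\<delta> = m / (Bf + Bg)"
  have d: "0 < \<delta>" "(Bf + Bg) * \<delta> = m" using m B by (simp_all add: \<delta>_def)
  have "m * dist x y \<le> dist (H x) (H y)" if xy: "dist x y < \<delta>" for x y
  proof -
    let ?q = "\<lambda>w. H w - (f y * w + f y * \<mu> y * cnj w)"
    have "cmod (?q x - ?q y) \<le> m * cmod (x - y)"
    proof (rule differentiable_bound[where S = "ball y \<delta>" and f' = "\<lambda>w v. f w * (v + \<mu> w * cnj v) - (f y * v + f y * \<mu> y * cnj v)"])
      fix w assume w: "w \<in> ball y \<delta>"
      show "(?q has_derivative (\<lambda>v. f w * (v + \<mu> w * cnj v) - (f y * v + f y * \<mu> y * cnj v))) (at w within ball y \<delta>)"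
        by (intro has_derivative_diff has_derivative_at_withinI[OF H]
            bounded_linear_imp_has_derivative[OF bounded_linear_wirtinger])
      have wy: "cmod (w - y) \<le> \<delta>" using w by (simp add: dist_norm norm_minus_commute)
      show "onorm (\<lambda>v. f w * (v + \<mu> w * cnj v) - (f y * v + f y * \<mu> y * cnj v)) \<le> m"
      proof (rule onorm_bound)
        fix v
        have "f w * (v + \<mu> w * cnj v) - (f y * v + f y * \<mu> y * cnj v) =
            (f w - f y) * v + (f w * \<mu> w - f y * \<mu> y) * cnj v" by (simp add: algebra_simps)
        also have "cmod \<dots> \<le> cmod (f w - f y) * cmod v + cmod (f w * \<mu> w - f y * \<mu> y) * cmod v"
          by (rule order_trans[OF norm_triangle_ineq]) (simp add: norm_mult)
        also have "\<dots> \<le> (Bf * \<delta>) * cmod v + (Bg * \<delta>) * cmod v"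
          using B(1,2) by (intro add_mono mult_right_mono order_trans[OF B(3)] order_trans[OF B(4)] mult_left_mono wy) auto
        also have "\<dots> = m * cmod v" using d(2) by (simp add: algebra_simps flip: d(2))
        finally show "cmod (f w * (v + \<mu> w * cnj v) - (f y * v + f y * \<mu> y * cnj v)) \<le> m * cmod v" .
      qed (use m in simp)
    qed (use xy d in \<open>auto simp: dist_commute\<close>)
    moreover have "H x - H y = (?q x - ?q y) + f y * ((x - y) + \<mu> y * cnj (x - y))"
      by (simp add: algebra_simps)
    moreover have "2 * m * cmod (x - y) \<le> cmod (f y * ((x - y) + \<mu> y * cnj (x - y)))" by (rule lower)
    ultimately have "m * cmod (x - y) \<le> cmod (H x - H y)"
      using norm_triangle_ineq4[of "H x - H y" "?q x - ?q y"] by (simp only: add_diff_cancel_left')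
    then show ?thesis by (simp add: dist_norm)
  qed
  then show thesis using that m d by blast
qed

text \<open>
  If the linear part has a nontrivial kernel, its range is contained in the line orthogonal to some \<open>n \<noteq> 0\<close>. Then the component
  of \<open>a z + b zbar + p z\<close> in the direction \<open>n\<close> comes from \<open>p\<close> alone and is bounded, contrary to surjectivity.
\<close>

lemma linear_part_injective:
  assumes p: "smooth_periodic p" and surj: "\<And>y. \<exists>z. a * z + b * cnj z + p z = y"
    and u: "a * u + b * cnj u = 0"
  shows "u = 0"
proof (rule ccontr)
  assume "u \<noteq> 0"
  define w where "w = a * (\<i> * u) + b * cnj (\<i> * u)"
  have im: "a * v + b * cnj v = of_real (Im (v / u)) * w" for v
  proof -
    define q where "q = v / u"
    have v: "v = q * u" using \<open>u \<noteq> 0\<close> by (simp add: q_def)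
    have "a * v + b * cnj v = of_real (Re q) * (a * u + b * cnj u) + of_real (Im q) * w"
      unfolding v w_def by (subst (1 2) complex_eq[of q]) (simp add: algebra_simps)
    then show ?thesis using u by (simp add: q_def)
  qed
  obtain n where n: "n \<noteq> 0" "Re (cnj n * w) = 0"
  proof (cases "w = 0")
    case True
    then show ?thesis using that[of 1] by simp
  next
    case False
    have "Re (cnj (\<i> * w) * w) = 0" by simp
    then show ?thesis using that[of "\<i> * w"] False by simp
  qed
  have 0: "Re (cnj n * (a * v + b * cnj v)) = 0" for v
  proof -
    have "Re (cnj n * (of_real t * w)) = t * Re (cnj n * w)" for t :: real by (simp add: algebra_simps)
    then show ?thesis unfolding im n by simp
  qed
  obtain B where B: "B > 0" "\<And>z. cmod (p z) \<le> B"
    using periodic_bounded[of p] p smooth_periodic_cont smooth_periodic_def by metis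
  \<comment> \<open>the point \<open>t n\<close> lies beyond the bound \<open>|n| B\<close> for the component in the direction \<open>n\<close>\<close>
  define t where "t = (cmod n * B + 1) / (cmod n)\<^sup>2"
  obtain z where z: "a * z + b * cnj z + p z = of_real t * n" using surj by blast
  have "Re (cnj n * (of_real t * n)) = t * (cmod n)\<^sup>2"
    by (simp add: cmod_power2) (simp add: power2_eq_square algebra_simps)
  also have "\<dots> = cmod n * B + 1" using n by (simp add: t_def)
  finally have "Re (cnj n * (a * z + b * cnj z + p z)) = cmod n * B + 1" by (simp only: z)
  moreover have "cnj n * (a * z + b * cnj z + p z) = cnj n * (a * z + b * cnj z) + cnj n * p z"
    by (rule distrib_left)
  ultimately have "Re (cnj n * p z) = cmod n * B + 1" using 0[of z] by (simp only: plus_complex.simps)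
  moreover have "Re (cnj n * p z) \<le> cmod n * B"
    using complex_Re_le_cmod[of "cnj n * p z"] mult_left_mono[OF B(2)[of z] norm_ge_zero[of n]]
    by (simp only: norm_mult complex_mod_cnj)
  ultimately show False by simp
qed

text \<open>
  The derivative of \<open>g\<close> is given by smooth functions \<open>A\<close>, \<open>B\<close> evaluated at \<open>g\<close>, so \<open>g\<close> gains one order of
  differentiability from each application of the chain rule.
\<close>

lemma smooth_beltrami_inverse:
  assumes \<mu>: "smooth \<mu>" "\<And>z. cmod (\<mu> z) < 1"
    and f: "smooth f" "\<And>z. f z \<noteq> 0"
    and H: "\<And>z. (H has_derivative (\<lambda>v. f z * (v + \<mu> z * cnj v))) (at z)"
    and g: "continuous_on UNIV g" "\<And>y. H (g y) = y"
  shows "smooth g"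
proof -
  define J where "J z = 1 - \<mu> z * cnj (\<mu> z)" for z
  have J: "J z \<noteq> 0" for z
  proof -
    have "cmod (\<mu> z * cnj (\<mu> z)) < 1"
      using \<mu>(2)[of z] by (simp add: norm_mult abs_square_less_1 flip: power2_eq_square)
    then show ?thesis by (auto simp: J_def)
  qed
  have sJ: "smooth J" unfolding J_def by (intro smooth_diff smooth_const smooth_mult smooth_cnj \<mu>)
  define A where "A z = inverse (f z * J z)" for z
  define B where "B z = - \<mu> z * inverse (cnj (f z) * J z)" for z
  have sA: "smooth A" unfolding A_def using f(2) J by (intro smooth_inverse smooth_mult f sJ) simp
  have sB: "smooth B" unfolding B_def using f(2) J
    by (intro smooth_mult smooth_uminus smooth_inverse smooth_cnj f sJ \<mu>) simp
  have der: "(g has_derivative (\<lambda>v. A (g y) * v + B (g y) * cnj v)) (at y)" for y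
  proof (rule has_derivative_inverse_basic[OF H bounded_linear_wirtinger])
    let ?z = "g y"
    have "A ?z * (f ?z * (v + \<mu> ?z * cnj v)) + B ?z * cnj (f ?z * (v + \<mu> ?z * cnj v)) = v" for v
    proof -
      have "A ?z * (f ?z * (v + \<mu> ?z * cnj v)) = (v + \<mu> ?z * cnj v) / J ?z"
        using f(2)[of ?z] J[of ?z] by (simp add: A_def field_simps)
      moreover have "B ?z * cnj (f ?z * (v + \<mu> ?z * cnj v)) = - \<mu> ?z * cnj (v + \<mu> ?z * cnj v) / J ?z"
        using f(2)[of ?z] J[of ?z] by (simp add: B_def field_simps)
      ultimately have "A ?z * (f ?z * (v + \<mu> ?z * cnj v)) + B ?z * cnj (f ?z * (v + \<mu> ?z * cnj v))
          = ((v + \<mu> ?z * cnj v) - \<mu> ?z * cnj (v + \<mu> ?z * cnj v)) / J ?z"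
        by (simp add: diff_divide_distrib)
      also have "(v + \<mu> ?z * cnj v) - \<mu> ?z * cnj (v + \<mu> ?z * cnj v) = v * J ?z"
        by (simp add: J_def algebra_simps)
      finally show ?thesis using J[of ?z] by simp
    qed
    then show "(\<lambda>v. A ?z * v + B ?z * cnj v) \<circ> (\<lambda>v. f ?z * (v + \<mu> ?z * cnj v)) = id"
      by (simp add: fun_eq_iff)
    show "continuous (at y) g" using g(1) by (simp add: continuous_on_eq_continuous_at)
    show "open UNIV" "y \<in> UNIV" "\<And>z. z \<in> UNIV \<Longrightarrow> H (g z) = z" by (auto simp: g)
  qed
  have "Ck_on n UNIV g" for n
  proof (induction n)
    case 0
    then show ?case using g by simp
  next
    case (Suc n)
    have cA: "Ck_on n UNIV (\<lambda>y. A (g y))" and cB: "Ck_on n UNIV (\<lambda>y. B (g y))"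
      using sA sB unfolding smooth_on_def by (blast intro: Ck_on_compose[OF _ Suc])+
    show ?case
      by (rule Ck_on_SucI[OF der])
        (rule Ck_on_add[OF Ck_on_mult[OF cA Ck_on_const] Ck_on_mult[OF cB Ck_on_const]])
  qed
  then show ?thesis by (simp add: smooth_on_def)
qed

lemma lattice0_eq: "\<Lambda>\<^sub>0 = {period m n |m n. True}"
proof -
  have "of_int m * of_real (2 * pi) + of_int n * (of_real (2 * pi) * \<i>) = period m n" for m n
    by (simp add: period_def complex_eq_iff)
  then show ?thesis by (simp add: \<Lambda>\<^sub>0_def lattice_gen_def)
qed

lemma independent_periods: "independent {complex_of_real (2 * pi), of_real (2 * pi) * \<i>}"
proof -
  have "of_real (2 * pi) * \<i> \<notin> span {complex_of_real (2 * pi)}"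
    by (auto simp: span_singleton complex_eq_iff)
  then have "independent {of_real (2 * pi) * \<i>, complex_of_real (2 * pi)}"
    by (intro independent_insertI) (auto simp: independent_empty)
  then show ?thesis by (metis insert_commute)
qed

lemma is_lattice_linear_image:
  assumes L: "linear L" and inj: "\<And>u. L u = 0 \<Longrightarrow> u = 0"
  shows "is_lattice (lattice_gen (L (of_real (2 * pi))) (L (of_real (2 * pi) * \<i>)))"
proof -
  have injL: "inj L" using L inj linear_injective_0 by blast
  have "complex_of_real (2 * pi) \<noteq> of_real (2 * pi) * \<i>" by (simp add: complex_eq_iff)
  then have "L (of_real (2 * pi)) \<noteq> L (of_real (2 * pi) * \<i>)" using injL by (simp add: inj_eq)
  moreover have "independent (L ` {complex_of_real (2 * pi), of_real (2 * pi) * \<i>})"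
    by (rule linear_independent_injective_image[OF L independent_periods inj_on_subset[OF injL subset_UNIV]])
  ultimately show ?thesis unfolding is_lattice_def by auto
qed

text \<open>
  The equivalence says that \<open>H\<close> descends to a map of the tori and that this map is injective. The maps \<open>H\<close> and \<open>g\<close>
  serve as lifts on the whole plane.
\<close>

lemma torus_diffeo_of_lift:
  assumes \<Lambda>: "is_lattice \<Lambda>" "is_lattice \<Lambda>'"
    and H: "smooth H" and g: "smooth g" "\<And>y. H (g y) = y"
    and equiv: "\<And>z w. H z - H w \<in> \<Lambda>' \<longleftrightarrow> z - w \<in> \<Lambda>"
  obtains \<Phi> where "\<And>z. \<Phi> (torus_proj \<Lambda> z) = torus_proj \<Lambda>' (H z)" "torus_diffeo \<Lambda> \<Lambda>' \<Phi>"
proof -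
  define \<Phi> where "\<Phi> p = torus_proj \<Lambda>' (H (SOME z. p = torus_proj \<Lambda> z))" for p
  have \<Phi>: "\<Phi> (torus_proj \<Lambda> z) = torus_proj \<Lambda>' (H z)" for z
  proof -
    have "torus_proj \<Lambda> z = torus_proj \<Lambda> (SOME w. torus_proj \<Lambda> z = torus_proj \<Lambda> w)"
      by (rule someI[of "\<lambda>w. torus_proj \<Lambda> z = torus_proj \<Lambda> w" z]) (rule refl)
    then have "H z - H (SOME w. torus_proj \<Lambda> z = torus_proj \<Lambda> w) \<in> \<Lambda>'"
      unfolding equiv by (simp only: torus_proj_eq_iff[OF \<Lambda>(1)])
    then show ?thesis unfolding \<Phi>_def by (metis torus_proj_eq_iff[OF \<Lambda>(2)])
  qed
  have inj: "inj_on \<Phi> (torus \<Lambda>)"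
  proof (rule inj_onI)
    fix p q assume pq: "p \<in> torus \<Lambda>" "q \<in> torus \<Lambda>" "\<Phi> p = \<Phi> q"
    then obtain z w where "p = torus_proj \<Lambda> z" "q = torus_proj \<Lambda> w" by (auto simp: torus_def)
    with pq(3) show "p = q"
      by (simp add: \<Phi> torus_proj_eq_iff[OF \<Lambda>(2)] torus_proj_eq_iff[OF \<Lambda>(1)] equiv)
  qed
  have proj': "torus_proj \<Lambda>' y = \<Phi> (torus_proj \<Lambda> (g y))" for y by (simp add: \<Phi> g)
  have "\<Phi> ` torus \<Lambda> = torus \<Lambda>'"
    using \<Phi> proj' unfolding torus_def by auto
  then have bij: "bij_betw \<Phi> (torus \<Lambda>) (torus \<Lambda>')" using inj by (simp add: bij_betw_def)
  have "inv_into (torus \<Lambda>) \<Phi> (torus_proj \<Lambda>' y) = torus_proj \<Lambda> (g y)" for y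
    by (rule inv_into_f_eq[OF inj]) (simp_all add: proj' torus_def)
  then have "local_lift \<Lambda>' \<Lambda> (inv_into (torus \<Lambda>) \<Phi>) UNIV g"
    by (simp add: local_lift_def smooth_continuous[OF g(1)])
  moreover have "local_lift \<Lambda> \<Lambda>' \<Phi> UNIV H"
    by (simp add: local_lift_def smooth_continuous[OF H] \<Phi>)
  ultimately have "torus_diffeo \<Lambda> \<Lambda>' \<Phi>"
    unfolding torus_diffeo_def torus_smooth_def using bij H g(1) by blast
  then show thesis using that \<Phi> by blast
qed

theorem theorem1p10:
  fixes \<sigma> :: "complex set \<Rightarrow> complex \<Rightarrow> complex"
  assumes "almost_complex_structure \<sigma>" and "smooth_acs \<sigma>" and "bounded_acs \<sigma>"
  shows "\<exists>\<Lambda> \<Phi>. is_lattice \<Lambda> \<and> torus_diffeo \<Lambda>\<^sub>0 \<Lambda> \<Phi> \<and> transforms_to_standard \<Lambda> \<Phi> \<sigma>"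
proof -
  define \<mu> where "\<mu> z = beltrami_coeff (\<sigma> (torus_proj \<Lambda>\<^sub>0 z))" for z
  have inT2: "torus_proj \<Lambda>\<^sub>0 z \<in> T2" for z by (simp add: T2_def torus_def)
  have \<mu>_spec: "cmod (\<mu> z) < 1 \<and> complex_linear_wrt (\<sigma> (torus_proj \<Lambda>\<^sub>0 z)) std_structure (beltrami_form (\<mu> z))" for z
    unfolding \<mu>_def beltrami_coeff_def
    by (rule theI'[OF complex_structure_beltrami_ex1])
      (use assms(1) inT2 in \<open>simp add: almost_complex_structure_def\<close>)
  have proj_period: "torus_proj \<Lambda>\<^sub>0 (z + period m n) = torus_proj \<Lambda>\<^sub>0 z" for z m n
    by (simp add: torus_proj_eq_iff[OF is_lattice_\<Lambda>\<^sub>0]) (auto simp: lattice0_eq)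
  have period_gens: "period 1 0 = of_real (2 * pi)" "period 0 1 = of_real (2 * pi) * \<i>"
    by (simp_all add: period_def complex_eq_iff)
  have sp\<mu>: "smooth_periodic \<mu>"
    using assms(2) proj_period[of _ 1 0] proj_period[of _ 0 1]
    by (simp add: smooth_periodic_def periodic_def smooth_acs_def \<mu>_def[abs_def] period_gens)
  define k where "k = (SUP p\<in>T2. cmod (beltrami_coeff (\<sigma> p)))"
  have k1: "k < 1" using assms(3) by (simp add: bounded_acs_def k_def)
  have le1: "cmod (beltrami_coeff (\<sigma> p)) \<le> 1" if "p \<in> T2" for p
    using that \<mu>_spec by (auto simp: T2_def torus_def \<mu>_def less_imp_le)
  have k: "cmod (\<mu> z) \<le> k" for z
    unfolding \<mu>_def k_def by (rule cSUP_upper[OF inT2]) (rule bdd_aboveI2, rule le1)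
  have k0: "0 \<le> k" using k[of 0] norm_ge_zero[of "\<mu> 0"] by linarith
  obtain a b p f where p: "smooth_periodic p" and f: "smooth_periodic f" "\<And>z. f z \<noteq> 0"
    and der: "\<And>z. ((\<lambda>z. a * z + b * cnj z + p z) has_derivative (\<lambda>v. f z * (v + \<mu> z * cnj v))) (at z)"
    by (rule beltrami_homeomorphism_lift[OF sp\<mu> k k0 k1]) (rule that)
  define L where "L z = a * z + b * cnj z" for z
  define H where "H z = L z + p z" for z
  have derH: "(H has_derivative (\<lambda>v. f z * (v + \<mu> z * cnj v))) (at z)" for z
    using der by (simp add: H_def[abs_def] L_def)
  have sH: "smooth H"
    unfolding H_def L_def by (rule smooth_add[OF smooth_wirtinger smooth_periodic_smooth[OF p]])
  obtain m \<delta> where md: "0 < m" "0 < \<delta>" "\<And>x y. dist x y < \<delta> \<Longrightarrow> m * dist x y \<le> dist (H x) (H y)"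
    by (rule beltrami_expanding[OF sp\<mu> k k1 f derH]) (rule that)
  obtain g where g: "continuous_on UNIV g" "\<And>y. H (g y) = y" "\<And>x. g (H x) = x"
    by (rule expanding_imp_bij[OF smooth_continuous[OF sH] md(1,2)]) (rule md(3), assumption, rule that)
  have sg: "smooth g"
    by (rule smooth_beltrami_inverse[OF smooth_periodic_smooth[OF sp\<mu>] _ smooth_periodic_smooth[OF f(1)] f(2) derH g(1,2)])
      (use \<mu>_spec in blast)
  have linL: "linear L" unfolding L_def[abs_def] by (rule bounded_linear.linear[OF bounded_linear_wirtinger])
  have injL: "u = 0" if "L u = 0" for u
  proof (rule linear_part_injective[OF p])
    show "\<exists>z. a * z + b * cnj z + p z = y" for y
      using g(2)[of y] by (auto simp: H_def L_def)
    show "a * u + b * cnj u = 0" using that by (simp add: L_def)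
  qed
  define \<Lambda> where "\<Lambda> = lattice_gen (L (of_real (2 * pi))) (L (of_real (2 * pi) * \<i>))"
  have lat: "is_lattice \<Lambda>" unfolding \<Lambda>_def by (rule is_lattice_linear_image[OF linL injL])
  have \<Lambda>_eq: "\<Lambda> = {L (period m n) |m n. True}"
  proof -
    have "of_int m * L (of_real (2 * pi)) + of_int n * L (of_real (2 * pi) * \<i>) = L (period m n)" for m n
      by (simp add: L_def period_def Complex_eq algebra_simps)
    then show ?thesis by (simp add: \<Lambda>_def lattice_gen_def)
  qed
  have H_period: "H (w + period m n) = H w + L (period m n)" for w m n
    using periodic_shift[of p w m n] p by (simp add: H_def L_def smooth_periodic_def algebra_simps)
  have equiv: "H z - H w \<in> \<Lambda> \<longleftrightarrow> z - w \<in> \<Lambda>\<^sub>0" for z w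
  proof
    assume "H z - H w \<in> \<Lambda>"
    then obtain m n where "H z = H w + L (period m n)" by (auto simp: \<Lambda>_eq diff_eq_eq add.commute)
    then have "H z = H (w + period m n)" by (simp add: H_period)
    then have "z = w + period m n" using g(3) by metis
    then show "z - w \<in> \<Lambda>\<^sub>0" by (auto simp: lattice0_eq)
  next
    assume "z - w \<in> \<Lambda>\<^sub>0"
    then obtain m n where "z = w + period m n" by (auto simp: lattice0_eq diff_eq_eq add.commute)
    then show "H z - H w \<in> \<Lambda>" by (auto simp: H_period \<Lambda>_eq)
  qed
  obtain \<Phi> where \<Phi>: "\<And>z. \<Phi> (torus_proj \<Lambda>\<^sub>0 z) = torus_proj \<Lambda> (H z)" "torus_diffeo \<Lambda>\<^sub>0 \<Lambda> \<Phi>"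
    by (rule torus_diffeo_of_lift[OF is_lattice_\<Lambda>\<^sub>0 lat sH sg g(2) equiv]) (rule that)
  have "transforms_to_standard \<Lambda> \<Phi> \<sigma>"
    unfolding transforms_to_standard_def
  proof
    fix q assume "q \<in> T2"
    then obtain z where z: "q = torus_proj \<Lambda>\<^sub>0 z" by (auto simp: T2_def torus_def)
    let ?D = "\<lambda>v. f z * beltrami_form (\<mu> z) v"
    have "local_lift \<Lambda>\<^sub>0 \<Lambda> \<Phi> UNIV H"
      by (simp add: local_lift_def smooth_continuous[OF sH] \<Phi>)
    then have "torus_has_derivative \<Lambda>\<^sub>0 \<Lambda> \<Phi> ?D q"
      unfolding torus_has_derivative_def beltrami_form_def using z derH by blast
    moreover have "complex_linear_wrt (\<sigma> q) std_structure ?D"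
    proof -
      have lin: "linear ?D"
        using has_derivative_linear[OF derH] by (simp add: beltrami_form_def)
      have "beltrami_form (\<mu> z) (\<sigma> q v) = \<i> * beltrami_form (\<mu> z) v" for v
        using \<mu>_spec[of z] by (simp add: complex_linear_wrt_def std_structure_def z)
      then show ?thesis using lin by (simp add: complex_linear_wrt_def std_structure_def)
    qed
    ultimately show "\<exists>D. torus_has_derivative \<Lambda>\<^sub>0 \<Lambda> \<Phi> D q \<and> complex_linear_wrt (\<sigma> q) std_structure D"
      by blast
  qed
  then show ?thesis using lat \<Phi>(2) by blast
qed

end
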